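(* Let $\mu_{1}$ and $\mu_{2}$ be two Borel probability measures on $\mathbb{T}=\{\zeta\in\mathbb{C}:|\zeta|=1\}$, and let $I\subset\mathbb{T}$ be an open arc with endpoints $\alpha,\beta$. If $\alpha$ and $\beta$ are atoms of the free multiplicative convolution $\mu_{1}\boxtimes\mu_{2}$, and $(\mu_{1}\boxtimes\mu_{2})(I)=0$, then either $\mu_{1}$ or $\mu_{2}$ is a point mass.
   Context: A point mass is a measure $\delta_\zeta$ (unit mass at a single point $\zeta$); an atom of $\mu$ is a point $\zeta$ with $\mu(\{\zeta\})>0$. A $W^*$-probability space $(\mathcal{A},\tau)$ is a von Neumann algebra $\mathcal A$ with a faithful normal tracial state $\tau$. The distribution of a unitary $u\in\mathcal{A}$ is the probability measure $\mu$ on $\mathbb{T}$ with $\tau(u^n)=\int_{\mathbb{T}}\zeta^n\,d\mu(\zeta)$ for all $n\in\mathbb{Z}$. Unitaries $u,v$ are freely independent if $\tau(a_1a_2\cdots a_n)=0$ whenever $n\ge1$, $\tau(a_k)=0$ for all $k$, and the $a_k$ belong alternately to the von Neumann algebras generated by $u$ and by $v$ (consecutive elements in different algebras). The free multiplicative convolution $\mu_1\boxtimes\mu_2$ of probability measures $\mu_1,\mu_2$ on $\mathbb{T}$ is the distribution of $uv$, where $u,v$ are freely independent unitaries with distributions $\mu_1$ and $\mu_2$ respectively; it depends only on $\mu_1,\mu_2$. Analytically, set $\psi_{\mu}(z)=\int_{\mathbb{T}}\frac{tz}{1-tz}\,d\mu(t)$ and $\eta_\mu(z)=\frac{\psi_\mu(z)}{1+\psi_\mu(z)}$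 for $|z|<1$. When $\int_{\mathbb T}\zeta\,d\mu_1(\zeta)\ne0\ne\int_{\mathbb T}\zeta\,d\mu_2(\zeta)$, $\mu_1\boxtimes\mu_2$ is characterized by $\eta_{\mu_{1}\boxtimes\mu_{2}}^{-1}(w)=\frac{1}{w}\eta_{\mu_{1}}^{-1}(w)\eta_{\mu_{2}}^{-1}(w)$ for $w\neq0$ in a neighborhood of $0$, where $\eta_\mu^{-1}$ is the local inverse of $\eta_\mu$ with $\eta_\mu^{-1}(0)=0$. *)

theory Defs
  imports "HOL-Probability.Probability"
begin

section \<open>Complex Hilbert spaces and von Neumann algebras\<close>

text \<open>The real inner product is required to be the real part of the complex one, so that
  norm, topology and completeness are the ones of the underlying real Hilbert space.
  \<open>cinner\<close> is linear in its first argument.\<close>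

class complex_hilbert_space = real_inner + complete_space +
  fixes scaleC :: "complex \<Rightarrow> 'a \<Rightarrow> 'a"
    and cinner :: "'a \<Rightarrow> 'a \<Rightarrow> complex"
  assumes scaleC_add_right: "scaleC c (x + y) = scaleC c x + scaleC c y"
    and scaleC_add_left: "scaleC (c + d) x = scaleC c x + scaleC d x"
    and scaleC_scaleC: "scaleC c (scaleC d x) = scaleC (c * d) x"
    and scaleC_of_real: "scaleC (complex_of_real r) x = scaleR r x"
    and cinner_commute: "cinner x y = cnj (cinner y x)"
    and cinner_add_left: "cinner (x + y) z = cinner x z + cinner y z"
    and cinner_scaleC_left: "cinner (scaleC c x) y = c * cinner x y"
    and Re_cinner: "Re (cinner x y) = inner x y"

definition bounded_operators :: "('h::complex_hilbert_space \<Rightarrow> 'h) set" where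
  "bounded_operators =
     {a. bounded_linear a \<and> (\<forall>c x. a (scaleC c x) = scaleC c (a x))}"

definition is_adjoint :: "('h::complex_hilbert_space \<Rightarrow> 'h) \<Rightarrow> ('h \<Rightarrow> 'h) \<Rightarrow> bool" where
  "is_adjoint a b \<longleftrightarrow> (\<forall>x y. cinner (a x) y = cinner x (b y))"

definition commutant :: "('h::complex_hilbert_space \<Rightarrow> 'h) set \<Rightarrow> ('h \<Rightarrow> 'h) set" where
  "commutant S = {b \<in> bounded_operators. \<forall>a\<in>S. a \<circ> b = b \<circ> a}"

definition von_neumann_algebra :: "('h::complex_hilbert_space \<Rightarrow> 'h) set \<Rightarrow> bool" where
  "von_neumann_algebra A \<longleftrightarrow>
     A \<subseteq> bounded_operators \<and>
     (\<forall>a\<in>A. \<exists>b\<in>A. is_adjoint a b) \<and>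
     commutant (commutant A) = A"

definition vn_generated :: "('h::complex_hilbert_space \<Rightarrow> 'h) \<Rightarrow> ('h \<Rightarrow> 'h) set" where
  "vn_generated u = \<Inter> {B. von_neumann_algebra B \<and> u \<in> B}"

section \<open>W*-probability spaces\<close>

definition positive_operator :: "('h::complex_hilbert_space \<Rightarrow> 'h) \<Rightarrow> bool" where
  "positive_operator a \<longleftrightarrow> (\<forall>x. cinner (a x) x \<in> \<real> \<and> 0 \<le> Re (cinner (a x) x))"

definition op_le :: "('h::complex_hilbert_space \<Rightarrow> 'h) \<Rightarrow> ('h \<Rightarrow> 'h) \<Rightarrow> bool" where
  "op_le a b \<longleftrightarrow> positive_operator (\<lambda>x. b x - a x)"

definition selfadjoint_part :: "('h::complex_hilbert_space \<Rightarrow> 'h) set \<Rightarrow> ('h \<Rightarrow> 'h) set" where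
  "selfadjoint_part A = {a \<in> A. is_adjoint a a}"

definition is_op_lub ::
    "('h::complex_hilbert_space \<Rightarrow> 'h) set \<Rightarrow> ('h \<Rightarrow> 'h) set \<Rightarrow> ('h \<Rightarrow> 'h) \<Rightarrow> bool" where
  "is_op_lub A D s \<longleftrightarrow>
     s \<in> selfadjoint_part A \<and> (\<forall>d\<in>D. op_le d s) \<and>
     (\<forall>b\<in>selfadjoint_part A. (\<forall>d\<in>D. op_le d b) \<longrightarrow> op_le s b)"

definition state_on ::
    "('h::complex_hilbert_space \<Rightarrow> 'h) set \<Rightarrow> (('h \<Rightarrow> 'h) \<Rightarrow> complex) \<Rightarrow> bool" where
  "state_on A \<tau> \<longleftrightarrow>
     (\<forall>a\<in>A. \<forall>b\<in>A. \<tau> (\<lambda>x. a x + b x) = \<tau> a + \<tau> b) \<and>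
     (\<forall>c. \<forall>a\<in>A. \<tau> (\<lambda>x. scaleC c (a x)) = c * \<tau> a) \<and>
     (\<forall>a\<in>A. positive_operator a \<longrightarrow> \<tau> a \<in> \<real> \<and> 0 \<le> Re (\<tau> a)) \<and>
     \<tau> id = 1"

definition tracial_on ::
    "('h::complex_hilbert_space \<Rightarrow> 'h) set \<Rightarrow> (('h \<Rightarrow> 'h) \<Rightarrow> complex) \<Rightarrow> bool" where
  "tracial_on A \<tau> \<longleftrightarrow> (\<forall>a\<in>A. \<forall>b\<in>A. \<tau> (a \<circ> b) = \<tau> (b \<circ> a))"

definition faithful_on ::
    "('h::complex_hilbert_space \<Rightarrow> 'h) set \<Rightarrow> (('h \<Rightarrow> 'h) \<Rightarrow> complex) \<Rightarrow> bool" where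
  "faithful_on A \<tau> \<longleftrightarrow> (\<forall>a\<in>A. positive_operator a \<and> \<tau> a = 0 \<longrightarrow> a = (\<lambda>x. 0))"

text \<open>Normality: suprema of bounded upward directed sets of self-adjoint elements are preserved.
  States are real on self-adjoint elements, so taking real parts loses nothing.\<close>

definition normal_on ::
    "('h::complex_hilbert_space \<Rightarrow> 'h) set \<Rightarrow> (('h \<Rightarrow> 'h) \<Rightarrow> complex) \<Rightarrow> bool" where
  "normal_on A \<tau> \<longleftrightarrow>
     (\<forall>D s. D \<noteq> {} \<and> D \<subseteq> selfadjoint_part A \<and>
        (\<forall>a\<in>D. \<forall>b\<in>D. \<exists>c\<in>D. op_le a c \<and> op_le b c) \<and>
        is_op_lub A D s \<longrightarrow>
        Re (\<tau> s) = (SUP d\<in>D. Re (\<tau> d)))"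

definition wstar_probability_space ::
    "('h::complex_hilbert_space \<Rightarrow> 'h) set \<Rightarrow> (('h \<Rightarrow> 'h) \<Rightarrow> complex) \<Rightarrow> bool" where
  "wstar_probability_space A \<tau> \<longleftrightarrow>
     von_neumann_algebra A \<and> state_on A \<tau> \<and> faithful_on A \<tau> \<and> normal_on A \<tau> \<and> tracial_on A \<tau>"

definition unitary_operator :: "('h::complex_hilbert_space \<Rightarrow> 'h) \<Rightarrow> bool" where
  "unitary_operator u \<longleftrightarrow>
     u \<in> bounded_operators \<and> (\<exists>w. is_adjoint u w \<and> u \<circ> w = id \<and> w \<circ> u = id)"

section \<open>Free independence and free multiplicative convolution\<close>

text \<open>The list \<open>js\<close> records from which of the two algebras each factor is taken.\<close>

definition freely_independent ::
    "(('h::complex_hilbert_space \<Rightarrow> 'h) \<Rightarrow> complex) \<Rightarrow> ('h \<Rightarrow> 'h) \<Rightarrow> ('h \<Rightarrow> 'h) \<Rightarrow> bool" where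
  "freely_independent \<tau> u v \<longleftrightarrow>
     (\<forall>as js. as \<noteq> [] \<and> length js = length as \<and>
        (\<forall>k. Suc k < length as \<longrightarrow> js ! k \<noteq> js ! Suc k) \<and>
        (\<forall>k < length as.
           as ! k \<in> (if js ! k then vn_generated u else vn_generated v) \<and> \<tau> (as ! k) = 0)
        \<longrightarrow> \<tau> (foldr (\<circ>) as id) = 0)"

abbreviation circle :: "complex set" where
  "circle \<equiv> sphere 0 1"

definition circle_prob :: "complex measure \<Rightarrow> bool" where
  "circle_prob \<mu> \<longleftrightarrow> prob_space \<mu> \<and> sets \<mu> = sets (restrict_space borel circle)"

text \<open>Integer powers of a bijective operator; for a unitary, \<open>inv u\<close> is the adjoint.\<close>

definition op_powi :: "('h \<Rightarrow> 'h) \<Rightarrow> int \<Rightarrow> 'h \<Rightarrow> 'h" where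
  "op_powi u n = (if 0 \<le> n then u ^^ nat n else inv u ^^ nat (- n))"

definition unitary_distribution ::
    "(('h::complex_hilbert_space \<Rightarrow> 'h) \<Rightarrow> complex) \<Rightarrow> ('h \<Rightarrow> 'h) \<Rightarrow> complex measure \<Rightarrow> bool" where
  "unitary_distribution \<tau> u \<mu> \<longleftrightarrow>
     circle_prob \<mu> \<and> (\<forall>n::int. \<tau> (op_powi u n) = (\<integral>\<zeta>. \<zeta> powi n \<partial>\<mu>))"

text \<open>\<open>\<nu>\<close> is the free multiplicative convolution of \<open>\<mu>1\<close> and \<open>\<mu>2\<close>, realised by operators on
  the Hilbert space \<open>'h\<close>. As \<open>\<nu>\<close> does not depend on the realisation, a statement about
  the convolution is one about all \<open>'h\<close> and all \<open>\<nu>\<close> in this relation.\<close>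

definition is_free_mult_convolution ::
    "'h::complex_hilbert_space itself \<Rightarrow>
       complex measure \<Rightarrow> complex measure \<Rightarrow> complex measure \<Rightarrow> bool" where
  "is_free_mult_convolution _ \<mu>1 \<mu>2 \<nu> \<longleftrightarrow>
     (\<exists>(A :: ('h \<Rightarrow> 'h) set) \<tau> u v.
        wstar_probability_space A \<tau> \<and>
        u \<in> A \<and> v \<in> A \<and> unitary_operator u \<and> unitary_operator v \<and>
        freely_independent \<tau> u v \<and>
        unitary_distribution \<tau> u \<mu>1 \<and>
        unitary_distribution \<tau> v \<mu>2 \<and>
        unitary_distribution \<tau> (u \<circ> v) \<nu>)"

section \<open>Atoms, point masses and arcs\<close>

definition is_atom :: "complex measure \<Rightarrow> complex \<Rightarrow> bool" where
  "is_atom \<mu> \<zeta> \<longleftrightarrow> \<zeta> \<in> circle \<and> measure \<mu> {\<zeta>} > 0"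

definition is_point_mass :: "complex measure \<Rightarrow> bool" where
  "is_point_mass \<mu> \<longleftrightarrow> (\<exists>\<zeta>\<in>circle. \<mu> = return (restrict_space borel circle) \<zeta>)"

text \<open>The endpoints are unordered, and may coincide when the arc is the circle minus a point.\<close>

definition open_arc :: "complex set \<Rightarrow> complex \<Rightarrow> complex \<Rightarrow> bool" where
  "open_arc I \<alpha> \<beta> \<longleftrightarrow>
     (\<exists>s t :: real. s < t \<and> t \<le> s + 2 * pi \<and>
        I = cis ` {s<..<t} \<and> {\<alpha>, \<beta>} = {cis s, cis t})"

end

theory Submission
  imports Defs "HOL-Complex_Analysis.Complex_Analysis" "HOL-Library.Real_Mod"
    "HOL-Real_Asymp.Real_Asymp"
begin

text \<open>
  Write \<open>G \<mu> z = \<integral> 1 / (1 - z x) d\<mu>(x) = 1 + \<psi> z\<close>. Freeness provides subordination functions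
  \<open>w1\<close>, \<open>w2\<close> of the disc with \<open>G \<mu>1 (w1 z) = G \<nu> z = G \<mu>2 (w2 z)\<close> and \<open>w1 w2 = z (1 - 1 / G \<nu>)\<close>.
  Across the gap of \<open>\<nu>\<close> they extend continuously to functions of modulus one, and the arcs traced
  by them have no mass for \<open>\<mu>1\<close> and \<open>\<mu>2\<close> and are traversed monotonically. At an end \<open>E\<close> of such an
  arc \<open>(1 - z / E) G \<mu> z\<close> tends to the mass of the atom there; since \<open>G \<nu>\<close> is infinite at both ends of
  the gap, the product formula yields \<open>p + q = 1 + m\<close> for the masses \<open>p\<close>, \<open>q\<close>, \<open>m\<close> of the
  corresponding atoms of \<open>\<mu>1\<close>, \<open>\<mu>2\<close>, \<open>\<nu>\<close>, at either end. If neither arc fills the circle up to a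
  point, the two atoms of \<open>\<mu>1\<close> are distinct, and so are those of \<open>\<mu>2\<close>, and adding the relations for the
  two ends gives \<open>2 + m + m' \<le> 2\<close>, which is absurd.
\<close>

section \<open>Transforms of measures on the circle\<close>

text \<open>First moments may vanish here, so local inverses of \<open>\<eta>\<close> need not
  exist. The subordination functions are therefore built on the whole disc as solutions of a
  fixed-point system and tied to \<nu> by an operator identity near the origin. Their extension to
  the gap rests on one identity: \<open>2 * Re (G z) - 1\<close> equals \<open>1 - |z|^2\<close>
  times the integral of \<open>1 / |1 - z x|^2\<close>. Equating both sides for \<mu>1 at
  \<open>w1 z\<close> and for \<nu> at \<open>z\<close> turns the distance of \<open>z\<close> from
  the carrier of \<nu> into a bound on second moments at \<open>w1 z\<close> and on the defect
  \<open>1 - |w1 z|^2\<close>; Schwarz-Pick converts the latter into a Lipschitz estimate up to the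
  boundary. The same holds for \<open>w2\<close>. Atoms are approached along the circle and not
  radially. The domination needed for the limit comes from the absence of mass on the traced arc,
  which makes its end the nearest point of the carrier. The angles of the two boundary functions are
  kept bounded through their sum: both increase, and the sum differs from \<theta> by an explicit
  angle in \<open>(0, 2 * pi)\<close>.\<close>

definition resolvent_transform :: "complex measure \<Rightarrow> complex \<Rightarrow> complex" where
  "resolvent_transform \<mu> z = (\<integral>x. 1 / (1 - z * x) \<partial>\<mu>)"

text \<open>This is \<open>\<psi> z / z\<close> with the singularity at the origin removed, so that
  dividing by \<open>z\<close> is avoided throughout.\<close>

definition shifted_transform :: "complex measure \<Rightarrow> complex \<Rightarrow> complex" where
  "shifted_transform \<mu> z = (\<integral>x. x / (1 - z * x) \<partial>\<mu>)"

lemma circle_prob_space: "circle_prob \<mu> \<Longrightarrow> space \<mu> = circle"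
  unfolding circle_prob_def using sets_eq_imp_space_eq[of \<mu> "restrict_space borel circle"]
  by (auto simp: space_restrict_space)

lemma circle_prob_measurable:
  assumes "circle_prob \<mu>" and "f \<in> borel_measurable borel"
  shows "f \<in> borel_measurable \<mu>"
proof -
  have "f \<in> borel_measurable (restrict_space borel circle)"
    using assms(2) by (rule measurable_restrict_space1)
  then show ?thesis
    using assms(1) measurable_cong_sets[of \<mu> "restrict_space borel circle" borel borel]
    by (auto simp: circle_prob_def)
qed

lemma circle_prob_sets:
  assumes "circle_prob \<mu>" and "S \<in> sets borel" and "S \<subseteq> circle"
  shows "S \<in> sets \<mu>"
  using assms by (auto simp: circle_prob_def sets_restrict_space image_iff)

lemma circle_prob_AE_norm: "circle_prob \<mu> \<Longrightarrow> AE x in \<mu>. norm x = 1"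
  using circle_prob_space by (intro AE_I2) auto

lemma circle_prob_integrable_bounded:
  fixes f :: "complex \<Rightarrow> 'b::{banach, second_countable_topology}"
  assumes "circle_prob \<mu>" and "f \<in> borel_measurable borel" and "\<And>x. norm x = 1 \<Longrightarrow> norm (f x) \<le> B"
  shows "integrable \<mu> f"
proof -
  interpret prob_space \<mu> using assms(1) by (simp add: circle_prob_def)
  show ?thesis
    by (rule integrable_const_bound[where B = B])
      (use circle_prob_AE_norm[OF assms(1)] assms(3) in \<open>auto intro: circle_prob_measurable assms(1,2)\<close>)
qed

lemma circle_prob_norm_integral_le:
  fixes f :: "complex \<Rightarrow> 'b::{banach, second_countable_topology}"
  assumes "circle_prob \<mu>" and "f \<in> borel_measurable borel" and "\<And>x. norm x = 1 \<Longrightarrow> norm (f x) \<le> B"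
  shows "norm (integral\<^sup>L \<mu> f) \<le> B"
proof -
  interpret prob_space \<mu> using assms(1) by (simp add: circle_prob_def)
  have "norm (integral\<^sup>L \<mu> f) \<le> (\<integral>x. norm (f x) \<partial>\<mu>)"
    by (rule integral_norm_bound)
  also have "\<dots> \<le> (\<integral>x. B \<partial>\<mu>)"
  proof (rule integral_mono_AE)
    show "integrable \<mu> (\<lambda>x. norm (f x))"
      using circle_prob_integrable_bounded[OF assms] by simp
    show "AE x in \<mu>. norm (f x) \<le> B"
      using circle_prob_AE_norm[OF assms(1)] assms(3) by auto
  qed simp
  finally show ?thesis by (simp add: prob_space)
qed

lemma one_minus_mult_norm_ge:
  fixes z x :: complex
  assumes "norm x = 1"
  shows "1 - norm z \<le> norm (1 - z * x)"
  using norm_triangle_ineq2[of 1 "z * x"] assms by (simp add: norm_mult)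

lemma norm_inverse_one_minus_le:
  fixes z x :: complex
  assumes "norm x = 1" and "norm z < 1"
  shows "norm (1 / (1 - z * x)) \<le> 1 / (1 - norm z)"
  using one_minus_mult_norm_ge[OF assms(1), of z] assms(2)
  by (simp add: norm_divide frac_le)

lemma integrable_power_resolvent:
  assumes "circle_prob \<mu>" and "norm z < 1"
  shows "integrable \<mu> (\<lambda>x. x ^ n / (1 - z * x))"
    and "norm (\<integral>x. x ^ n / (1 - z * x) \<partial>\<mu>) \<le> 1 / (1 - norm z)"
proof -
  have b: "norm (x ^ n / (1 - z * x)) \<le> 1 / (1 - norm z)" if "norm x = 1" for x :: complex
    using norm_inverse_one_minus_le[OF that assms(2)] that by (simp add: norm_divide norm_power)
  have m: "(\<lambda>x. x ^ n / (1 - z * x)) \<in> borel_measurable borel" by measurable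
  show "integrable \<mu> (\<lambda>x. x ^ n / (1 - z * x))"
    by (rule circle_prob_integrable_bounded[OF assms(1) m b])
  show "norm (\<integral>x. x ^ n / (1 - z * x) \<partial>\<mu>) \<le> 1 / (1 - norm z)"
    by (rule circle_prob_norm_integral_le[OF assms(1) m b])
qed

text \<open>One term of the geometric series is split off. The power \<open>n\<close> stays general
  so that the identity can be iterated: it yields the remainder of the moment series, and traces of
  resolvents obey the same recursion.\<close>

lemma integral_power_resolvent_rec:
  assumes "circle_prob \<mu>" and "norm z < 1"
  shows "(\<integral>x. x ^ n / (1 - z * x) \<partial>\<mu>) = (\<integral>x. x ^ n \<partial>\<mu>) + z * (\<integral>x. x ^ Suc n / (1 - z * x) \<partial>\<mu>)"
proof -
  have i: "integrable \<mu> (\<lambda>x. x ^ n)"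
    by (rule circle_prob_integrable_bounded[OF assms(1), where B = 1]) (auto simp: norm_power)
  have "(\<integral>x. x ^ n / (1 - z * x) \<partial>\<mu>) = (\<integral>x. x ^ n + z * (x ^ Suc n / (1 - z * x)) \<partial>\<mu>)"
  proof (rule Bochner_Integration.integral_cong_AE)
    show "AE x in \<mu>. x ^ n / (1 - z * x) = x ^ n + z * (x ^ Suc n / (1 - z * x))"
    proof (rule AE_mp[OF circle_prob_AE_norm[OF assms(1)]], rule AE_I2, rule impI)
      fix x :: complex assume "norm x = 1"
      then have "1 - z * x \<noteq> 0" using one_minus_mult_norm_ge[of x z] assms(2) by auto
      then show "x ^ n / (1 - z * x) = x ^ n + z * (x ^ Suc n / (1 - z * x))"
        by (simp add: field_simps)
    qed
  qed (auto intro!: circle_prob_measurable[OF assms(1)])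
  also have "\<dots> = (\<integral>x. x ^ n \<partial>\<mu>) + z * (\<integral>x. x ^ Suc n / (1 - z * x) \<partial>\<mu>)"
    using i integrable_power_resolvent(1)[OF assms, of "Suc n"]
    by (simp only: Bochner_Integration.integral_add integrable_mult_right integral_mult_right_zero)
  finally show ?thesis .
qed

lemma resolvent_transform_eq:
  assumes "circle_prob \<mu>" and "norm z < 1"
  shows "resolvent_transform \<mu> z = 1 + z * shifted_transform \<mu> z"
proof -
  interpret prob_space \<mu> using assms(1) by (simp add: circle_prob_def)
  show ?thesis
    using integral_power_resolvent_rec[OF assms, of 0] prob_space
    by (simp add: resolvent_transform_def shifted_transform_def)
qed

text \<open>Iterating the recursion from power 1 gives the partial sums of the moment series with
  the explicit remainder \<open>w ^ N * ?K (Suc N)\<close>, which decays geometrically.\<close>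

lemma shifted_transform_holomorphic:
  assumes "circle_prob \<mu>"
  shows "shifted_transform \<mu> holomorphic_on ball 0 1"
proof (rule power_series_holomorphic)
  fix w :: complex assume "w \<in> ball 0 1"
  then have w: "norm w < 1" by simp
  let ?c = "\<lambda>n. \<integral>x. x ^ Suc n \<partial>\<mu>"
  let ?K = "\<lambda>n. \<integral>x. x ^ n / (1 - w * x) \<partial>\<mu>"
  have part: "(\<Sum>n<N. ?c n * w ^ n) = ?K 1 - w ^ N * ?K (Suc N)" for N
  proof (induction N)
    case (Suc N)
    then show ?case
      using integral_power_resolvent_rec[OF assms w, of "Suc N"] by (simp add: algebra_simps)
  qed simp
  have "(\<lambda>N. w ^ N * ?K (Suc N)) \<longlonglongrightarrow> 0"
  proof (rule Lim_null_comparison)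
    show "\<forall>\<^sub>F N in sequentially. norm (w ^ N * ?K (Suc N)) \<le> norm w ^ N * (1 / (1 - norm w))"
    proof (rule always_eventually, rule allI)
      fix N
      show "norm (w ^ N * ?K (Suc N)) \<le> norm w ^ N * (1 / (1 - norm w))"
        unfolding norm_mult norm_power
        by (rule mult_left_mono[OF integrable_power_resolvent(2)[OF assms w]]) simp
    qed
    show "(\<lambda>N. norm w ^ N * (1 / (1 - norm w))) \<longlonglongrightarrow> 0"
      using w by (intro tendsto_mult_left_zero LIMSEQ_power_zero) auto
  qed
  then have "(\<lambda>N. ?K 1 - w ^ N * ?K (Suc N)) \<longlonglongrightarrow> ?K 1 - 0"
    by (intro tendsto_diff tendsto_const)
  then show "(\<lambda>n. ?c n * (w - 0) ^ n) sums shifted_transform \<mu> w"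
    unfolding sums_def part diff_zero by (simp add: shifted_transform_def)
qed

lemma resolvent_transform_holomorphic:
  assumes "circle_prob \<mu>"
  shows "resolvent_transform \<mu> holomorphic_on ball 0 1"
proof -
  have "(\<lambda>z. 1 + z * shifted_transform \<mu> z) holomorphic_on ball 0 1"
    by (intro holomorphic_intros shifted_transform_holomorphic assms)
  then show ?thesis
    by (rule holomorphic_transform) (simp add: resolvent_transform_eq[OF assms])
qed

text \<open>The left-hand side is \<open>Re ((1 + w) / (1 - w))\<close>, the Poisson kernel.\<close>

lemma Re_inverse_one_minus:
  fixes w :: complex
  assumes "w \<noteq> 1"
  shows "2 * Re (1 / (1 - w)) - 1 = (1 - (norm w)\<^sup>2) / (norm (1 - w))\<^sup>2"
proof -
  have n: "(norm (1 - w))\<^sup>2 \<noteq> 0" using assms by simp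
  have "Re (1 / (1 - w)) = (1 - Re w) / (norm (1 - w))\<^sup>2"
    by (simp add: Re_divide cmod_power2)
  moreover have "2 * (1 - Re w) - (norm (1 - w))\<^sup>2 = 1 - (norm w)\<^sup>2"
    by (simp only: cmod_power2) (simp add: power2_eq_square algebra_simps)
  ultimately show ?thesis
    using n by (simp add: field_simps)
qed

text \<open>Integrating the Poisson kernel separates the factor that vanishes at the boundary from a
  second moment of the resolvent. The bound 1/4 comes from \<open>|1 - z x| <= 2\<close>. Comparing
  these quantities for two measures drives the boundary estimates.\<close>

lemma Re_resolvent_transform:
  assumes "circle_prob \<mu>" and "norm z < 1"
  shows "2 * Re (resolvent_transform \<mu> z) - 1 =
      (1 - (norm z)\<^sup>2) * (\<integral>x. 1 / (norm (1 - z * x))\<^sup>2 \<partial>\<mu>)"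
    and "integrable \<mu> (\<lambda>x. 1 / (norm (1 - z * x))\<^sup>2)"
    and "1 / 4 \<le> (\<integral>x. 1 / (norm (1 - z * x))\<^sup>2 \<partial>\<mu>)"
proof -
  interpret prob_space \<mu> using assms(1) by (simp add: circle_prob_def)
  have i: "integrable \<mu> (\<lambda>x. 1 / (1 - z * x))"
    using integrable_power_resolvent(1)[OF assms, of 0] by simp
  show i2: "integrable \<mu> (\<lambda>x. 1 / (norm (1 - z * x))\<^sup>2)"
  proof (rule circle_prob_integrable_bounded[OF assms(1)])
    fix x :: complex assume "norm x = 1"
    from norm_inverse_one_minus_le[OF this assms(2)]
    have "(norm (1 / (1 - z * x)))\<^sup>2 \<le> (1 / (1 - norm z))\<^sup>2" by (rule power_mono) simp
    then show "norm (1 / (norm (1 - z * x))\<^sup>2) \<le> (1 / (1 - norm z))\<^sup>2"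
      by (simp add: norm_divide power_divide)
  qed measurable
  have "2 * Re (resolvent_transform \<mu> z) - 1 = (\<integral>x. 2 * Re (1 / (1 - z * x)) - 1 \<partial>\<mu>)"
    using i prob_space integral_Re[OF i] integrable_Re[OF i]
    by (simp add: resolvent_transform_def)
  also have "\<dots> = (\<integral>x. (1 - (norm z)\<^sup>2) * (1 / (norm (1 - z * x))\<^sup>2) \<partial>\<mu>)"
  proof (rule Bochner_Integration.integral_cong_AE)
    show "AE x in \<mu>. 2 * Re (1 / (1 - z * x)) - 1 = (1 - (norm z)\<^sup>2) * (1 / (norm (1 - z * x))\<^sup>2)"
    proof (rule AE_mp[OF circle_prob_AE_norm[OF assms(1)]], rule AE_I2, rule impI)
      fix x :: complex assume x: "norm x = 1"
      then have "z * x \<noteq> 1" using one_minus_mult_norm_ge[of x z] assms(2) by auto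
      from Re_inverse_one_minus[OF this]
      show "2 * Re (1 / (1 - z * x)) - 1 = (1 - (norm z)\<^sup>2) * (1 / (norm (1 - z * x))\<^sup>2)"
        using x by (simp add: norm_mult)
    qed
  qed (auto intro!: circle_prob_measurable[OF assms(1)])
  finally show "2 * Re (resolvent_transform \<mu> z) - 1 =
      (1 - (norm z)\<^sup>2) * (\<integral>x. 1 / (norm (1 - z * x))\<^sup>2 \<partial>\<mu>)"
    by (simp only: integral_mult_right_zero)
  have "(\<integral>x. 1 / 4 \<partial>\<mu>) \<le> (\<integral>x. 1 / (norm (1 - z * x))\<^sup>2 \<partial>\<mu>)"
  proof (rule integral_mono_AE)
    show "AE x in \<mu>. 1 / 4 \<le> 1 / (norm (1 - z * x))\<^sup>2"
    proof (rule AE_mp[OF circle_prob_AE_norm[OF assms(1)]], rule AE_I2, rule impI)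
      fix x :: complex assume x: "norm x = 1"
      have "norm (1 - z * x) \<le> 2"
        using norm_triangle_ineq4[of 1 "z * x"] x assms(2) by (simp add: norm_mult)
      then have "(norm (1 - z * x))\<^sup>2 \<le> 4" using power_mono[of "norm (1 - z * x)" 2 2] by simp
      moreover have "0 < norm (1 - z * x)" using one_minus_mult_norm_ge[OF x, of z] assms(2) by linarith
      ultimately show "1 / 4 \<le> 1 / (norm (1 - z * x))\<^sup>2" by (intro frac_le) auto
    qed
  qed (use i2 in auto)
  then show "1 / 4 \<le> (\<integral>x. 1 / (norm (1 - z * x))\<^sup>2 \<partial>\<mu>)"
    by (simp add: prob_space)
qed

lemma Re_resolvent_transform_gt:
  assumes "circle_prob \<mu>" and "norm z < 1"
  shows "1 / 2 < Re (resolvent_transform \<mu> z)"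
proof -
  have "0 < (1 - (norm z)\<^sup>2) * (\<integral>x. 1 / (norm (1 - z * x))\<^sup>2 \<partial>\<mu>)"
    using Re_resolvent_transform(3)[OF assms] assms(2)
    by (intro mult_pos_pos) (auto simp: abs_square_less_1)
  then show ?thesis using Re_resolvent_transform(1)[OF assms] by linarith
qed

lemma resolvent_transform_nonzero:
  assumes "circle_prob \<mu>" and "norm z < 1"
  shows "resolvent_transform \<mu> z \<noteq> 0" and "1 / 2 \<le> norm (resolvent_transform \<mu> z)"
  using Re_resolvent_transform_gt[OF assms] complex_Re_le_cmod[of "resolvent_transform \<mu> z"]
  by auto

text \<open>This is \<open>\<eta> z / z\<close>, extended to the origin. The subordination system is
  a fixed-point system in these functions.\<close>

definition h_transform :: "complex measure \<Rightarrow> complex \<Rightarrow> complex" where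
  "h_transform \<mu> z = shifted_transform \<mu> z / resolvent_transform \<mu> z"

lemma h_transform_holomorphic: "circle_prob \<mu> \<Longrightarrow> h_transform \<mu> holomorphic_on ball 0 1"
  unfolding h_transform_def
  by (intro holomorphic_intros shifted_transform_holomorphic resolvent_transform_holomorphic)
    (auto simp: resolvent_transform_nonzero)

text \<open>Points of this half-plane are nearer to 1 than to 0; hence
  \<open>\<eta> = (G - 1) / G\<close> maps the disc into itself.\<close>

lemma norm_sub_one_less:
  fixes g :: complex
  assumes "1 / 2 < Re g"
  shows "norm (g - 1) < norm g"
proof -
  have "(norm (g - 1))\<^sup>2 < (norm g)\<^sup>2"
    using assms by (simp only: cmod_power2) (simp add: power2_eq_square algebra_simps)
  then show ?thesis by (rule power_less_imp_less_base) simp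
qed

lemma eta_transform_eq:
  assumes "circle_prob \<mu>" and "norm z < 1"
  shows "z * h_transform \<mu> z = (resolvent_transform \<mu> z - 1) / resolvent_transform \<mu> z"
  by (simp add: h_transform_def resolvent_transform_eq[OF assms])

text \<open>The Schwarz lemma applies to \<eta>. Dividing its bound by \<open>z\<close> says nothing
  at the origin, where \<open>h_transform\<close> is the first moment.\<close>

lemma norm_h_transform_le:
  assumes "circle_prob \<mu>" and "norm z < 1"
  shows "norm (h_transform \<mu> z) \<le> 1"
proof (cases "z = 0")
  case True
  have "resolvent_transform \<mu> 0 = 1" using resolvent_transform_eq[OF assms(1), of 0] by simp
  moreover have "norm (shifted_transform \<mu> 0) \<le> 1"
    using integrable_power_resolvent(2)[OF assms(1), of 0 1] by (simp add: shifted_transform_def)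
  ultimately show ?thesis using True by (simp add: h_transform_def)
next
  case False
  have "norm (z * h_transform \<mu> z) \<le> norm z"
  proof (rule Schwarz_Lemma(1))
    show "(\<lambda>z. z * h_transform \<mu> z) holomorphic_on ball 0 1"
      by (intro holomorphic_intros h_transform_holomorphic assms)
    show "norm (w * h_transform \<mu> w) < 1" if "norm w < 1" for w
      using norm_sub_one_less[OF Re_resolvent_transform_gt[OF assms(1) that]]
        resolvent_transform_nonzero[OF assms(1) that]
      by (simp add: eta_transform_eq[OF assms(1) that] norm_divide)
  qed (use assms in auto)
  then show ?thesis using False by (simp add: norm_mult)
qed

section \<open>Fixed points of holomorphic self-maps depending on a parameter\<close>

lemma holomorphic_lipschitz_near_0:
  assumes "f holomorphic_on ball 0 1"
  obtains L where "L > 0"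
    and "\<And>x y. \<lbrakk>norm x \<le> 1/2; norm y \<le> 1/2\<rbrakk> \<Longrightarrow> norm (f x - f y :: complex) \<le> L * norm (x - y)"
proof -
  have "compact (deriv f ` cball 0 (1/2))"
    by (intro compact_continuous_image compact_cball holomorphic_on_imp_continuous_on
        holomorphic_on_subset[OF holomorphic_deriv[OF assms]]) auto
  then obtain L where L: "L > 0" "\<And>x. norm x \<le> 1/2 \<Longrightarrow> norm (deriv f x) \<le> L"
    using bounded_pos[of "deriv f ` cball 0 (1/2)"] compact_imp_bounded by auto
  have "norm (f x - f y) \<le> L * norm (x - y)" if "norm x \<le> 1/2" "norm y \<le> 1/2" for x y
  proof (rule field_differentiable_bound[of "cball 0 (1/2)" f "deriv f"])
    show "(f has_field_derivative deriv f z) (at z within cball 0 (1/2))" if "z \<in> cball 0 (1/2)" for z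
      using that holomorphic_derivI[OF assms, of z] by (auto intro: has_field_derivative_at_within)
  qed (use that L in auto)
  then show ?thesis using L(1) that by blast
qed

text \<open>The fixed points are obtained by iterating from the zero function: near the origin the
  iteration contracts, Montel's theorem supplies a limit on the whole disc, and the identity theorem
  propagates the equation.\<close>

lemma holomorphic_fixed_point_family:
  assumes "f holomorphic_on ball 0 1" and "g holomorphic_on ball 0 1"
    and "\<And>z. norm z < 1 \<Longrightarrow> norm (f z) \<le> (1::real)" and "\<And>z. norm z < 1 \<Longrightarrow> norm (g z) \<le> (1::real)"
  obtains p where "p holomorphic_on ball 0 1"
    and "\<And>z. norm z < 1 \<Longrightarrow> norm (p z) \<le> norm z"
    and "\<And>z. norm z < 1 \<Longrightarrow> p z = z * f (z * g (p z))"
proof -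
  define F where "F = rec_nat (\<lambda>z. 0) (\<lambda>_ p z. z * f (z * g (p z)))"
  have F_Suc: "F (Suc n) = (\<lambda>z. z * f (z * g (F n z)))" for n by (simp add: F_def)
  have mult_less: "norm (z * w) < 1" if "norm z < 1" "norm w \<le> 1" for z w :: complex
    using that mult_left_le[of "norm w" "norm z"] by (simp add: norm_mult)
  have F_le: "norm (F n z) \<le> norm z" if "norm z < 1" for n z
  proof (induction n)
    case (Suc n)
    then have "norm (F n z) < 1" using that by linarith
    then have "norm (f (z * g (F n z))) \<le> 1" using assms(3,4) mult_less that by blast
    then show ?case by (simp add: F_Suc norm_mult mult_left_le)
  qed (simp add: F_def)
  have comp: "(\<lambda>z. z * f (z * g (p z))) holomorphic_on ball 0 1"
    if p: "p holomorphic_on ball 0 1" "\<And>z. norm z < 1 \<Longrightarrow> norm (p z) < 1" for p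
  proof -
    have 1: "(\<lambda>z. z * g (p z)) holomorphic_on ball 0 1"
      by (intro holomorphic_intros holomorphic_on_compose_gen[of p _ g, unfolded o_def, OF _ assms(2)])
        (use p in auto)
    show ?thesis
      by (intro holomorphic_intros holomorphic_on_compose_gen[of _ _ f, unfolded o_def, OF 1 assms(1)])
        (use p assms(4) mult_less in auto)
  qed
  have F_hol: "F n holomorphic_on ball 0 1" for n
  proof (induction n)
    case (Suc n)
    then show ?case unfolding F_Suc by (rule comp) (use F_le le_less_trans in blast)
  qed (simp add: F_def)
  obtain p r where p: "p holomorphic_on ball 0 1" and r: "strict_mono (r :: nat \<Rightarrow> nat)"
    and lim: "\<And>z. z \<in> ball 0 1 \<Longrightarrow> (\<lambda>n. F (r n) z) \<longlonglongrightarrow> p z"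
  proof (rule Montel[of "ball 0 1" "range F" F])
    show "\<exists>B. \<forall>h\<in>range F. \<forall>z\<in>K. norm (h z) \<le> B" if "compact K" and K: "K \<subseteq> ball 0 1" for K
    proof (intro exI ballI)
      fix h z assume "h \<in> range F" "z \<in> K"
      then obtain n where "h = F n" "norm z < 1" using K by auto
      then show "norm (h z) \<le> 1" using F_le[of z n] by simp
    qed
  qed (use F_hol in auto)
  have p_le: "norm (p z) \<le> norm z" if "norm z < 1" for z
    by (rule Lim_norm_ubound[OF _ lim]) (use that F_le in auto)
  obtain Lf where Lf: "Lf > 0" "\<And>x y. \<lbrakk>norm x \<le> 1/2; norm y \<le> 1/2\<rbrakk> \<Longrightarrow> norm (f x - f y) \<le> Lf * norm (x - y)"
    using holomorphic_lipschitz_near_0[OF assms(1)] by blast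
  obtain Lg where Lg: "Lg > 0" "\<And>x y. \<lbrakk>norm x \<le> 1/2; norm y \<le> 1/2\<rbrakk> \<Longrightarrow> norm (g x - g y) \<le> Lg * norm (x - y)"
    using holomorphic_lipschitz_near_0[OF assms(2)] by blast
  \<comment> \<open>One iteration changes differences by the factor
    \<open>|z| * Lf * |z| * Lg\<close>. The bound \<open>1 / (2 * Lf * Lg)\<close> makes this at
    most 1/2; the bound 1/2 keeps all arguments where the Lipschitz constants are valid.\<close>
  define \<rho> where "\<rho> = min (1/2) (1 / (2 * Lf * Lg))"
  have \<rho>: "0 < \<rho>" "\<rho> \<le> 1/2" "\<rho> * (Lf * Lg) \<le> 1/2"
  proof -
    show "0 < \<rho>" "\<rho> \<le> 1/2" using Lf Lg by (auto simp: \<rho>_def)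
    have "\<rho> \<le> 1 / (2 * Lf * Lg)" by (simp add: \<rho>_def)
    then show "\<rho> * (Lf * Lg) \<le> 1/2" using Lf(1) Lg(1) by (simp add: field_simps)
  qed
  have small: "p z = z * f (z * g (p z))" if z: "z \<in> ball 0 \<rho>" for z
  proof -
    have z2: "norm z \<le> 1/2" "norm z < 1" and zL: "norm z * (Lf * Lg) \<le> 1/2"
    proof -
      have "norm z * (Lf * Lg) \<le> \<rho> * (Lf * Lg)"
        using z Lf(1) Lg(1) by (intro mult_right_mono) auto
      then show "norm z \<le> 1/2" "norm z < 1" "norm z * (Lf * Lg) \<le> 1/2"
        using \<rho> z by auto
    qed
    have Fz: "norm (F n z) \<le> 1/2" "norm (F n z) < 1" for n using F_le[OF z2(2), of n] z2 by auto
    have gz: "norm (z * g w) \<le> 1/2" if "norm w < 1" for w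
      using assms(4)[OF that] z2 mult_left_le[of "norm (g w)" "norm z"] by (simp add: norm_mult)
    have step: "norm (F (Suc (Suc n)) z - F (Suc n) z) \<le> (1/2) * norm (F (Suc n) z - F n z)" for n
    proof -
      have "norm (F (Suc (Suc n)) z - F (Suc n) z)
          = norm z * norm (f (z * g (F (Suc n) z)) - f (z * g (F n z)))"
        by (simp only: F_Suc right_diff_distrib[symmetric] norm_mult)
      also have "\<dots> \<le> norm z * (Lf * norm (z * g (F (Suc n) z) - z * g (F n z)))"
        by (intro mult_left_mono Lf gz Fz) auto
      also have "\<dots> = norm z * Lf * norm z * norm (g (F (Suc n) z) - g (F n z))"
        by (simp only: right_diff_distrib[symmetric] norm_mult mult.assoc)
      also have "\<dots> \<le> norm z * Lf * norm z * (Lg * norm (F (Suc n) z - F n z))"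
        using Lf(1) by (intro mult_left_mono Lg Fz) auto
      also have "\<dots> = (norm z * (Lf * Lg)) * (norm z * norm (F (Suc n) z - F n z))" by simp
      also have "\<dots> \<le> (1/2) * (1 * norm (F (Suc n) z - F n z))"
        using zL z2 Lf(1) Lg(1) by (intro mult_mono mult_right_mono) auto
      finally show ?thesis by simp
    qed
    have geo: "norm (F (Suc n) z - F n z) \<le> (1/2) ^ n" for n
    proof (induction n)
      case 0
      have "F 0 z = 0" by (simp add: F_def)
      then show ?case using Fz(2)[of "Suc 0"] by simp
    next
      case (Suc n)
      have "norm (F (Suc (Suc n)) z - F (Suc n) z) \<le> (1/2) * (1/2) ^ n"
        using step[of n] Suc by linarith
      then show ?case by simp
    qed
    \<comment> \<open>The indices supplied by Montel need not be closed under successor. Vanishing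
      consecutive differences give the shifted subsequence the same limit.\<close>
    have "(\<lambda>n. F (Suc n) z - F n z) \<longlonglongrightarrow> 0"
      by (rule Lim_null_comparison[where g = "\<lambda>n. (1/2) ^ n"])
        (use geo in \<open>auto intro!: LIMSEQ_power_zero\<close>)
    from LIMSEQ_subseq_LIMSEQ[OF this r] have d: "(\<lambda>n. F (Suc (r n)) z - F (r n) z) \<longlonglongrightarrow> 0"
      by (simp add: o_def)
    have lz: "(\<lambda>n. F (r n) z) \<longlonglongrightarrow> p z" using lim z2 by simp
    from tendsto_add[OF d lz] have 1: "(\<lambda>n. F (Suc (r n)) z) \<longlonglongrightarrow> p z" by simp
    have pz: "norm (p z) < 1" using p_le z2 by (meson le_less_trans)
    have "isCont g (p z)" "isCont f (z * g (p z))"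
      using assms(1,2) pz gz[OF pz]
      by (auto intro!: holomorphic_on_imp_continuous_on continuous_on_interior[of "ball 0 1"])
    then have "(\<lambda>n. z * f (z * g (F (r n) z))) \<longlonglongrightarrow> z * f (z * g (p z))"
      by (intro tendsto_mult tendsto_const isCont_tendsto_compose[of _ f] isCont_tendsto_compose[of _ g] lz)
    then show ?thesis using 1 by (simp add: F_Suc LIMSEQ_unique)
  qed
  have "p z = z * f (z * g (p z))" if "norm z < 1" for z
  proof (rule analytic_continuation_open[of "ball 0 \<rho>" "ball 0 1" p "\<lambda>z. z * f (z * g (p z))"])
    show "(\<lambda>z. z * f (z * g (p z))) holomorphic_on ball 0 1"
      by (rule comp[OF p]) (use p_le le_less_trans in blast)
  qed (use \<rho> p small that in auto)
  with p p_le show ?thesis using that by blast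
qed

section \<open>Operators\<close>

lemma scaleC_one: "scaleC 1 x = x"
  using scaleC_of_real[of 1 x] by simp

lemma scaleC_zero_left: "scaleC 0 x = 0"
  using scaleC_of_real[of 0 x] by simp

lemma scaleC_uminus_left: "scaleC (- c) x = - scaleC c x"
  using scaleC_add_left[of "- c" c x] by (simp add: scaleC_zero_left eq_neg_iff_add_eq_0)

lemma scaleC_diff_left: "scaleC (c - d) x = scaleC c x - scaleC d x"
  using scaleC_add_left[of c "- d" x] by (simp add: scaleC_uminus_left)

lemma scaleC_diff_right: "scaleC c (x - y) = scaleC c x - scaleC c y"
  using scaleC_add_right[of c "x - y" y] by simp

lemma cinner_scaleC_right: "cinner x (scaleC c y) = cnj c * cinner x y"
  by (metis cinner_commute cinner_scaleC_left complex_cnj_cnj complex_cnj_mult)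

lemma cinner_add_right: "cinner x (y + z) = cinner x y + cinner x z"
  by (metis cinner_commute cinner_add_left complex_cnj_add)

lemma norm_scaleC: "norm (scaleC c x) = norm c * norm x"
proof -
  have "cinner (scaleC c x) (scaleC c x) = complex_of_real ((norm c)\<^sup>2) * cinner x x"
    by (simp only: cinner_scaleC_left cinner_scaleC_right complex_norm_square mult_ac)
  then have "inner (scaleC c x) (scaleC c x) = (norm c)\<^sup>2 * inner x x"
    by (simp flip: Re_cinner)
  then show ?thesis
    by (simp add: norm_eq_sqrt_inner real_sqrt_mult)
qed

lemma bounded_operatorsD:
  assumes "a \<in> bounded_operators"
  shows "a (x + y) = a x + a y" and "a (x - y) = a x - a y"
    and "a (scaleC c x) = scaleC c (a x)" and "bounded_linear a"
  using assms
  by (auto simp: bounded_operators_def bounded_linear.linear linear_add linear_diff)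

lemma bounded_operatorsI:
  assumes "\<And>x y. a (x + y) = a x + a y" and "\<And>c x. a (scaleC c x) = scaleC c (a x)"
    and "\<And>x. norm (a x) \<le> K * norm x"
  shows "a \<in> bounded_operators"
  unfolding bounded_operators_def
proof (intro CollectI conjI allI)
  show "bounded_linear a"
    by (rule bounded_linear_intro[where K = K])
      (use assms in \<open>auto simp: mult.commute simp flip: scaleC_of_real\<close>)
qed (rule assms)

lemma bounded_operators_id: "id \<in> bounded_operators"
  by (rule bounded_operatorsI[where K = 1]) auto

lemma bounded_operators_comp:
  assumes "a \<in> bounded_operators" and "b \<in> bounded_operators"
  shows "a \<circ> b \<in> bounded_operators"
  using assms bounded_linear_compose[of a b] by (auto simp: bounded_operators_def o_def)

lemma bounded_operators_add:
  assumes "a \<in> bounded_operators" and "b \<in> bounded_operators"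
  shows "(\<lambda>x. a x + b x) \<in> bounded_operators"
  using assms bounded_linear_add[of a b] by (auto simp: bounded_operators_def scaleC_add_right)

lemma bounded_operators_scaleC:
  assumes "a \<in> bounded_operators"
  shows "(\<lambda>x. scaleC c (a x)) \<in> bounded_operators"
proof -
  obtain K where "\<And>x. norm (a x) \<le> norm x * K"
    using bounded_linear.bounded[OF bounded_operatorsD(4)[OF assms]] by blast
  then have "norm (scaleC c (a x)) \<le> (norm c * K) * norm x" for x
    using mult_left_mono[of "norm (a x)" "norm x * K" "norm c"] by (simp add: norm_scaleC mult_ac)
  then show ?thesis
    by (rule bounded_operatorsI[rotated 2])
      (simp_all add: bounded_operatorsD[OF assms] scaleC_add_right scaleC_scaleC mult.commute)
qed

lemma commutant_closed:
  assumes "S \<subseteq> bounded_operators" and "a \<in> commutant S" and "b \<in> commutant S"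
  shows "a \<circ> b \<in> commutant S" and "(\<lambda>x. a x + b x) \<in> commutant S"
    and "(\<lambda>x. scaleC c (a x)) \<in> commutant S" and "id \<in> commutant S"
proof -
  have ab: "a \<in> bounded_operators" "b \<in> bounded_operators" and
    c: "\<And>s x. s \<in> S \<Longrightarrow> s (a x) = a (s x)" "\<And>s x. s \<in> S \<Longrightarrow> s (b x) = b (s x)"
    using assms(2,3) by (auto simp: commutant_def fun_eq_iff)
  have s: "s \<in> bounded_operators" if "s \<in> S" for s using assms(1) that by auto
  have I: "b \<in> commutant S" if "b \<in> bounded_operators" "\<And>s x. s \<in> S \<Longrightarrow> s (b x) = b (s x)" for b
    using that by (auto simp: commutant_def)
  show "a \<circ> b \<in> commutant S"
  proof (rule I)
    fix s x assume "s \<in> S"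
    from c(1)[OF this, of "b x"] c(2)[OF this, of x] show "s ((a \<circ> b) x) = (a \<circ> b) (s x)" by simp
  qed (rule bounded_operators_comp[OF ab])
  show "(\<lambda>x. a x + b x) \<in> commutant S"
  proof (rule I)
    fix t x assume "t \<in> S"
    with c[OF this, of x] show "t (a x + b x) = a (t x) + b (t x)"
      by (simp add: bounded_operatorsD[OF s])
  qed (rule bounded_operators_add[OF ab])
  show "(\<lambda>x. scaleC c (a x)) \<in> commutant S"
  proof (rule I)
    fix t x assume "t \<in> S"
    with c(1)[OF this, of x] show "t (scaleC c (a x)) = scaleC c (a (t x))"
      by (simp add: bounded_operatorsD[OF s])
  qed (rule bounded_operators_scaleC[OF ab(1)])
  show "id \<in> commutant S" by (rule I) (auto intro: bounded_operators_id)
qed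

text \<open>The definition contains no algebraic closure. It comes from the bicommutant condition,
  since every commutant of bounded operators is closed under these operations.\<close>

lemma von_neumann_algebra_closed:
  assumes "von_neumann_algebra B" and "a \<in> B" and "b \<in> B"
  shows "a \<circ> b \<in> B" and "(\<lambda>x. a x + b x) \<in> B" and "(\<lambda>x. scaleC c (a x)) \<in> B" and "id \<in> B"
proof -
  have "commutant B \<subseteq> bounded_operators" by (auto simp: commutant_def)
  note cl = commutant_closed[OF this]
  have "commutant (commutant B) = B" using assms(1) by (simp add: von_neumann_algebra_def)
  then show "a \<circ> b \<in> B" "(\<lambda>x. a x + b x) \<in> B" "(\<lambda>x. scaleC c (a x)) \<in> B" "id \<in> B"
    using cl[of a b] assms(2,3) by auto
qed

lemma vn_generated_closed:
  assumes "a \<in> vn_generated u" and "b \<in> vn_generated u"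
  shows "a \<circ> b \<in> vn_generated u" and "(\<lambda>x. a x + b x) \<in> vn_generated u"
    and "(\<lambda>x. scaleC c (a x)) \<in> vn_generated u" and "id \<in> vn_generated u"
  using assms von_neumann_algebra_closed[of _ a b] by (auto simp: vn_generated_def)

lemma vn_generated_affine:
  assumes "a \<in> vn_generated u" and "b \<in> vn_generated u"
  shows "(\<lambda>x. a (b x) + scaleC c x) \<in> vn_generated u"
proof -
  have "id \<in> vn_generated u" by (rule vn_generated_closed(4)[OF assms])
  from vn_generated_closed(2)[OF vn_generated_closed(1)[OF assms] vn_generated_closed(3)[OF this this]]
  show ?thesis by simp
qed

lemma unitary_operator_norm:
  assumes "unitary_operator u"
  shows "norm (u x) = norm x"
proof -
  obtain w where w: "is_adjoint u w" "w \<circ> u = id"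
    using assms by (auto simp: unitary_operator_def)
  have "cinner (u x) (u x) = cinner x (w (u x))" using w(1) by (simp add: is_adjoint_def)
  also have "w (u x) = x" using w(2) by (metis comp_apply id_apply)
  finally show ?thesis by (simp add: norm_eq_sqrt_inner flip: Re_cinner)
qed

lemma unitary_operator_comp:
  assumes "unitary_operator u" and "unitary_operator v"
  shows "unitary_operator (u \<circ> v)"
proof -
  obtain u' where u: "is_adjoint u u'" "u \<circ> u' = id" "u' \<circ> u = id"
    using assms(1) by (auto simp: unitary_operator_def)
  obtain v' where v: "is_adjoint v v'" "v \<circ> v' = id" "v' \<circ> v = id"
    using assms(2) by (auto simp: unitary_operator_def)
  show ?thesis
    unfolding unitary_operator_def
  proof (intro conjI exI[of _ "v' \<circ> u'"])
    show "u \<circ> v \<in> bounded_operators"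
      using assms by (intro bounded_operators_comp) (auto simp: unitary_operator_def)
  qed (use u v in \<open>auto simp: is_adjoint_def fun_eq_iff\<close>)
qed

text \<open>The inverse of \<open>1 - z u\<close>, defined by solving the equation pointwise. Its
  linearity and its commutation properties all follow from uniqueness of the solution.\<close>

definition op_resolvent :: "complex \<Rightarrow> ('h::complex_hilbert_space \<Rightarrow> 'h) \<Rightarrow> 'h \<Rightarrow> 'h" where
  "op_resolvent z u y = (THE x. x - scaleC z (u x) = y)"

context
  fixes u :: "'h::complex_hilbert_space \<Rightarrow> 'h" and z :: complex
  assumes u: "unitary_operator u" and z: "norm z < 1"
begin

lemma unitary_bounded: "u \<in> bounded_operators"
  using u by (simp add: unitary_operator_def)

text \<open>Since \<open>u\<close> is an isometry, the map sending \<open>x\<close> to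
  \<open>y + z u x\<close> contracts with factor \<open>|z|\<close>.\<close>

lemma op_resolvent_ex1: "\<exists>!x. x - scaleC z (u x) = y"
proof -
  have "\<exists>!x. y + scaleC z (u x) = x"
  proof (rule banach_fix_type[of "norm z"])
    show "\<forall>x x'. dist (y + scaleC z (u x)) (y + scaleC z (u x')) \<le> norm z * dist x x'"
    proof (intro allI)
      fix x x'
      have "scaleC z (u x) - scaleC z (u x') = scaleC z (u (x - x'))"
        by (simp add: bounded_operatorsD[OF unitary_bounded] scaleC_diff_right)
      then show "dist (y + scaleC z (u x)) (y + scaleC z (u x')) \<le> norm z * dist x x'"
        by (simp add: dist_norm norm_scaleC unitary_operator_norm[OF u])
    qed
  qed (use z in auto)
  moreover have "y + scaleC z (u x) = x \<longleftrightarrow> x - scaleC z (u x) = y" for x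
    by (auto simp: algebra_simps)
  ultimately show ?thesis by simp
qed

lemma op_resolvent_right: "op_resolvent z u y - scaleC z (u (op_resolvent z u y)) = y"
  unfolding op_resolvent_def by (rule theI'[OF op_resolvent_ex1])

lemma op_resolvent_unique: "x - scaleC z (u x) = y \<Longrightarrow> op_resolvent z u y = x"
  using op_resolvent_ex1 op_resolvent_right by blast

lemma op_resolvent_eq: "op_resolvent z u y = y + scaleC z (u (op_resolvent z u y))"
  using op_resolvent_right[of y] by (simp add: algebra_simps)

lemma op_resolvent_norm: "norm (op_resolvent z u y) \<le> 1 / (1 - norm z) * norm y"
proof -
  have "norm (op_resolvent z u y) \<le> norm y + norm z * norm (op_resolvent z u y)"
    using norm_triangle_ineq[of y "scaleC z (u (op_resolvent z u y))"]
    by (simp add: op_resolvent_eq[symmetric] norm_scaleC unitary_operator_norm[OF u])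
  then show ?thesis using z by (simp add: field_simps)
qed

lemma op_resolvent_commute:
  assumes "a \<in> bounded_operators" and "\<And>x. a (u x) = u (a x)"
  shows "op_resolvent z u (a y) = a (op_resolvent z u y)"
proof (rule op_resolvent_unique)
  have "a (op_resolvent z u y) - scaleC z (u (a (op_resolvent z u y)))
      = a (op_resolvent z u y - scaleC z (u (op_resolvent z u y)))"
    by (simp add: bounded_operatorsD[OF assms(1)] assms(2))
  then show "a (op_resolvent z u y) - scaleC z (u (a (op_resolvent z u y))) = a y"
    by (simp add: op_resolvent_right)
qed

lemma op_resolvent_bounded: "op_resolvent z u \<in> bounded_operators"
proof (rule bounded_operatorsI[OF _ _ op_resolvent_norm])
  note lin = bounded_operatorsD[OF unitary_bounded]
  show "op_resolvent z u (x + y) = op_resolvent z u x + op_resolvent z u y" for x y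
  proof (rule op_resolvent_unique)
    have "op_resolvent z u x + op_resolvent z u y - scaleC z (u (op_resolvent z u x + op_resolvent z u y))
      = (op_resolvent z u x - scaleC z (u (op_resolvent z u x)))
        + (op_resolvent z u y - scaleC z (u (op_resolvent z u y)))"
      by (simp add: lin scaleC_add_right)
    then show "op_resolvent z u x + op_resolvent z u y
        - scaleC z (u (op_resolvent z u x + op_resolvent z u y)) = x + y"
      by (simp add: op_resolvent_right)
  qed
  show "op_resolvent z u (scaleC c x) = scaleC c (op_resolvent z u x)" for c x
  proof (rule op_resolvent_unique)
    have "scaleC c (op_resolvent z u x) - scaleC z (u (scaleC c (op_resolvent z u x)))
      = scaleC c (op_resolvent z u x - scaleC z (u (op_resolvent z u x)))"
      by (simp add: lin scaleC_diff_right scaleC_scaleC mult.commute)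
    then show "scaleC c (op_resolvent z u x) - scaleC z (u (scaleC c (op_resolvent z u x))) = scaleC c x"
      by (simp add: op_resolvent_right)
  qed
qed

text \<open>Whatever commutes with \<open>u\<close> commutes with its resolvent, so the resolvent
  lies in the bicommutant; no limit of operators is taken.\<close>

lemma op_resolvent_in_von_neumann_algebra:
  assumes "von_neumann_algebra B" and "u \<in> B"
  shows "op_resolvent z u \<in> B"
proof -
  have B: "commutant (commutant B) = B" using assms(1) by (simp add: von_neumann_algebra_def)
  have "op_resolvent z u \<in> commutant (commutant B)"
    unfolding commutant_def[of "commutant B"]
  proof (intro CollectI conjI ballI op_resolvent_bounded)
    fix a assume a: "a \<in> commutant B"
    then have "a (u x) = u (a x)" for x
      using assms(2) by (auto simp: commutant_def fun_eq_iff)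
    then show "a \<circ> op_resolvent z u = op_resolvent z u \<circ> a"
      using a op_resolvent_commute[of a] by (auto simp: commutant_def fun_eq_iff)
  qed
  then show ?thesis by (simp only: B)
qed

lemma op_resolvent_in_vn_generated: "op_resolvent z u \<in> vn_generated u"
  using op_resolvent_in_von_neumann_algebra by (auto simp: vn_generated_def)

end

section \<open>Traces\<close>

lemma adjoint_norm:
  fixes a b :: "'h::complex_hilbert_space \<Rightarrow> 'h"
  assumes "is_adjoint a b" and "\<And>x. norm (a x) \<le> K * norm x"
  shows "norm (b x) \<le> K * norm x"
proof (cases "b x = 0")
  case True
  have "0 \<le> K * norm x" by (rule order_trans[OF _ assms(2)]) simp
  then show ?thesis using True by simp
next
  case False
  have "norm (b x) * norm (b x) = Re (cinner (b x) (b x))"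
    by (simp add: Re_cinner power2_norm_eq_inner[symmetric] power2_eq_square)
  also have "\<dots> = inner (a (b x)) x"
    using assms(1) by (simp add: is_adjoint_def Re_cinner[symmetric])
  also have "\<dots> \<le> norm (a (b x)) * norm x" by (rule norm_cauchy_schwarz)
  also have "\<dots> \<le> (K * norm (b x)) * norm x" by (intro mult_right_mono assms(2)) simp
  finally show ?thesis using False by (simp add: mult_ac)
qed

text \<open>Iteration gives \<open>e n = c ^ k * e (n + k)\<close>, and the decay of
  \<open>c ^ k\<close> beats the growth \<open>M ^ k\<close>. This replaces the summation of
  operator series: it serves for resolvents with \<open>M = 1\<close> and for alternating products
  with \<open>M = 16\<close>.\<close>

lemma bounded_sequence_geometric_zero:
  fixes e :: "nat \<Rightarrow> complex"
  assumes "\<And>n. e n = c * e (Suc n)" and "\<And>n. norm (e n) \<le> K * M ^ n" and "norm c * M < 1" and "0 \<le> M"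
  shows "e n = 0"
proof -
  have e: "e n = c ^ k * e (n + k)" for k
  proof (induction k)
    case (Suc k)
    then show ?case using assms(1)[of "n + k"] by simp
  qed simp
  have "norm (e n) \<le> (norm c * M) ^ k * (K * M ^ n)" for k
  proof -
    have "norm (e n) = norm c ^ k * norm (e (n + k))" by (subst e[of k]) (simp add: norm_mult norm_power)
    also have "\<dots> \<le> norm c ^ k * (K * M ^ (n + k))" by (intro mult_left_mono assms(2)) simp
    finally show ?thesis by (simp add: power_add power_mult_distrib mult_ac)
  qed
  moreover have "(\<lambda>k. (norm c * M) ^ k * (K * M ^ n)) \<longlonglongrightarrow> 0"
    using assms(3,4) by (intro tendsto_mult_left_zero LIMSEQ_power_zero) (simp add: abs_mult)
  ultimately have "norm (e n) \<le> 0" by (intro LIMSEQ_le_const) auto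
  then show ?thesis by simp
qed

definition alt_word :: "('a \<Rightarrow> 'a) \<Rightarrow> ('a \<Rightarrow> 'a) \<Rightarrow> nat \<Rightarrow> (bool \<times> ('a \<Rightarrow> 'a)) list" where
  "alt_word a b k = concat (replicate k [(True, a), (False, b)])"

lemma alt_word_simps:
  "alt_word a b 0 = []" "alt_word a b (Suc k) = (True, a) # (False, b) # alt_word a b k"
  by (simp_all add: alt_word_def)

lemma successively_alt_word: "successively (\<lambda>p q. fst p \<noteq> fst q) ((False, c) # alt_word a b k)"
  by (induction k) (auto simp: alt_word_simps successively_Cons)

lemma foldr_alt_word: "foldr (\<circ>) (map snd (alt_word a b k)) id = (a \<circ> b) ^^ k"
  by (induction k) (auto simp: alt_word_simps o_assoc)

lemma set_alt_word: "set (alt_word a b k) \<subseteq> {(True, a), (False, b)}"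
  by (induction k) (auto simp: alt_word_simps)

locale trace_space =
  fixes A :: "('h::complex_hilbert_space \<Rightarrow> 'h) set" and \<tau> :: "('h \<Rightarrow> 'h) \<Rightarrow> complex"
  assumes wstar: "wstar_probability_space A \<tau>"
begin

lemma algebra: "von_neumann_algebra A"
  using wstar by (simp add: wstar_probability_space_def)

lemma algebra_bounded: "a \<in> A \<Longrightarrow> a \<in> bounded_operators"
  using algebra by (auto simp: von_neumann_algebra_def)

lemmas comp_in = von_neumann_algebra_closed(1)[OF algebra]
lemmas add_in = von_neumann_algebra_closed(2)[OF algebra]

lemma scaleC_in: "a \<in> A \<Longrightarrow> (\<lambda>x. scaleC c (a x)) \<in> A"
  using von_neumann_algebra_closed(3)[OF algebra] by blast

text \<open>The general closure lemma yields \<open>id\<close> only from given members, so the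
  bicommutant is used directly.\<close>

lemma id_in: "id \<in> A"
proof -
  have "commutant A \<subseteq> bounded_operators" by (auto simp: commutant_def)
  moreover have "id \<in> commutant (commutant A)"
    using calculation bounded_operators_id by (auto simp: commutant_def)
  ultimately show ?thesis using algebra by (simp add: von_neumann_algebra_def)
qed

lemma funpow_in: "a \<in> A \<Longrightarrow> a ^^ n \<in> A"
  by (induction n) (auto intro: comp_in id_in)

lemma trace_add: "a \<in> A \<Longrightarrow> b \<in> A \<Longrightarrow> \<tau> (\<lambda>x. a x + b x) = \<tau> a + \<tau> b"
  using wstar by (auto simp: wstar_probability_space_def state_on_def)

lemma trace_scaleC: "a \<in> A \<Longrightarrow> \<tau> (\<lambda>x. scaleC c (a x)) = c * \<tau> a"
  using wstar by (auto simp: wstar_probability_space_def state_on_def)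

lemma scaleC_id_in: "(\<lambda>x. scaleC c x) \<in> A"
  using scaleC_in[OF id_in, of c] by simp

lemma trace_scaleC_id: "\<tau> (\<lambda>x. scaleC c x) = c"
proof -
  have "\<tau> id = 1"
    using wstar by (auto simp: wstar_probability_space_def state_on_def)
  then show ?thesis using trace_scaleC[OF id_in, of c] by simp
qed

lemma trace_commute: "a \<in> A \<Longrightarrow> b \<in> A \<Longrightarrow> \<tau> (a \<circ> b) = \<tau> (b \<circ> a)"
  using wstar by (auto simp: wstar_probability_space_def tracial_on_def)

lemma vn_generated_in: "u \<in> A \<Longrightarrow> a \<in> vn_generated u \<Longrightarrow> a \<in> A"
  using algebra by (auto simp: vn_generated_def)

text \<open>By Cauchy-Schwarz \<open>K - h\<close> is a positive operator, so its trace is real and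
  nonnegative.\<close>

lemma trace_selfadjoint:
  assumes "h \<in> A" and "is_adjoint h h" and "\<And>x. norm (h x) \<le> K * norm x"
  shows "\<tau> h \<in> \<real>" and "Re (\<tau> h) \<le> K"
proof -
  let ?d = "\<lambda>x. scaleC (of_real K) x + scaleC (-1) (h x)"
  have d: "?d \<in> A" using assms(1) by (intro add_in scaleC_in scaleC_id_in)
  have "positive_operator ?d"
    unfolding positive_operator_def
  proof (intro allI conjI)
    fix x
    have "cinner (h x) x = cnj (cinner (h x) x)"
      using assms(2) cinner_commute by (metis is_adjoint_def)
    then have r: "cinner (h x) x \<in> \<real>" by (metis Reals_cnj_iff)
    moreover have "cinner x x \<in> \<real>" by (metis Reals_cnj_iff cinner_commute)
    ultimately show "cinner (?d x) x \<in> \<real>"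
      by (simp add: cinner_add_left cinner_scaleC_left)
    have "inner (h x) x \<le> norm (h x) * norm x" by (rule norm_cauchy_schwarz)
    also have "\<dots> \<le> (K * norm x) * norm x" by (intro mult_right_mono assms(3)) simp
    finally have "inner (h x) x \<le> K * inner x x"
      by (simp add: power2_norm_eq_inner[symmetric] power2_eq_square)
    then show "0 \<le> Re (cinner (?d x) x)"
      by (simp add: cinner_add_left cinner_scaleC_left Re_cinner)
  qed
  then have "\<tau> ?d \<in> \<real> \<and> 0 \<le> Re (\<tau> ?d)"
    using wstar d by (auto simp: wstar_probability_space_def state_on_def)
  moreover have "\<tau> ?d = of_real K - \<tau> h"
    using assms(1) by (simp only: trace_add trace_scaleC scaleC_in scaleC_id_in trace_scaleC_id) simp
  ultimately have *: "of_real K - \<tau> h \<in> \<real>" "0 \<le> Re (of_real K - \<tau> h)" by auto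
  have "of_real K - (of_real K - \<tau> h) \<in> \<real>"
    by (intro Reals_diff *) auto
  then show "\<tau> h \<in> \<real>" by simp
  show "Re (\<tau> h) \<le> K" using *(2) by simp
qed

text \<open>Rotate \<open>a\<close> by a unimodular \<open>l\<close> so that
  \<open>l * \<tau> a\<close> is the norm of \<open>\<tau> a\<close>, and write
  \<open>l a = h + \<i> k\<close> with self-adjoint \<open>h\<close> and \<open>k\<close>. The trace
  of \<open>k\<close> is real and hence contributes no real part, and \<open>h\<close> inherits the
  bound \<open>K\<close>.\<close>

lemma norm_trace_le:
  assumes "a \<in> A" and "\<And>x. norm (a x) \<le> K * norm x"
  shows "norm (\<tau> a) \<le> K"
proof -
  obtain b where b: "b \<in> A" "is_adjoint a b"
    using algebra assms(1) by (auto simp: von_neumann_algebra_def)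
  have b': "cinner (b x) y = cinner x (a y)" for x y
    using b(2) cinner_commute by (metis is_adjoint_def)
  obtain l where l: "norm l = 1" "l * \<tau> a = of_real (norm (\<tau> a))"
  proof (cases "\<tau> a = 0")
    case False
    then show ?thesis
      by (intro that[of "cnj (\<tau> a) / norm (\<tau> a)"])
        (auto simp: norm_divide complex_norm_square[symmetric] power2_eq_square mult.commute[of "cnj _"])
  qed (auto intro: that[of 1])
  have ll: "l * cnj l = 1" using l(1) by (metis complex_norm_square of_real_1 power_one)
  let ?h = "\<lambda>x. scaleC (l / 2) (a x) + scaleC (cnj l / 2) (b x)"
  let ?k = "\<lambda>x. scaleC (l / (2 * \<i>)) (a x) + scaleC (- cnj l / (2 * \<i>)) (b x)"
  have in_A: "?h \<in> A" "?k \<in> A" using assms(1) b(1) by (auto intro!: add_in scaleC_in)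
  have sa: "is_adjoint ?h ?h" "is_adjoint ?k ?k"
    using b(2)
    by (auto simp: is_adjoint_def cinner_add_left cinner_add_right cinner_scaleC_left
        cinner_scaleC_right b')
  have bb: "norm (b x) \<le> K * norm x" for x by (rule adjoint_norm[OF b(2) assms(2)])
  have half: "norm (c * l / 2) = 1/2" "norm (c * cnj l / 2) = 1/2" if "norm c = 1" for c
    using l(1) that by (auto simp: norm_mult norm_divide)
  have n: "norm (scaleC c (a x) + scaleC d (b x)) \<le> K * norm x"
    if "norm c = 1/2" "norm d = 1/2" for c d x
    using norm_triangle_ineq[of "scaleC c (a x)" "scaleC d (b x)"] assms(2)[of x] bb[of x] that
    by (simp add: norm_scaleC)
  have nh: "norm (?h x) \<le> K * norm x" and nk: "norm (?k x) \<le> K * norm x" for x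
    using l(1) by (auto intro!: n simp: norm_divide norm_mult)
  have "l * \<tau> a = \<tau> ?h + \<i> * \<tau> ?k"
    using assms(1) b(1) by (simp add: trace_add trace_scaleC scaleC_in field_simps)
  then have "of_real (norm (\<tau> a)) = \<tau> ?h + \<i> * \<tau> ?k" using l(2) by simp
  then have "Re (of_real (norm (\<tau> a))) = Re (\<tau> ?h + \<i> * \<tau> ?k)" by (rule arg_cong)
  then have "norm (\<tau> a) = Re (\<tau> ?h) - Im (\<tau> ?k)" by simp
  moreover have "Im (\<tau> ?k) = 0"
    using trace_selfadjoint(1)[OF in_A(2) sa(2) nk] by (simp add: complex_is_Real_iff)
  moreover have "Re (\<tau> ?h) \<le> K"
    by (rule trace_selfadjoint(2)[OF in_A(1) sa(1) nh])
  ultimately show ?thesis by simp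
qed

text \<open>Only moments of \<open>u\<close> are known. Both sides satisfy the same recursion with
  the moments as source terms, so their difference satisfies \<open>e n = z * e (Suc n)\<close> and
  is bounded, hence zero.\<close>

lemma trace_power_resolvent:
  assumes "u \<in> A" and "unitary_operator u" and "unitary_distribution \<tau> u \<mu>" and "norm z < 1"
  shows "\<tau> ((u ^^ n) \<circ> op_resolvent z u) = (\<integral>x. x ^ n / (1 - z * x) \<partial>\<mu>)"
proof -
  let ?R = "op_resolvent z u"
  have \<mu>: "circle_prob \<mu>" using assms(3) by (simp add: unitary_distribution_def)
  have R: "?R \<in> A" by (rule op_resolvent_in_von_neumann_algebra[OF assms(2,4) algebra assms(1)])
  have moment: "\<tau> (u ^^ n) = (\<integral>x. x ^ n \<partial>\<mu>)" for n
  proof -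
    have "\<tau> (op_powi u (int n)) = (\<integral>x. x powi (int n) \<partial>\<mu>)"
      using assms(3) by (simp add: unitary_distribution_def)
    then show ?thesis by (simp add: op_powi_def)
  qed
  define e where "e n = \<tau> ((u ^^ n) \<circ> ?R) - (\<integral>x. x ^ n / (1 - z * x) \<partial>\<mu>)" for n
  have rec: "e n = z * e (Suc n)" for n
  proof -
    have lin: "(u ^^ n) (x + y) = (u ^^ n) x + (u ^^ n) y"
      "(u ^^ n) (scaleC c x) = scaleC c ((u ^^ n) x)" for x y c
      using bounded_operatorsD[OF algebra_bounded[OF funpow_in[OF assms(1)]]] by auto
    have "(u ^^ n) \<circ> ?R = (\<lambda>x. (u ^^ n) x + scaleC z (((u ^^ Suc n) \<circ> ?R) x))"
    proof
      fix x
      have "(u ^^ n) (?R x) = (u ^^ n) (x + scaleC z (u (?R x)))"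
        by (simp only: op_resolvent_eq[OF assms(2,4), symmetric])
      also have "\<dots> = (u ^^ n) x + scaleC z ((u ^^ Suc n) (?R x))"
        by (simp add: lin funpow_swap1[of u n])
      finally show "((u ^^ n) \<circ> ?R) x = (u ^^ n) x + scaleC z (((u ^^ Suc n) \<circ> ?R) x)"
        by simp
    qed
    then have "\<tau> ((u ^^ n) \<circ> ?R) = \<tau> (u ^^ n) + z * \<tau> ((u ^^ Suc n) \<circ> ?R)"
      using R assms(1) by (simp only: trace_add trace_scaleC scaleC_in comp_in funpow_in)
    then show ?thesis
      unfolding e_def integral_power_resolvent_rec[OF \<mu> assms(4), of n] moment
      by (simp only:) (simp add: algebra_simps)
  qed
  have "norm (e n) \<le> 2 / (1 - norm z) * 1 ^ n" for n
  proof -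
    have "norm ((u ^^ n) x) = norm x" for n x
      by (induction n) (auto simp: unitary_operator_norm[OF assms(2)])
    then have "norm (\<tau> ((u ^^ n) \<circ> ?R)) \<le> 1 / (1 - norm z)"
      using R assms(1) op_resolvent_norm[OF assms(2,4)]
      by (intro norm_trace_le comp_in funpow_in) auto
    moreover have "norm (\<integral>x. x ^ n / (1 - z * x) \<partial>\<mu>) \<le> 1 / (1 - norm z)"
      by (rule integrable_power_resolvent(2)[OF \<mu> assms(4)])
    ultimately have "norm (e n) \<le> 1 / (1 - norm z) + 1 / (1 - norm z)"
      unfolding e_def by (intro order_trans[OF norm_triangle_ineq4] add_mono)
    then show ?thesis by simp
  qed
  from bounded_sequence_geometric_zero[OF rec this] assms(4) show ?thesis
    by (simp add: e_def)
qed

lemma trace_resolvent: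
  assumes "u \<in> A" and "unitary_operator u" and "unitary_distribution \<tau> u \<mu>" and "norm z < 1"
  shows "\<tau> (op_resolvent z u) = resolvent_transform \<mu> z"
    and "\<tau> (u \<circ> op_resolvent z u) = shifted_transform \<mu> z"
  using trace_power_resolvent[OF assms, of 0] trace_power_resolvent[OF assms, of 1]
  by (auto simp: resolvent_transform_def shifted_transform_def)

lemma free_word:
  assumes "freely_independent \<tau> u v" and "ws \<noteq> []" and "successively (\<lambda>p q. fst p \<noteq> fst q) ws"
    and "\<And>b a. (b, a) \<in> set ws \<Longrightarrow> a \<in> (if b then vn_generated u else vn_generated v) \<and> \<tau> a = 0"
  shows "\<tau> (foldr (\<circ>) (map snd ws) id) = 0"
proof -
  have "fst (ws ! k) \<noteq> fst (ws ! Suc k)" if "Suc k < length ws" for k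
    by (rule successively_nth[OF assms(3) that])
  moreover have "snd (ws ! k) \<in> (if fst (ws ! k) then vn_generated u else vn_generated v) \<and> \<tau> (snd (ws ! k)) = 0"
    if "k < length ws" for k
    using assms(4)[of "fst (ws ! k)" "snd (ws ! k)"] nth_mem[OF that] by simp
  ultimately show ?thesis
    using assms(1)[unfolded freely_independent_def, rule_format, of "map snd ws" "map fst ws"] assms(2)
    by simp
qed

section \<open>Traces of alternating products of centred elements\<close>

context
  fixes u v U V :: "'h \<Rightarrow> 'h"
  assumes u_in: "u \<in> A" and v_in: "v \<in> A" and free: "freely_independent \<tau> u v"
    and U: "U \<in> vn_generated u" "\<tau> U = 0" and V: "V \<in> vn_generated v" "\<tau> V = 0"
begin

lemma U_in: "U \<in> A" and V_in: "V \<in> A"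
  using vn_generated_in u_in v_in U V by auto

lemma trace_alt_V: "\<tau> (V \<circ> (U \<circ> V) ^^ k) = 0"
proof -
  have "\<tau> (foldr (\<circ>) (map snd ((False, V) # alt_word U V k)) id) = 0"
    by (rule free_word[OF free])
      (use set_alt_word[of U V k] successively_alt_word[of V U V k] U V in auto)
  then show ?thesis by (simp add: foldr_alt_word)
qed

lemma trace_alt_head:
  assumes "a \<in> vn_generated u" and "\<tau> a = 0"
  shows "\<tau> (a \<circ> (V \<circ> (U \<circ> V) ^^ k)) = 0"
proof -
  have "\<tau> (foldr (\<circ>) (map snd ((True, a) # (False, V) # alt_word U V k)) id) = 0"
    by (rule free_word[OF free])
      (use set_alt_word[of U V k] successively_alt_word[of V U V k] U V assms in auto)
  then show ?thesis by (simp add: foldr_alt_word)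
qed

text \<open>Split \<open>a\<close> into its centred part and a scalar. The first gives an
  alternating word starting in the algebra of \<open>u\<close>, the second a multiple of one
  starting with \<open>V\<close>; both have trace zero.\<close>

lemma trace_alt_general:
  assumes "a \<in> vn_generated u"
  shows "\<tau> (a \<circ> (V \<circ> (U \<circ> V) ^^ k)) = 0"
proof -
  let ?W = "V \<circ> (U \<circ> V) ^^ k"
  let ?a = "\<lambda>x. a x + scaleC (- \<tau> a) x"
  have W: "?W \<in> A" using U_in V_in by (intro comp_in funpow_in)
  have a: "a \<in> A" using assms vn_generated_in u_in by blast
  have "?a \<in> vn_generated u"
    using assms vn_generated_closed(3)[OF vn_generated_closed(4)[OF assms assms]]
    by (intro vn_generated_closed(2)) auto
  moreover have "\<tau> ?a = 0"
    using a by (simp only: trace_add scaleC_id_in trace_scaleC_id) simp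
  ultimately have "\<tau> (?a \<circ> ?W) = 0" by (rule trace_alt_head)
  moreover have "?a \<circ> ?W = (\<lambda>x. (a \<circ> ?W) x + scaleC (- \<tau> a) (?W x))" by (simp add: o_def)
  ultimately have "\<tau> (a \<circ> ?W) + - \<tau> a * \<tau> ?W = 0"
    using a W by (simp only: trace_add trace_scaleC scaleC_in comp_in)
  then show ?thesis by (simp add: trace_alt_V)
qed

lemma trace_alt_UV: "\<tau> ((U \<circ> V) ^^ Suc k) = 0"
  using trace_alt_general[OF U(1), of k] by (simp add: o_assoc)

lemma trace_alt_U: "\<tau> (U \<circ> (U \<circ> V) ^^ k) = 0"
proof (cases k)
  case (Suc j)
  \<comment> \<open>The two adjacent factors merge into \<open>U \<circ> U\<close>, which need not
    be centred; this is what the version with an arbitrary left factor is for.\<close>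
  have "U \<circ> U \<in> vn_generated u" using U by (intro vn_generated_closed)
  from trace_alt_general[OF this, of j] show ?thesis using Suc by (simp add: o_assoc)
qed (use U in simp)

end

end

section \<open>Subordination functions from freeness\<close>

text \<open>The two equations make \<open>w1 * w2\<close> equal both to
  \<open>z * \<eta>1 w1\<close> and to \<open>z * \<eta>2 w2\<close>. Cancelling \<open>z\<close>
  leaves \<open>\<eta>1 w1 = \<eta>2 w2\<close>, and \<open>\<eta> = 1 - 1 / G\<close> determines
  \<open>G\<close>.\<close>

lemma resolvent_transform_eqI:
  assumes "circle_prob \<mu>1" and "circle_prob \<mu>2"
    and "norm z < 1" and "norm w1 < 1" and "norm w2 < 1"
    and "w1 = z * h_transform \<mu>2 w2" and "w2 = z * h_transform \<mu>1 w1"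
  shows "resolvent_transform \<mu>1 w1 = resolvent_transform \<mu>2 w2"
proof (cases "z = 0")
  case True
  then have "w1 = 0" "w2 = 0" using assms(6,7) by simp_all
  then show ?thesis using resolvent_transform_eq[of _ 0] assms(1,2) by simp
next
  case False
  define g1 g2 where "g1 = resolvent_transform \<mu>1 w1" and "g2 = resolvent_transform \<mu>2 w2"
  have "z * (w1 * h_transform \<mu>1 w1) = w1 * w2" by (subst assms(7)) (rule mult.left_commute)
  also have "\<dots> = z * (w2 * h_transform \<mu>2 w2)" by (subst assms(6)) (simp add: mult_ac)
  finally have "w1 * h_transform \<mu>1 w1 = w2 * h_transform \<mu>2 w2"
    using False by simp
  then have "(g1 - 1) / g1 = (g2 - 1) / g2"
    unfolding g1_def g2_def eta_transform_eq[OF assms(1,4)] eta_transform_eq[OF assms(2,5)] .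
  moreover have "g1 \<noteq> 0" "g2 \<noteq> 0"
    using resolvent_transform_nonzero assms(1,2,4,5) by (auto simp: g1_def g2_def)
  ultimately show ?thesis by (simp add: diff_divide_distrib g1_def g2_def)
qed

context trace_space
begin

text \<open>With \<open>g\<close> the common value of the transforms, \<open>R1\<close>, \<open>R2\<close> the resolvents of \<open>u\<close>, \<open>v\<close> at
  \<open>w1\<close>, \<open>w2\<close>, and \<open>U\<close>, \<open>V\<close> the centred parts of \<open>u R1\<close>, \<open>v R2\<close>, the subordination equations give
  \<open>R1 (1 - z u v) R2 = g (1 - (z / g\<^sup>2) U V)\<close>. Expanding the inverse of the right-hand side yields
  alternating products, on which the trace vanishes by freeness.\<close>

lemma resolvent_transform_free_small:
  assumes "u \<in> A" and "v \<in> A" and "unitary_operator u" and "unitary_operator v"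
    and "freely_independent \<tau> u v"
    and "unitary_distribution \<tau> u \<mu>1" and "unitary_distribution \<tau> v \<mu>2"
    and "unitary_distribution \<tau> (u \<circ> v) \<nu>"
    and "64 * norm z < 1" and "norm w1 \<le> 1/2" and "norm w2 \<le> 1/2"
    and "w1 = z * h_transform \<mu>2 w2" and "w2 = z * h_transform \<mu>1 w1"
  shows "resolvent_transform \<nu> z = resolvent_transform \<mu>1 w1"
proof -
  have \<mu>: "circle_prob \<mu>1" "circle_prob \<mu>2" "circle_prob \<nu>"
    using assms(6-8) by (auto simp: unitary_distribution_def)
  have n: "norm z < 1" "norm w1 < 1" "norm w2 < 1" using assms(9-11) by auto
  define g where "g = resolvent_transform \<mu>1 w1"
  define k1 where "k1 = shifted_transform \<mu>1 w1"
  define k2 where "k2 = shifted_transform \<mu>2 w2"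
  have g2: "g = resolvent_transform \<mu>2 w2"
    unfolding g_def by (rule resolvent_transform_eqI[OF \<mu>(1,2) n assms(12,13)])
  have g0: "g \<noteq> 0" "1/2 \<le> norm g" using resolvent_transform_nonzero[OF \<mu>(1) n(2)] by (auto simp: g_def)
  have e1: "g = 1 + w1 * k1" and e2: "g = 1 + w2 * k2"
    using resolvent_transform_eq[OF \<mu>(1) n(2)] resolvent_transform_eq[OF \<mu>(2) n(3)]
    by (auto simp: g_def[symmetric] g2[symmetric] k1_def k2_def)
  \<comment> \<open>The identities \<open>s1\<close> to \<open>s4\<close> are the coefficients of
    \<open>U\<close>, \<open>V\<close>, the identity and \<open>U V\<close> in the expansion of
    \<open>R1 (1 - z u v) R2\<close>; the mixed-free terms in \<open>U\<close> and \<open>V\<close>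
    alone cancel.\<close>
  have s1: "w1 * g = z * k2" and s2: "w2 * g = z * k1"
    using g0
    by (subst assms(12), simp add: h_transform_def g2[symmetric] k2_def,
        subst assms(13), simp add: h_transform_def g_def[symmetric] k1_def)
  have s3: "g * g - z * (k1 * k2) = g"
  proof -
    have "z * (k1 * k2) = (w1 * g) * k1" by (simp only: s1) simp
    also have "\<dots> = g * (w1 * k1)" by simp
    also have "\<dots> = g * (g - 1)" using e1 by simp
    finally show ?thesis by (simp add: algebra_simps)
  qed
  have s4: "w1 * w2 - z = - (z / g)"
  proof -
    have "w1 * w2 * g = w1 * (z * k1)" by (simp only: s2[symmetric] mult.assoc)
    also have "\<dots> = z * (g - 1)" using e1 by (simp add: mult.left_commute)
    finally show ?thesis using g0 by (simp add: field_simps)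
  qed
  define R1 where "R1 = op_resolvent w1 u"
  define R2 where "R2 = op_resolvent w2 v"
  define S where "S = op_resolvent z (u \<circ> v)"
  have uv: "u \<circ> v \<in> A" "unitary_operator (u \<circ> v)"
    using assms(1-4) by (auto intro: comp_in unitary_operator_comp)
  note in_vn = op_resolvent_in_vn_generated
  have u_vn: "u \<in> vn_generated u" "v \<in> vn_generated v" by (auto simp: vn_generated_def)
  have R_vn: "R1 \<in> vn_generated u" "R2 \<in> vn_generated v"
    using in_vn assms(3,4) n by (auto simp: R1_def R2_def)
  have R_in: "R1 \<in> A" "R2 \<in> A" "S \<in> A"
    using R_vn vn_generated_in assms(1,2) op_resolvent_in_von_neumann_algebra[OF uv(2) n(1) algebra uv(1)]
    by (auto simp: S_def)
  define U where "U = (\<lambda>x. u (R1 x) + scaleC (- k1) x)"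
  define V where "V = (\<lambda>x. v (R2 x) + scaleC (- k2) x)"
  have UV_vn: "U \<in> vn_generated u" "V \<in> vn_generated v"
    using vn_generated_affine[OF u_vn(1) R_vn(1), of "- k1"] vn_generated_affine[OF u_vn(2) R_vn(2), of "- k2"]
    by (simp_all add: U_def V_def)
  have "\<tau> (\<lambda>x. (u \<circ> R1) x + scaleC (- k1) x) = 0" "\<tau> (\<lambda>x. (v \<circ> R2) x + scaleC (- k2) x) = 0"
    using trace_resolvent(2)[OF assms(1,3,6) n(2)] trace_resolvent(2)[OF assms(2,4,7) n(3)] R_in assms(1,2)
    by (simp_all only: trace_add scaleC_id_in trace_scaleC_id comp_in R1_def R2_def k1_def k2_def) simp_all
  then have UV_trace: "\<tau> U = 0" "\<tau> V = 0" by (auto simp: U_def V_def)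
  have UV_in: "U \<in> A" "V \<in> A" using UV_vn vn_generated_in assms(1,2) by auto
  note traces = trace_alt_V[OF assms(1,2,5) UV_vn(1) UV_trace(1) UV_vn(2) UV_trace(2)]
    trace_alt_U[OF assms(1,2,5) UV_vn(1) UV_trace(1) UV_vn(2) UV_trace(2)]
    trace_alt_UV[OF assms(1,2,5) UV_vn(1) UV_trace(1) UV_vn(2) UV_trace(2)]
  define X where "X = U \<circ> V"
  have X_in: "X \<in> A" "X ^^ k \<in> A" for k using UV_in by (auto simp: X_def intro: comp_in funpow_in)
  note lin = bounded_operatorsD[OF algebra_bounded]
  note sC = scaleC_add_right scaleC_diff_right scaleC_scaleC scaleC_uminus_left
  have uR: "u (R1 y) = U y + scaleC k1 y" and vR: "v (R2 y) = V y + scaleC k2 y" for y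
    by (auto simp: U_def V_def scaleC_uminus_left)
  \<comment> \<open>From \<open>R1 = 1 + w1 u R1\<close> and \<open>u R1 = U + k1\<close>, the
    scalar part is \<open>1 + w1 * k1 = g\<close>.\<close>
  have R1_eq: "R1 y = scaleC g y + scaleC w1 (U y)" for y
    using op_resolvent_eq[OF assms(3) n(2), of y]
    by (simp add: R1_def[symmetric] uR e1 sC scaleC_add_left scaleC_one)
  have R2_eq: "R2 y = scaleC g y + scaleC w2 (V y)" for y
    using op_resolvent_eq[OF assms(4) n(3), of y]
    by (simp add: R2_def[symmetric] vR e2 sC scaleC_add_left scaleC_one)
  have R1u: "R1 (u y) = u (R1 y)" for y
    unfolding R1_def by (rule op_resolvent_commute[OF assms(3) n(2)]) (auto intro: algebra_bounded assms(1))
  have R2v: "R2 (v y) = v (R2 y)" for y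
    unfolding R2_def by (rule op_resolvent_commute[OF assms(4) n(3)]) (auto intro: algebra_bounded assms(2))
  have key: "R1 (R2 y - scaleC z (u (v (R2 y)))) = scaleC g y - scaleC (z / g) (X y)" for y
  proof -
    have a: "R1 (R2 y) = scaleC (g * g) y + scaleC (w2 * g) (V y) + scaleC (w1 * g) (U y)
        + scaleC (w1 * w2) (X y)"
      by (simp add: R1_eq R2_eq lin(1)[OF UV_in(1)] lin(3)[OF UV_in(1)] sC X_def mult.commute)
    have b: "u (R1 (v (R2 y))) = scaleC (k1 * k2) y + scaleC k1 (V y) + scaleC k2 (U y) + X y"
      by (simp add: uR vR lin(1)[OF UV_in(1)] lin(3)[OF UV_in(1)] sC X_def)
    have "R1 (R2 y - scaleC z (u (v (R2 y)))) = R1 (R2 y) - scaleC z (u (R1 (v (R2 y))))"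
      by (simp add: lin(2)[OF R_in(1)] lin(3)[OF R_in(1)] R1u)
    also have "\<dots> = scaleC (g * g - z * (k1 * k2)) y + scaleC (w2 * g - z * k1) (V y)
        + scaleC (w1 * g - z * k2) (U y) + scaleC (w1 * w2 - z) (X y)"
      by (simp add: a b sC scaleC_diff_left)
    also have "\<dots> = scaleC g y - scaleC (z / g) (X y)"
      by (simp add: s1 s2 s3 s4 scaleC_zero_left scaleC_uminus_left)
    finally show ?thesis .
  qed
  define c where "c = z / (g * g)"
  \<comment> \<open>\<open>Y\<close> is \<open>(1 - w2 v) S\<close>, so \<open>R2 Y = S\<close>, and
    \<open>key\<close> applied to \<open>Y\<close> becomes
    \<open>(g - (z / g) X) Y = R1\<close>.\<close>
  define Y where "Y = (\<lambda>x. S x + scaleC (- w2) (v (S x)))"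
  have Y_in: "Y \<in> A"
  proof -
    have "(\<lambda>x. S x + scaleC (- w2) ((v \<circ> S) x)) \<in> A"
      using R_in assms(2) by (intro add_in scaleC_in comp_in)
    then show ?thesis by (simp add: Y_def)
  qed
  have R2Y: "R2 (Y x) = S x" for x
    unfolding R2_def by (rule op_resolvent_unique[OF assms(4) n(3)]) (simp add: Y_def scaleC_uminus_left)
  have RS: "S x - scaleC z (u (v (S x))) = x" for x
    using op_resolvent_right[OF uv(2) n(1), of x] by (simp add: S_def)
  have Y_rec: "Y x = scaleC (1 / g) (R1 x) + scaleC c (X (Y x))" for x
  proof -
    have "scaleC g (Y x) - scaleC (z / g) (X (Y x)) = R1 x"
      using key[of "Y x"] by (simp add: R2Y RS)
    then have "scaleC (1 / g) (scaleC g (Y x) - scaleC (z / g) (X (Y x))) = scaleC (1 / g) (R1 x)" by simp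
    then show ?thesis using g0 by (simp add: sC scaleC_one c_def algebra_simps)
  qed
  \<comment> \<open>\<open>E 0\<close> is the trace of \<open>S\<close>, the quantity sought.
    Substituting \<open>Y_rec\<close> repeatedly produces the source terms
    \<open>F k\<close>.\<close>
  define E where "E k = \<tau> (R2 \<circ> (X ^^ k \<circ> Y))" for k
  define F where "F k = \<tau> (R2 \<circ> (X ^^ k \<circ> R1))" for k
  have E_rec: "E k = 1 / g * F k + c * E (Suc k)" for k
  proof -
    have "R2 \<circ> (X ^^ k \<circ> Y)
        = (\<lambda>x. scaleC (1 / g) ((R2 \<circ> (X ^^ k \<circ> R1)) x) + scaleC c ((R2 \<circ> (X ^^ Suc k \<circ> Y)) x))"
    proof
      fix x
      have "(R2 \<circ> (X ^^ k \<circ> Y)) x = R2 ((X ^^ k) (scaleC (1 / g) (R1 x) + scaleC c (X (Y x))))"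
        by (simp only: comp_apply Y_rec[symmetric])
      also have "\<dots> = scaleC (1 / g) (R2 ((X ^^ k) (R1 x))) + scaleC c (R2 ((X ^^ k) (X (Y x))))"
        by (simp add: lin(1)[OF X_in(2)] lin(3)[OF X_in(2)] lin(1)[OF R_in(2)] lin(3)[OF R_in(2)])
      also have "(X ^^ k) (X (Y x)) = (X ^^ Suc k) (Y x)" by (simp add: funpow_swap1)
      finally show "(R2 \<circ> (X ^^ k \<circ> Y)) x
        = scaleC (1 / g) ((R2 \<circ> (X ^^ k \<circ> R1)) x) + scaleC c ((R2 \<circ> (X ^^ Suc k \<circ> Y)) x)" by simp
    qed
    then show ?thesis
      unfolding E_def F_def using R_in X_in Y_in
      by (simp only: trace_add trace_scaleC scaleC_in comp_in)
  qed
  have F_eq: "F k = (if k = 0 then g * g else 0)" for k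
  proof -
    have "(X ^^ k) \<circ> R1 \<in> A" "R2 \<circ> X ^^ k \<in> A" using X_in R_in by (auto intro: comp_in)
    \<comment> \<open>Traciality brings \<open>R1\<close> next to \<open>R2\<close>. Expanding the
      product leaves \<open>X ^^ k\<close> and alternating products of centred factors, so only
      \<open>k = 0\<close> survives.\<close>
    then have "F k = \<tau> (R1 \<circ> (R2 \<circ> X ^^ k))"
      using trace_commute[of "R2 \<circ> X ^^ k" R1] R_in by (simp add: F_def o_assoc)
    also have "R1 \<circ> (R2 \<circ> X ^^ k) = (\<lambda>x. scaleC (g * g) ((X ^^ k) x) + (scaleC (g * w2) ((V \<circ> X ^^ k) x)
        + (scaleC (w1 * g) ((U \<circ> X ^^ k) x) + scaleC (w1 * w2) ((X ^^ Suc k) x))))"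
      by (simp add: fun_eq_iff R1_eq R2_eq lin(1)[OF UV_in(1)] lin(3)[OF UV_in(1)] sC X_def)
    also have "\<tau> \<dots> = g * g * \<tau> (X ^^ k) + (g * w2 * \<tau> (V \<circ> X ^^ k)
        + (w1 * g * \<tau> (U \<circ> X ^^ k) + w1 * w2 * \<tau> (X ^^ Suc k)))"
      using UV_in X_in by (simp only: trace_add trace_scaleC add_in scaleC_in comp_in)
    also have "\<dots> = g * g * \<tau> (X ^^ k)"
      using traces by (simp only: X_def) simp
    also have "\<tau> (X ^^ k) = (if k = 0 then 1 else 0)"
    proof (cases k)
      case 0
      then show ?thesis using trace_scaleC_id[of 1] by (simp add: scaleC_one id_def)
    next
      case (Suc j)
      then show ?thesis using traces(3)[of j] by (simp only: X_def) simp
    qed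
    finally show ?thesis by simp
  qed
  \<comment> \<open>For \<open>|w1|, |w2| <= 1/2\<close> the resolvents are bounded by 2 and
    \<open>k1\<close>, \<open>k2\<close> by 2, hence \<open>U\<close> and \<open>V\<close> by
    4.\<close>
  have bound: "norm (X x) \<le> 16 * norm x" for x
  proof -
    have r: "norm (U y) \<le> 4 * norm y" "norm (V y) \<le> 4 * norm y" for y
    proof -
      have k: "norm k1 \<le> 2" "norm k2 \<le> 2"
      proof -
        have "1 / (1 - norm w1) \<le> 2" "1 / (1 - norm w2) \<le> 2"
          using assms(10,11) by (auto simp: field_simps)
        then show "norm k1 \<le> 2" "norm k2 \<le> 2"
          using integrable_power_resolvent(2)[OF \<mu>(1) n(2), of 1] integrable_power_resolvent(2)[OF \<mu>(2) n(3), of 1]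
          by (auto simp: k1_def k2_def shifted_transform_def)
      qed
      have d: "1 / (1 - norm w) * norm y \<le> 2 * norm y" if "norm w \<le> 1/2" for w :: complex
        using that by (intro mult_right_mono) (auto simp: field_simps)
      have "norm (R1 y) \<le> 2 * norm y" "norm (R2 y) \<le> 2 * norm y"
        using op_resolvent_norm[OF assms(3) n(2), of y] op_resolvent_norm[OF assms(4) n(3), of y]
          d[OF assms(10)] d[OF assms(11)] by (auto simp: R1_def R2_def)
      moreover have "norm (scaleC (- k1) y) \<le> 2 * norm y" "norm (scaleC (- k2) y) \<le> 2 * norm y"
        using k by (auto simp: norm_scaleC intro: mult_right_mono)
      ultimately show "norm (U y) \<le> 4 * norm y" "norm (V y) \<le> 4 * norm y"
        using norm_triangle_ineq[of "u (R1 y)" "scaleC (- k1) y"]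
          norm_triangle_ineq[of "v (R2 y)" "scaleC (- k2) y"]
        unfolding U_def V_def
        by (auto simp: unitary_operator_norm[OF assms(3)] unitary_operator_norm[OF assms(4)])
    qed
    show ?thesis using r(1)[of "V x"] r(2)[of x] by (simp add: X_def)
  qed
  have Xk: "norm ((X ^^ k) x) \<le> 16 ^ k * norm x" for k x
  proof (induction k)
    case (Suc k)
    then show ?case using bound[of "(X ^^ k) x"] by simp
  qed simp
  obtain KY where KY: "\<And>x. norm (Y x) \<le> norm x * KY"
    using bounded_linear.bounded[OF lin(4)[OF Y_in]] by blast
  obtain KR where KR: "\<And>x. norm (R2 x) \<le> norm x * KR" "KR > 0"
    using bounded_linear.pos_bounded[OF lin(4)[OF R_in(2)]] by blast
  have E_bound: "norm (E k) \<le> (KR * KY) * 16 ^ k" for k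
    unfolding E_def
  proof (rule norm_trace_le)
    show "R2 \<circ> (X ^^ k \<circ> Y) \<in> A" using R_in X_in Y_in by (intro comp_in)
    fix x
    have "norm ((R2 \<circ> (X ^^ k \<circ> Y)) x) \<le> norm ((X ^^ k) (Y x)) * KR" using KR(1) by simp
    also have "\<dots> \<le> (16 ^ k * norm (Y x)) * KR" using KR(2) by (intro mult_right_mono Xk) auto
    also have "\<dots> \<le> (16 ^ k * (norm x * KY)) * KR"
      using KR(2) KY by (intro mult_right_mono mult_left_mono) auto
    finally show "norm ((R2 \<circ> (X ^^ k \<circ> Y)) x) \<le> (KR * KY) * 16 ^ k * norm x" by (simp add: mult_ac)
  qed
  \<comment> \<open>\<open>|g| >= 1/2\<close> gives \<open>|c| <= 4 * |z|\<close>; together with the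
    bound 16 for \<open>X\<close> this is the origin of the condition
    \<open>64 * norm z < 1\<close>.\<close>
  have c16: "norm c * 16 < 1"
  proof -
    have "1/4 \<le> norm (g * g)" using mult_mono[OF g0(2) g0(2)] by (simp add: norm_mult)
    then have "norm c \<le> norm z / (1/4)" unfolding c_def norm_divide by (intro divide_left_mono) auto
    then show ?thesis using assms(9) by simp
  qed
  \<comment> \<open>The source term at index 0 is nonzero, so the homogeneous recursion starts only
    at index 1.\<close>
  have E_tail: "E (Suc n) = c * E (Suc (Suc n))" for n by (subst E_rec) (simp add: F_eq)
  have E_tail_bound: "norm (E (Suc n)) \<le> (KR * KY * 16) * 16 ^ n" for n using E_bound[of "Suc n"] by simp
  have "E (Suc 0) = 0"
    by (rule bounded_sequence_geometric_zero[where e = "\<lambda>n. E (Suc n)", OF E_tail E_tail_bound c16]) simp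
  then have "E 0 = g" using E_rec[of 0] F_eq[of 0] g0 by simp
  moreover have "R2 \<circ> Y = S" using R2Y by auto
  then have "E 0 = resolvent_transform \<nu> z"
    using trace_resolvent(1)[OF uv assms(8) n(1)] by (simp add: E_def S_def)
  ultimately show ?thesis by (simp add: g_def)
qed

end

text \<open>\<open>w1\<close> is the fixed point for the two functions \<open>h_transform\<close>,
  and \<open>w2\<close> is read off from it. The operator computation covers
  \<open>|z| < 1/64\<close>; the identity theorem extends the equality of transforms to the disc.
  The product formula is \<open>z * h_transform \<mu>1 z = 1 - 1 / G\<close> evaluated at
  \<open>w1\<close>.\<close>

theorem free_subordination:
  assumes "is_free_mult_convolution TYPE('h::complex_hilbert_space) \<mu>1 \<mu>2 \<nu>"
  obtains w1 w2 where "w1 holomorphic_on ball 0 1" and "w2 holomorphic_on ball 0 1"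
    and "\<forall>z\<in>ball 0 1. norm (w1 z) \<le> norm z" and "\<forall>z\<in>ball 0 1. norm (w2 z) \<le> norm z"
    and "\<forall>z\<in>ball 0 1. resolvent_transform \<mu>1 (w1 z) = resolvent_transform \<nu> z"
    and "\<forall>z\<in>ball 0 1. resolvent_transform \<mu>2 (w2 z) = resolvent_transform \<nu> z"
    and "\<forall>z\<in>ball 0 1. w1 z * w2 z * resolvent_transform \<nu> z = z * (resolvent_transform \<nu> z - 1)"
proof -
  obtain A :: "('h \<Rightarrow> 'h) set" and \<tau> u v where *:
    "wstar_probability_space A \<tau>" "u \<in> A" "v \<in> A" "unitary_operator u" "unitary_operator v"
    "freely_independent \<tau> u v" "unitary_distribution \<tau> u \<mu>1" "unitary_distribution \<tau> v \<mu>2"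
    "unitary_distribution \<tau> (u \<circ> v) \<nu>"
    using assms unfolding is_free_mult_convolution_def by blast
  interpret trace_space A \<tau> by standard (rule *(1))
  have \<mu>: "circle_prob \<mu>1" "circle_prob \<mu>2" "circle_prob \<nu>"
    using * by (auto simp: unitary_distribution_def)
  obtain w1 where w1: "w1 holomorphic_on ball 0 1" "\<And>z. norm z < 1 \<Longrightarrow> norm (w1 z) \<le> norm z"
    "\<And>z. norm z < 1 \<Longrightarrow> w1 z = z * h_transform \<mu>2 (z * h_transform \<mu>1 (w1 z))"
    using holomorphic_fixed_point_family[OF h_transform_holomorphic[OF \<mu>(2)] h_transform_holomorphic[OF \<mu>(1)]
        norm_h_transform_le[OF \<mu>(2)] norm_h_transform_le[OF \<mu>(1)]] by blast
  define w2 where "w2 z = z * h_transform \<mu>1 (w1 z)" for z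
  have w1_lt: "norm (w1 z) < 1" if "norm z < 1" for z using w1(2)[OF that] that by linarith
  have w2_hol: "w2 holomorphic_on ball 0 1"
    unfolding w2_def
    by (intro holomorphic_intros
        holomorphic_on_compose_gen[OF w1(1) h_transform_holomorphic[OF \<mu>(1)], unfolded o_def])
      (auto simp: w1_lt)
  have w2_le: "norm (w2 z) \<le> norm z" if "norm z < 1" for z
    using norm_h_transform_le[OF \<mu>(1) w1_lt[OF that]] by (simp add: w2_def norm_mult mult_left_le)
  have w2_lt: "norm (w2 z) < 1" if "norm z < 1" for z using w2_le[OF that] that by linarith
  have w1_eq: "w1 z = z * h_transform \<mu>2 (w2 z)" if "norm z < 1" for z
    using w1(3)[OF that] by (simp add: w2_def)
  have same: "resolvent_transform \<mu>1 (w1 z) = resolvent_transform \<mu>2 (w2 z)" if "norm z < 1" for z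
    by (rule resolvent_transform_eqI[OF \<mu>(1,2) that w1_lt[OF that] w2_lt[OF that] w1_eq[OF that] w2_def])
  have G: "resolvent_transform \<mu>1 (w1 z) = resolvent_transform \<nu> z" if "norm z < 1" for z
  proof (rule analytic_continuation_open[of "ball 0 (1/64)" "ball 0 1" "\<lambda>z. resolvent_transform \<mu>1 (w1 z)"])
    show "(\<lambda>z. resolvent_transform \<mu>1 (w1 z)) holomorphic_on ball 0 1"
      by (rule holomorphic_on_compose_gen[OF w1(1) resolvent_transform_holomorphic[OF \<mu>(1)], unfolded o_def])
        (auto simp: w1_lt)
    show "resolvent_transform \<nu> holomorphic_on ball 0 1" by (rule resolvent_transform_holomorphic[OF \<mu>(3)])
    fix z :: complex assume "z \<in> ball 0 (1/64)"
    then have z: "64 * norm z < 1" "norm z < 1" by auto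
    show "resolvent_transform \<mu>1 (w1 z) = resolvent_transform \<nu> z"
      using resolvent_transform_free_small[OF *(2-9) z(1) _ _ w1_eq[OF z(2)] w2_def]
        w1(2)[OF z(2)] w2_le[OF z(2)] z by simp
  qed (use that in auto)
  have prod: "w1 z * w2 z * resolvent_transform \<nu> z = z * (resolvent_transform \<nu> z - 1)"
    if z: "norm z < 1" for z
  proof -
    have "w1 z * w2 z = z * ((resolvent_transform \<nu> z - 1) / resolvent_transform \<nu> z)"
      using eta_transform_eq[OF \<mu>(1) w1_lt[OF z]] by (simp add: w2_def G[OF z] mult.left_commute)
    then show ?thesis using resolvent_transform_nonzero(1)[OF \<mu>(3) z] by simp
  qed
  show ?thesis
    by (rule that[OF w1(1) w2_hol]) (use w1(2) w2_le G prod same in auto)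
qed

section \<open>Arcs without mass\<close>

lemma norm_one_minus_cis: "norm (1 - cis w) = 2 * \<bar>sin (w / 2)\<bar>"
proof -
  have "(norm (1 - cis w))\<^sup>2 = 2 - 2 * cos w"
    using sin_cos_squared_add[of w] by (simp only: cmod_power2) (simp add: power2_eq_square algebra_simps)
  also have "\<dots> = (2 * \<bar>sin (w / 2)\<bar>)\<^sup>2"
    using cos_double_sin[of "w / 2"] by (simp add: power_mult_distrib)
  finally show ?thesis by (rule power2_eq_imp_eq) auto
qed

lemma norm_one_minus_cis_abs:
  assumes "\<bar>w\<bar> \<le> 2 * pi"
  shows "norm (1 - cis w) = 2 * sin (\<bar>w\<bar> / 2)"
proof -
  have "0 \<le> sin (\<bar>w\<bar> / 2)" using assms by (intro sin_ge_zero) auto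
  moreover have "\<bar>sin (w / 2)\<bar> = \<bar>sin (\<bar>w\<bar> / 2)\<bar>" by (cases "0 \<le> w") auto
  ultimately show ?thesis by (simp add: norm_one_minus_cis)
qed

lemma circle_eq_cis:
  assumes "norm x = 1"
  obtains y where "a < y" and "y \<le> a + 2 * pi" and "x = cis y"
proof -
  define k where "k = \<lfloor>(a - Arg x) / (2 * pi)\<rfloor> + 1"
  have "of_int k - 1 \<le> (a - Arg x) / (2 * pi)" "(a - Arg x) / (2 * pi) < of_int k"
    by (auto simp: k_def)
  then have "a < Arg x + of_int k * (2 * pi)" "Arg x + of_int k * (2 * pi) \<le> a + 2 * pi"
    by (auto simp: field_simps)
  moreover have "x = cis (Arg x + of_int k * (2 * pi))"
  proof -
    have "cis (of_int k * (2 * pi)) = 1" by (subst cis_eq_1_iff) auto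
    moreover have "cis (Arg x) = x"
      using assms by (cases "x = 0") (auto simp: cis_Arg sgn_eq)
    ultimately show ?thesis by (simp add: cis_mult[symmetric])
  qed
  ultimately show ?thesis using that by blast
qed

text \<open>The angle belongs to the argument of the transform: the kernel at
  \<open>z = cis \<theta>\<close> has its pole at \<open>x = cnj z\<close>, so the arc of the
  carrier is reflected. The quantifier over \<theta> stands inside, so one null set serves the whole
  arc.\<close>

definition null_arc :: "complex measure \<Rightarrow> real \<Rightarrow> real \<Rightarrow> bool" where
  "null_arc \<mu> a b \<longleftrightarrow> (AE x in \<mu>. \<forall>\<theta>. a < \<theta> \<and> \<theta> < b \<longrightarrow> cis \<theta> * x \<noteq> 1)"

text \<open>The carrier of \<open>\<mu>\<close> is parametrised by \<open>y \<mapsto> cis (- y)\<close>, so that \<open>cis \<theta> * x = 1\<close> corresponds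
  to \<open>y = \<theta>\<close>.\<close>

lemma null_arc_AE:
  assumes "circle_prob \<mu>" and "null_arc \<mu> a b"
  shows "AE x in \<mu>. \<exists>y. b \<le> y \<and> y \<le> a + 2 * pi \<and> x = cis (- y)"
  using assms(2)[unfolded null_arc_def] circle_prob_AE_norm[OF assms(1)]
proof eventually_elim
  case (elim x)
  then have "norm (cnj x) = 1" by simp
  then obtain y where y: "a < y" "y \<le> a + 2 * pi" "cnj x = cis y" by (rule circle_eq_cis)
  have x: "x = cis (- y)" using y(3) by (metis cis_cnj complex_cnj_cnj)
  have "b \<le> y"
  proof (rule ccontr)
    assume "\<not> b \<le> y"
    then have "cis y * x \<noteq> 1" using elim y by auto
    then show False by (simp add: x cis_mult)
  qed
  then show ?case using x y by blast
qed

lemma null_arc_open_arc: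
  assumes "circle_prob \<nu>" and "s < t" and "t \<le> s + 2 * pi" and "measure \<nu> (cis ` {s<..<t}) = 0"
  shows "null_arc \<nu> (- t) (- s)"
proof -
  interpret prob_space \<nu> using assms(1) by (simp add: circle_prob_def)
  \<comment> \<open>Seen as the complement of a compact set, the arc is measurable.\<close>
  have eq: "cis ` {s<..<t} = circle - cis ` {t..s + 2 * pi}"
  proof (intro equalityI subsetI)
    fix x assume "x \<in> cis ` {s<..<t}"
    then obtain y where y: "s < y" "y < t" "x = cis y" by auto
    have *: "x \<noteq> cis y'" if "t \<le> y'" "y' \<le> s + 2 * pi" for y'
    proof
      assume "x = cis y'"
      then have "cis (y' - y) = 1" using y(3) by (simp add: cis_divide[symmetric])
      then obtain n where n: "y' - y = of_int n * (2 * pi)" by (auto simp: cis_eq_1_iff)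
      have "0 < of_int n * (2 * pi)" "of_int n * (2 * pi) < 1 * (2 * pi)"
        unfolding n[symmetric] using y that by auto
      then have "0 < n" "of_int n < (1 :: real)"
        by (auto simp: zero_less_mult_iff dest: mult_right_less_imp_less)
      then show False by simp
    qed
    have "x \<notin> cis ` {t..s + 2 * pi}"
    proof
      assume "x \<in> cis ` {t..s + 2 * pi}"
      then obtain y' where "t \<le> y'" "y' \<le> s + 2 * pi" "x = cis y'" by auto
      with * show False by blast
    qed
    then show "x \<in> circle - cis ` {t..s + 2 * pi}" by (simp add: y(3))
  next
    fix x assume x: "x \<in> circle - cis ` {t..s + 2 * pi}"
    then have "norm x = 1" by simp
    then obtain y where y: "s < y" "y \<le> s + 2 * pi" "x = cis y" by (rule circle_eq_cis)
    then have "y < t" using x by force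
    then show "x \<in> cis ` {s<..<t}" using y by auto
  qed
  have "compact (cis ` {t..s + 2 * pi})"
    by (intro compact_continuous_image continuous_intros) auto
  then have "cis ` {s<..<t} \<in> sets \<nu>"
    unfolding eq by (intro circle_prob_sets[OF assms(1)] sets.Diff borel_closed compact_imp_closed) auto
  then have "AE x in \<nu>. x \<notin> cis ` {s<..<t}"
    using assms(4) by (intro AE_not_in) (auto simp: null_sets_def emeasure_eq_measure)
  then show ?thesis
    unfolding null_arc_def
  proof eventually_elim
    case (elim x)
    show ?case
    proof (intro allI impI notI)
      fix \<theta> assume "- t < \<theta> \<and> \<theta> < - s" and "cis \<theta> * x = 1"
      then have "x = cis (- \<theta>)" "- \<theta> \<in> {s<..<t}"
        by (auto simp: cis_inverse[symmetric] field_simps)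
      then show False using elim by blast
    qed
  qed
qed

text \<open>The differences \<open>y - \<theta>\<close> range over a compact subset of
  \<open>(0, 2 * pi)\<close>, so the chords \<open>2 * sin ((y - \<theta>) / 2)\<close> have a
  positive minimum \<open>2 * d\<close>. Moving \<open>z\<close> off the circle by at most
  \<open>d\<close> costs at most half of it.\<close>

lemma null_arc_distance:
  assumes "circle_prob \<nu>" and "null_arc \<nu> S T" and "S < a" and "a \<le> b" and "b < T" and "T \<le> S + 2 * pi"
  obtains d where "0 < d" and "d \<le> 1"
    and "AE x in \<nu>. \<forall>\<theta>\<in>{a..b}. \<forall>z. norm (z - cis \<theta>) \<le> d \<longrightarrow> d \<le> norm (1 - z * x)"
proof -
  have ne: "{T - b..S + 2 * pi - a} \<noteq> {}" using assms by auto
  have "continuous_on {T - b..S + 2 * pi - a} (\<lambda>w. sin (w / 2))" by (intro continuous_intros) auto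
  from continuous_attains_inf[OF compact_Icc ne this]
  obtain w0 where w0: "w0 \<in> {T - b..S + 2 * pi - a}"
    "\<And>w. w \<in> {T - b..S + 2 * pi - a} \<Longrightarrow> sin (w0 / 2) \<le> sin (w / 2)"
    by blast
  define d where "d = sin (w0 / 2)"
  have d: "0 < d" "d \<le> 1" using w0(1) assms by (auto simp: d_def intro!: sin_gt_zero)
  have "AE x in \<nu>. \<forall>\<theta>\<in>{a..b}. \<forall>z. norm (z - cis \<theta>) \<le> d \<longrightarrow> d \<le> norm (1 - z * x)"
    using null_arc_AE[OF assms(1,2)]
  proof eventually_elim
    case (elim x)
    then obtain y where y: "T \<le> y" "y \<le> S + 2 * pi" "x = cis (- y)" by blast
    show ?case
    proof (intro ballI allI impI)
      fix \<theta> z assume \<theta>: "\<theta> \<in> {a..b}" and z: "norm (z - cis \<theta>) \<le> d"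
      have "d \<le> sin ((y - \<theta>) / 2)" unfolding d_def using \<theta> y by (intro w0) auto
      then have "2 * d \<le> 2 * \<bar>sin ((\<theta> - y) / 2)\<bar>"
        by (metis abs_ge_self abs_minus_commute add.inverse_inverse minus_diff_eq minus_divide_left
            mult_left_mono order.trans sin_minus abs_minus_cancel zero_le_numeral)
      also have "\<dots> = norm (1 - cis \<theta> * x)" by (simp add: norm_one_minus_cis[symmetric] y cis_mult)
      also have "\<dots> \<le> norm (1 - z * x) + norm ((z - cis \<theta>) * x)"
        using norm_triangle_ineq[of "1 - z * x" "(z - cis \<theta>) * x"] by (simp add: algebra_simps)
      also have "\<dots> \<le> norm (1 - z * x) + d" using z y by (simp add: norm_mult)
      finally show "d \<le> norm (1 - z * x)" by simp
    qed
  qed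
  with d show ?thesis by (rule that)
qed

section \<open>Schwarz-Pick estimates up to the boundary\<close>

lemma schwarz_pick:
  fixes f :: "complex \<Rightarrow> complex"
  assumes "f holomorphic_on ball 0 1" and "\<And>z. norm z < 1 \<Longrightarrow> norm (f z) < 1"
    and "norm z < 1" and "norm w < 1"
  shows "norm (f z - f w) * norm (1 - cnj w * z) \<le> norm (z - w) * norm (1 - cnj (f w) * f z)"
proof -
  define g where "g = (\<lambda>u. Moebius_function 0 (f w) (f (Moebius_function 0 (- w) u)))"
  have w: "norm (- w) < 1" and fw: "norm (f w) < 1" using assms by auto
  have M: "norm (Moebius_function 0 (- w) u) < 1" if "norm u < 1" for u
    by (rule Moebius_function_norm_lt_1[OF w that])
  have "norm (g (Moebius_function 0 w z)) \<le> norm (Moebius_function 0 w z)"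
  proof (rule Schwarz_Lemma(1))
    show "g holomorphic_on ball 0 1"
      unfolding g_def
      by (rule holomorphic_on_compose_gen[where t = "ball 0 1" and g = "\<lambda>u. Moebius_function 0 (f w) (f u)", unfolded o_def,
          OF Moebius_function_holomorphic[OF w]
             holomorphic_on_compose_gen[where t = "ball 0 1", unfolded o_def,
               OF assms(1) Moebius_function_holomorphic[OF fw]]])
        (use assms(2) M in auto)
    show "g 0 = 0" by (simp add: g_def Moebius_function_of_zero Moebius_function_eq_zero)
    show "norm (g u) < 1" if "norm u < 1" for u
      unfolding g_def by (rule Moebius_function_norm_lt_1[OF fw assms(2)[OF M[OF that]]])
    show "norm (Moebius_function 0 w z) < 1" by (rule Moebius_function_norm_lt_1[OF assms(4,3)])
  qed
  also have "g (Moebius_function 0 w z) = Moebius_function 0 (f w) (f z)"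
    using Moebius_function_compose[of "- w" w z] w assms(3) by (simp add: g_def)
  finally have "norm ((f z - f w) / (1 - cnj (f w) * f z)) \<le> norm ((z - w) / (1 - cnj w * z))"
    by (simp add: Moebius_function_simple)
  moreover have nz: "1 - cnj a * b \<noteq> 0" if "norm a < 1" "norm b < 1" for a b :: complex
  proof
    assume "1 - cnj a * b = 0"
    then have "norm (cnj a * b) = 1" by (metis eq_iff_diff_eq_0 norm_one)
    then show False using mult_strict_mono'[OF that] by (simp add: norm_mult)
  qed
  ultimately show ?thesis
    using nz[OF assms(4,3)] nz[OF fw assms(2)[OF assms(3)]]
    by (simp add: norm_divide field_simps)
qed

lemma moebius_norm_identity:
  fixes z w :: complex
  shows "(norm (1 - cnj w * z))\<^sup>2 = (norm (z - w))\<^sup>2 + (1 - (norm z)\<^sup>2) * (1 - (norm w)\<^sup>2)"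
  by (simp only: cmod_power2) (simp add: power2_eq_square algebra_simps)

text \<open>The norm identity turns the squared Schwarz-Pick inequality into
  \<open>D * (E + P) <= E * (D + Q)\<close>. The common term cancels, and the two defect hypotheses
  give \<open>Q <= C^2 * P\<close>. The constant is independent of the distance to the circle, which
  permits boundary limits.\<close>

lemma schwarz_pick_lipschitz:
  fixes f :: "complex \<Rightarrow> complex"
  assumes "f holomorphic_on ball 0 1" and "\<And>z. norm z < 1 \<Longrightarrow> norm (f z) < 1"
    and "norm z < 1" and "norm w < 1"
    and "1 - (norm (f z))\<^sup>2 \<le> C * (1 - (norm z)\<^sup>2)" and "1 - (norm (f w))\<^sup>2 \<le> C * (1 - (norm w)\<^sup>2)"
    and "0 \<le> C"
  shows "norm (f z - f w) \<le> C * norm (z - w)"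
proof -
  define D where "D = (norm (f z - f w))\<^sup>2"
  define E where "E = (norm (z - w))\<^sup>2"
  define P where "P = (1 - (norm z)\<^sup>2) * (1 - (norm w)\<^sup>2)"
  define Q where "Q = (1 - (norm (f z))\<^sup>2) * (1 - (norm (f w))\<^sup>2)"
  have lt: "(norm a)\<^sup>2 < 1" if "norm a < 1" for a :: complex
    using that by (simp add: abs_square_less_1)
  have P: "0 < P" using lt assms(3,4) by (auto simp: P_def)
  have E: "0 \<le> E" by (simp add: E_def)
  have "(norm (f z - f w) * norm (1 - cnj w * z))\<^sup>2 \<le> (norm (z - w) * norm (1 - cnj (f w) * f z))\<^sup>2"
    by (rule power_mono[OF schwarz_pick[OF assms(1) _ assms(3,4)]])
      (auto intro: assms(2) mult_nonneg_nonneg)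
  then have "D * (E + P) \<le> E * (D + Q)"
    by (simp add: power_mult_distrib moebius_norm_identity D_def E_def P_def Q_def)
  then have "D * P \<le> E * Q" by (simp add: algebra_simps)
  also have "E * Q \<le> E * (C\<^sup>2 * P)"
  proof (rule mult_left_mono[OF _ E])
    have "Q \<le> (C * (1 - (norm z)\<^sup>2)) * (C * (1 - (norm w)\<^sup>2))"
      unfolding Q_def using lt[OF assms(2)[OF assms(4)]] lt[OF assms(3)] assms(5-7)
      by (intro mult_mono) auto
    then show "Q \<le> C\<^sup>2 * P" by (simp add: P_def power2_eq_square mult_ac)
  qed
  finally have "D * P \<le> (C\<^sup>2 * E) * P" by (simp add: mult_ac)
  then have "D \<le> C\<^sup>2 * E" using P by (rule mult_right_le_imp_le)
  then have "(norm (f z - f w))\<^sup>2 \<le> (C * norm (z - w))\<^sup>2" by (simp add: D_def E_def power_mult_distrib)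
  then show ?thesis by (rule power2_le_imp_le) (simp add: assms(7))
qed

text \<open>The resolvent identity and \<open>1 / (p q) <= (1 / p^2 + 1 / q^2) / 2\<close> reduce
  the difference to second moments. Integrability is assumed and not derived from
  \<open>norm w < 1\<close>, so that one point may lie on the circle.\<close>

lemma integral_norm_diff_resolvent_le:
  fixes w w' :: complex
  assumes "circle_prob \<mu>"
    and "integrable \<mu> (\<lambda>x. 1 / (norm (1 - w * x))\<^sup>2)" and "integrable \<mu> (\<lambda>x. 1 / (norm (1 - w' * x))\<^sup>2)"
    and "(\<integral>x. 1 / (norm (1 - w * x))\<^sup>2 \<partial>\<mu>) \<le> K" and "(\<integral>x. 1 / (norm (1 - w' * x))\<^sup>2 \<partial>\<mu>) \<le> K"
    and "integrable \<mu> (\<lambda>x. 1 / (1 - w * x))" and "integrable \<mu> (\<lambda>x. 1 / (1 - w' * x))"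
    and "AE x in \<mu>. w * x \<noteq> 1" and "AE x in \<mu>. w' * x \<noteq> 1"
  shows "norm (resolvent_transform \<mu> w - resolvent_transform \<mu> w') \<le> norm (w - w') * K"
proof -
  let ?f = "\<lambda>x. 1 / (norm (1 - w * x))\<^sup>2" and ?f' = "\<lambda>x. 1 / (norm (1 - w' * x))\<^sup>2"
  have "resolvent_transform \<mu> w - resolvent_transform \<mu> w' = (\<integral>x. 1 / (1 - w * x) - 1 / (1 - w' * x) \<partial>\<mu>)"
    using assms(6,7) by (simp add: resolvent_transform_def)
  also have "norm \<dots> \<le> (\<integral>x. norm (1 / (1 - w * x) - 1 / (1 - w' * x)) \<partial>\<mu>)"
    by (rule integral_norm_bound)
  also have "\<dots> \<le> (\<integral>x. norm (w - w') * ((?f x + ?f' x) / 2) \<partial>\<mu>)"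
  proof (rule integral_mono_AE)
    show "AE x in \<mu>. norm (1 / (1 - w * x) - 1 / (1 - w' * x)) \<le> norm (w - w') * ((?f x + ?f' x) / 2)"
      using assms(8,9) circle_prob_AE_norm[OF assms(1)]
    proof eventually_elim
      case (elim x)
      define p where "p = norm (1 - w * x)"
      define q where "q = norm (1 - w' * x)"
      have pq: "p \<noteq> 0" "q \<noteq> 0" using elim by (auto simp: p_def q_def)
      have "1 / (1 - w * x) - 1 / (1 - w' * x) = (w - w') * x / ((1 - w * x) * (1 - w' * x))"
        using elim by (simp add: field_simps)
      then have "norm (1 / (1 - w * x) - 1 / (1 - w' * x)) = norm (w - w') * ((1 / p) * (1 / q))"
        using elim by (simp add: norm_mult norm_divide p_def q_def)
      also have "\<dots> \<le> norm (w - w') * ((1 / p\<^sup>2 + 1 / q\<^sup>2) / 2)"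
        using sum_squares_bound[of "1 / p" "1 / q"]
        by (intro mult_left_mono) (auto simp: power_divide)
      finally show ?case by (simp add: p_def q_def)
    qed
  qed (use assms in auto)
  also have "\<dots> = norm (w - w') * (((\<integral>x. ?f x \<partial>\<mu>) + (\<integral>x. ?f' x \<partial>\<mu>)) / 2)"
    using assms(2,3) by simp
  also have "\<dots> \<le> norm (w - w') * K"
    using assms(4,5) by (intro mult_left_mono) auto
  finally show ?thesis .
qed

definition radii :: "nat \<Rightarrow> real" where
  "radii n = 1 - 1 / (of_nat n + 2)"

lemma radii_bounds: "0 < radii n" "radii n < 1"
  by (auto simp: radii_def field_simps)

lemma radii_tendsto: "radii \<longlonglongrightarrow> 1"
  unfolding radii_def by real_asymp

lemma radii_cis_norm: "norm (of_real (radii n) * cis \<theta>) < 1"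
  using radii_bounds[of n] by (simp add: norm_mult)

lemma radii_cis_dist: "norm (of_real (radii n) * cis \<theta> - cis \<theta>) = 1 - radii n"
proof -
  have "of_real (radii n) * cis \<theta> - cis \<theta> = of_real (radii n - 1) * cis \<theta>" by (simp add: algebra_simps)
  then show ?thesis using radii_bounds[of n] by (simp only: norm_mult norm_of_real norm_cis) simp
qed

lemma radii_cis_tendsto: "(\<lambda>n. of_real (radii n) * cis \<theta>) \<longlonglongrightarrow> cis \<theta>"
  using tendsto_mult[OF tendsto_of_real[OF radii_tendsto] tendsto_const[of "cis \<theta>"]] by simp

lemma norm_cis_diff_le: "norm (cis a - cis b) \<le> \<bar>a - b\<bar>"
proof -
  have "cis a - cis b = - cis b * (1 - cis (a - b))" by (simp add: algebra_simps cis_mult)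
  then have "norm (cis a - cis b) = 2 * \<bar>sin ((a - b) / 2)\<bar>"
    by (simp only: norm_mult norm_minus_cancel norm_cis norm_one_minus_cis)
  also have "\<dots> \<le> \<bar>a - b\<bar>" using abs_sin_x_le_abs_x[of "(a - b) / 2"] by simp
  finally show ?thesis .
qed

section \<open>Boundary values of a subordination function across the gap\<close>

locale boundary_values =
  fixes \<mu> \<nu> :: "complex measure" and f :: "complex \<Rightarrow> complex" and S T :: real
  assumes \<mu>: "circle_prob \<mu>" and \<nu>: "circle_prob \<nu>"
    and T_le: "T \<le> S + 2 * pi" and gap: "null_arc \<nu> S T"
    and f_hol: "f holomorphic_on ball 0 1" and f_le: "\<And>z. norm z < 1 \<Longrightarrow> norm (f z) \<le> norm z"
    and subord: "\<And>z. norm z < 1 \<Longrightarrow> resolvent_transform \<mu> (f z) = resolvent_transform \<nu> z"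
begin

sublocale M: prob_space \<mu> using \<mu> by (simp add: circle_prob_def)
sublocale N: prob_space \<nu> using \<nu> by (simp add: circle_prob_def)

lemma f_lt: "norm z < 1 \<Longrightarrow> norm (f z) < 1"
  using f_le by (meson le_less_trans)

definition near :: "real \<Rightarrow> real \<Rightarrow> real \<Rightarrow> complex set" where
  "near a b d = {z. norm z < 1 \<and> (\<exists>\<theta>\<in>{a..b}. norm (z - cis \<theta>) \<le> d)}"

definition near_const :: "real \<Rightarrow> real \<Rightarrow> real \<Rightarrow> bool" where
  "near_const a b d \<longleftrightarrow> 0 < d \<and>
     (AE x in \<nu>. \<forall>\<theta>\<in>{a..b}. \<forall>z. norm (z - cis \<theta>) \<le> d \<longrightarrow> d \<le> norm (1 - z * x)) \<and>
     (\<forall>z\<in>near a b d. (\<integral>x. 1 / (norm (1 - f z * x))\<^sup>2 \<partial>\<mu>) \<le> 1 / d\<^sup>2) \<and>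
     (\<forall>z\<in>near a b d. 1 - (norm (f z))\<^sup>2 \<le> 4 / d\<^sup>2 * (1 - (norm z)\<^sup>2)) \<and>
     (\<forall>z\<in>near a b d. \<forall>z'\<in>near a b d. norm (f z - f z') \<le> 4 / d\<^sup>2 * norm (z - z'))"

lemma near_constD:
  assumes "near_const a b d"
  shows "0 < d"
    and "AE x in \<nu>. \<forall>\<theta>\<in>{a..b}. \<forall>z. norm (z - cis \<theta>) \<le> d \<longrightarrow> d \<le> norm (1 - z * x)"
    and "\<And>z. z \<in> near a b d \<Longrightarrow> (\<integral>x. 1 / (norm (1 - f z * x))\<^sup>2 \<partial>\<mu>) \<le> 1 / d\<^sup>2"
    and "\<And>z. z \<in> near a b d \<Longrightarrow> 1 - (norm (f z))\<^sup>2 \<le> 4 / d\<^sup>2 * (1 - (norm z)\<^sup>2)"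
    and "\<And>z z'. z \<in> near a b d \<Longrightarrow> z' \<in> near a b d \<Longrightarrow> norm (f z - f z') \<le> 4 / d\<^sup>2 * norm (z - z')"
  using assms unfolding near_const_def by simp_all

text \<open>Subordination gives \<open>(1 - |f z|^2) * J = (1 - |z|^2) * K\<close> for the second
  moments \<open>J\<close> of \<mu> at \<open>f z\<close> and \<open>K\<close> of \<nu> at
  \<open>z\<close>, where \<open>K <= 1 / d^2\<close> near the gap. From \<open>|f z| <= |z|\<close>
  follows \<open>J <= K\<close>; from \<open>J >= 1/4\<close> follows the defect bound with factor
  \<open>4 / d^2\<close>, which is then also the Lipschitz constant.\<close>

lemma near_const_ex:
  assumes "S < a" and "a \<le> b" and "b < T"
  obtains d where "near_const a b d"
proof -
  obtain d where d: "0 < d" "d \<le> 1"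
    "AE x in \<nu>. \<forall>\<theta>\<in>{a..b}. \<forall>z. norm (z - cis \<theta>) \<le> d \<longrightarrow> d \<le> norm (1 - z * x)"
    using null_arc_distance[OF \<nu> gap assms T_le] by blast
  have b: "(\<integral>x. 1 / (norm (1 - f z * x))\<^sup>2 \<partial>\<mu>) \<le> 1 / d\<^sup>2"
    "1 - (norm (f z))\<^sup>2 \<le> 4 / d\<^sup>2 * (1 - (norm z)\<^sup>2)" if z: "z \<in> near a b d" for z
  proof -
    obtain \<theta> where \<theta>: "\<theta> \<in> {a..b}" "norm (z - cis \<theta>) \<le> d" and z1: "norm z < 1"
      using z by (auto simp: near_def)
    let ?J = "\<integral>x. 1 / (norm (1 - f z * x))\<^sup>2 \<partial>\<mu>" and ?K = "\<integral>x. 1 / (norm (1 - z * x))\<^sup>2 \<partial>\<nu>"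
    have eq: "(1 - (norm (f z))\<^sup>2) * ?J = (1 - (norm z)\<^sup>2) * ?K"
      using Re_resolvent_transform(1)[OF \<mu> f_lt[OF z1]] Re_resolvent_transform(1)[OF \<nu> z1]
      by (simp add: subord[OF z1])
    have "?K \<le> (\<integral>x. 1 / d\<^sup>2 \<partial>\<nu>)"
    proof (rule integral_mono_AE)
      show "AE x in \<nu>. 1 / (norm (1 - z * x))\<^sup>2 \<le> 1 / d\<^sup>2"
        using d(3)
      proof eventually_elim
        case (elim x)
        then have "d \<le> norm (1 - z * x)" using \<theta> by blast
        then show ?case using d(1) by (intro divide_left_mono power_mono) (auto simp: zero_less_mult_iff)
      qed
    qed (use Re_resolvent_transform(2)[OF \<nu> z1] in auto)
    then have K: "?K \<le> 1 / d\<^sup>2" by (simp add: N.prob_space)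
    have z2: "0 < 1 - (norm z)\<^sup>2" and f2: "0 < 1 - (norm (f z))\<^sup>2"
      using z1 f_lt[OF z1] by (auto simp: abs_square_less_1)
    have le: "1 - (norm z)\<^sup>2 \<le> 1 - (norm (f z))\<^sup>2"
      using power_mono[OF f_le[OF z1], of 2] by simp
    have J: "1 / 4 \<le> ?J" by (rule Re_resolvent_transform(3)[OF \<mu> f_lt[OF z1]])
    have "(1 - (norm z)\<^sup>2) * ?J \<le> (1 - (norm (f z))\<^sup>2) * ?J"
      using J by (intro mult_right_mono le) linarith
    then have "(1 - (norm z)\<^sup>2) * ?J \<le> (1 - (norm z)\<^sup>2) * ?K" by (simp only: eq)
    then have "?J \<le> ?K" using z2 by (rule mult_left_le_imp_le)
    then show "?J \<le> 1 / d\<^sup>2" using K by linarith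
    have "(1 - (norm (f z))\<^sup>2) * (1 / 4) \<le> (1 - (norm (f z))\<^sup>2) * ?J"
      using f2 by (intro mult_left_mono J) auto
    also have "\<dots> \<le> (1 - (norm z)\<^sup>2) * (1 / d\<^sup>2)"
      unfolding eq using z2 by (intro mult_left_mono K) auto
    finally show "1 - (norm (f z))\<^sup>2 \<le> 4 / d\<^sup>2 * (1 - (norm z)\<^sup>2)"
      using d(1) by (simp add: field_simps)
  qed
  have "norm (f z - f z') \<le> 4 / d\<^sup>2 * norm (z - z')" if zz: "z \<in> near a b d" "z' \<in> near a b d" for z z'
    by (rule schwarz_pick_lipschitz[OF f_hol f_lt _ _ b(2)[OF zz(1)] b(2)[OF zz(2)]])
      (use zz in \<open>auto simp: near_def\<close>)
  then have "near_const a b d"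
    unfolding near_const_def using d(1,3) b by blast
  then show ?thesis by (rule that)
qed

definition W :: "real \<Rightarrow> complex" where
  "W \<theta> = lim (\<lambda>n. f (of_real (radii n) * cis \<theta>))"

lemma eventually_near:
  assumes "0 < d" and "\<theta> \<in> {a..b}"
  shows "\<forall>\<^sub>F n in sequentially. of_real (radii n) * cis \<theta> \<in> near a b d"
proof -
  have "\<forall>\<^sub>F n in sequentially. 1 - d < radii n"
    using assms(1) by (intro order_tendstoD(1)[OF radii_tendsto]) simp
  then show ?thesis
  proof eventually_elim
    case (elim n)
    then show ?case
      using assms(2) radii_cis_norm radii_cis_dist[of n \<theta>] by (auto simp: near_def intro!: bexI[of _ \<theta>])
  qed
qed

lemma W_tendsto:
  assumes "S < \<theta>" and "\<theta> < T"
  shows "(\<lambda>n. f (of_real (radii n) * cis \<theta>)) \<longlonglongrightarrow> W \<theta>"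
proof -
  let ?z = "\<lambda>n. of_real (radii n) * cis \<theta>"
  obtain d where "near_const \<theta> \<theta> d"
    by (rule near_const_ex[OF assms(1) order_refl assms(2)])
  note d = near_constD(1,5)[OF this]
  have C: "0 < 4 / d\<^sup>2" using d(1) by simp
  obtain N where N: "\<And>n. n \<ge> N \<Longrightarrow> ?z n \<in> near \<theta> \<theta> d"
    using eventually_near[OF d(1), of \<theta> \<theta> \<theta>] by (auto simp: eventually_sequentially)
  have "Cauchy (\<lambda>n. f (?z n))"
  proof (rule CauchyI)
    fix e :: real assume "0 < e"
    then have "0 < e / (4 / d\<^sup>2)" using C by simp
    moreover have "Cauchy ?z" using radii_cis_tendsto LIMSEQ_imp_Cauchy by blast
    ultimately obtain M where M: "\<And>m n. \<lbrakk>m \<ge> M; n \<ge> M\<rbrakk> \<Longrightarrow> norm (?z m - ?z n) < e / (4 / d\<^sup>2)"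
      by (meson CauchyD)
    show "\<exists>M. \<forall>m\<ge>M. \<forall>n\<ge>M. norm (f (?z m) - f (?z n)) < e"
    proof (intro exI[of _ "max M N"] allI impI)
      fix m n assume mn: "max M N \<le> m" "max M N \<le> n"
      then have "norm (f (?z m) - f (?z n)) \<le> 4 / d\<^sup>2 * norm (?z m - ?z n)"
        by (intro d(2) N) auto
      also have "\<dots> < 4 / d\<^sup>2 * (e / (4 / d\<^sup>2))"
        using mn C by (intro mult_strict_left_mono M) auto
      also have "\<dots> = e" using C by simp
      finally show "norm (f (?z m) - f (?z n)) < e" .
    qed
  qed
  then show ?thesis unfolding W_def using Cauchy_convergent convergent_LIMSEQ_iff by blast
qed

text \<open>The defect bound passes to the radial limit, where its right-hand side vanishes.\<close>

lemma norm_W: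
  assumes "S < \<theta>" and "\<theta> < T"
  shows "norm (W \<theta>) = 1"
proof -
  let ?z = "\<lambda>n. of_real (radii n) * cis \<theta>"
  obtain d where "near_const \<theta> \<theta> d"
    by (rule near_const_ex[OF assms(1) order_refl assms(2)])
  note d = near_constD(1,4)[OF this]
  have 1: "(\<lambda>n. 1 - (norm (f (?z n)))\<^sup>2) \<longlonglongrightarrow> 1 - (norm (W \<theta>))\<^sup>2"
    by (intro tendsto_intros W_tendsto assms)
  have 2: "(\<lambda>n. 4 / d\<^sup>2 * (1 - (norm (?z n))\<^sup>2)) \<longlonglongrightarrow> 4 / d\<^sup>2 * (1 - (norm (cis \<theta>))\<^sup>2)"
    by (intro tendsto_intros radii_cis_tendsto)
  have "\<forall>\<^sub>F n in sequentially. ?z n \<in> near \<theta> \<theta> d" by (rule eventually_near[OF d(1)]) simp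
  then have 3: "\<forall>\<^sub>F n in sequentially. 1 - (norm (f (?z n)))\<^sup>2 \<le> 4 / d\<^sup>2 * (1 - (norm (?z n))\<^sup>2)"
    by eventually_elim (rule d(2))
  have "1 - (norm (W \<theta>))\<^sup>2 \<le> 4 / d\<^sup>2 * (1 - (norm (cis \<theta>))\<^sup>2)"
    by (rule tendsto_le[OF _ 2 1 3]) simp
  then have "1 - (norm (W \<theta>))\<^sup>2 \<le> 0" by simp
  moreover have "norm (W \<theta>) \<le> 1"
  proof (rule Lim_norm_ubound[OF _ W_tendsto[OF assms]])
    show "\<forall>\<^sub>F n in sequentially. norm (f (?z n)) \<le> 1"
      by (intro always_eventually allI less_imp_le f_lt radii_cis_norm)
  qed simp
  ultimately show ?thesis
    using abs_square_less_1[of "norm (W \<theta>)"] by (cases "norm (W \<theta>) = 1") auto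
qed

lemma W_lipschitz:
  assumes "S < a" and "a \<le> b" and "b < T"
    and "near_const a b d" and "\<theta> \<in> {a..b}" and "\<theta>' \<in> {a..b}"
  shows "norm (W \<theta> - W \<theta>') \<le> 4 / d\<^sup>2 * \<bar>\<theta> - \<theta>'\<bar>"
proof -
  define C where "C = 4 / d\<^sup>2"
  have C: "0 \<le> C" by (simp add: C_def)
  note d = near_constD(1,5)[OF assms(4)]
  let ?z = "\<lambda>\<theta> n. of_real (radii n) * cis \<theta>"
  have "norm (W \<theta> - W \<theta>') \<le> C * norm (cis \<theta> - cis \<theta>')"
  proof (rule tendsto_le)
    show "(\<lambda>n. norm (f (?z \<theta> n) - f (?z \<theta>' n))) \<longlonglongrightarrow> norm (W \<theta> - W \<theta>')"
      using assms by (intro tendsto_intros W_tendsto) auto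
    show "(\<lambda>n. C * norm (?z \<theta> n - ?z \<theta>' n)) \<longlonglongrightarrow> C * norm (cis \<theta> - cis \<theta>')"
      by (intro tendsto_intros radii_cis_tendsto)
    show "\<forall>\<^sub>F n in sequentially. norm (f (?z \<theta> n) - f (?z \<theta>' n)) \<le> C * norm (?z \<theta> n - ?z \<theta>' n)"
      using eventually_near[OF d(1) assms(5)] eventually_near[OF d(1) assms(6)]
      unfolding C_def by eventually_elim (rule d(2))
  qed simp
  also have "\<dots> \<le> C * \<bar>\<theta> - \<theta>'\<bar>" by (intro mult_left_mono norm_cis_diff_le C)
  finally show ?thesis by (simp only: C_def)
qed

lemma continuous_on_W_Icc:
  assumes "S < a" and "a \<le> b" and "b < T"
  shows "continuous_on {a..b} W"
proof -
  obtain d where d: "near_const a b d" by (rule near_const_ex[OF assms])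
  have "(4 / d\<^sup>2)-lipschitz_on {a..b} W"
    by (rule lipschitz_onI)
      (use W_lipschitz[OF assms d] in \<open>auto simp: dist_norm dist_real_def\<close>)
  then show ?thesis by (rule lipschitz_on_continuous_on)
qed

lemma continuous_on_W: "continuous_on {S<..<T} W"
proof (rule continuous_at_imp_continuous_on, rule ballI)
  fix \<theta> assume \<theta>: "\<theta> \<in> {S<..<T}"
  define a b where "a = (S + \<theta>) / 2" and "b = (\<theta> + T) / 2"
  have "continuous_on {a..b} W" using \<theta> by (intro continuous_on_W_Icc) (auto simp: a_def b_def)
  moreover have "\<theta> \<in> interior {a..b}" using \<theta> by (auto simp: a_def b_def)
  ultimately show "isCont W \<theta>" by (rule continuous_on_interior)
qed

text \<open>The second moments of the resolvent stay bounded near the gap. By Markov's inequality an arc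
  of length \<open>\<epsilon>\<close> traced by \<open>W\<close> therefore carries mass \<open>O(\<epsilon>\<^sup>2)\<close>, and summing over a fine subdivision
  shows that \<open>W\<close> runs outside the support of \<open>\<mu>\<close>.\<close>

lemma W_avoids_Icc:
  assumes "S < a" and "a \<le> b" and "b < T"
  shows "AE x in \<mu>. \<forall>\<theta>\<in>{a..b}. W \<theta> * x \<noteq> 1"
proof -
  obtain d where dd: "near_const a b d" by (rule near_const_ex[OF assms])
  note d = near_constD(1,3)[OF dd]
  define C where "C = 4 / d\<^sup>2"
  have C: "0 < C" using d(1) by (simp add: C_def)
  define B where "B \<theta> e = {x \<in> space \<mu>. norm (1 - W \<theta> * x) < e}" for \<theta> e
  have meas: "B \<theta> e \<in> sets \<mu>" for \<theta> e
    unfolding B_def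
    by (intro borel_measurable_less borel_measurable_const circle_prob_measurable[OF \<mu>]) measurable
  \<comment> \<open>Take \<open>z\<close> with \<open>f z\<close> within \<open>e\<close> of
    \<open>W \<theta>\<close>. On \<open>B \<theta> e\<close> the kernel at \<open>f z\<close> is at
    least \<open>1 / (2 * e)^2\<close>, and Markov's inequality with the moment bound
    \<open>1 / d^2\<close> gives \<open>(2 * e)^2 / d^2 = e^2 * C\<close>.\<close>
  have ball: "measure \<mu> (B \<theta> e) \<le> e\<^sup>2 * C" if \<theta>: "\<theta> \<in> {a..b}" and e: "0 < e" for \<theta> e
  proof -
    have st: "S < \<theta>" "\<theta> < T" using \<theta> assms by auto
    have "\<forall>\<^sub>F n in sequentially. dist (f (of_real (radii n) * cis \<theta>)) (W \<theta>) < e"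
      by (rule tendstoD[OF W_tendsto[OF st] e])
    from eventually_happens'[OF _ eventually_conj[OF this eventually_near[OF d(1) \<theta>]]]
    obtain z where z: "norm (f z - W \<theta>) < e" "z \<in> near a b d" by (auto simp: dist_norm)
    have z1: "norm z < 1" using z by (simp add: near_def)
    let ?g = "\<lambda>x. 1 / (norm (1 - f z * x))\<^sup>2"
    have int: "integrable \<mu> ?g" by (rule Re_resolvent_transform(2)[OF \<mu> f_lt[OF z1]])
    have "B \<theta> e \<subseteq> {x \<in> space \<mu>. ?g x \<ge> 1 / (2 * e)\<^sup>2}"
    proof
      fix x assume "x \<in> B \<theta> e"
      then have x: "norm (1 - W \<theta> * x) < e" "norm x = 1" "x \<in> space \<mu>"
        by (auto simp: B_def circle_prob_space[OF \<mu>])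
      have "norm (1 - f z * x) \<le> norm (1 - W \<theta> * x) + norm ((W \<theta> - f z) * x)"
        using norm_triangle_ineq[of "1 - W \<theta> * x" "(W \<theta> - f z) * x"] by (simp add: algebra_simps)
      also have "\<dots> \<le> 2 * e" using x z by (simp add: norm_mult norm_minus_commute)
      finally have "(norm (1 - f z * x))\<^sup>2 \<le> (2 * e)\<^sup>2" by (rule power_mono) simp
      moreover have "0 < norm (1 - f z * x)"
        using one_minus_mult_norm_ge[OF x(2), of "f z"] f_lt[OF z1] by linarith
      ultimately have "1 / (2 * e)\<^sup>2 \<le> ?g x"
        using e by (intro divide_left_mono mult_pos_pos zero_less_power) auto
      then show "x \<in> {x \<in> space \<mu>. ?g x \<ge> 1 / (2 * e)\<^sup>2}" using x by simp
    qed
    then have "measure \<mu> (B \<theta> e) \<le> measure \<mu> {x \<in> space \<mu>. ?g x \<ge> 1 / (2 * e)\<^sup>2}"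
      by (intro M.finite_measure_mono borel_measurable_le borel_measurable_const
          borel_measurable_integrable[OF int])
    also have "\<dots> \<le> (\<integral>x. ?g x \<partial>\<mu>) / (1 / (2 * e)\<^sup>2)"
      using e by (intro integral_Markov_inequality_measure[OF int sets.top]) auto
    also have "\<dots> \<le> (1 / d\<^sup>2) / (1 / (2 * e)\<^sup>2)"
      by (intro divide_right_mono d(2) z) auto
    finally show ?thesis by (simp add: C_def power_mult_distrib mult.commute)
  qed
  define P where "P = cnj ` W ` {a..b}"
  have P_sub: "P \<subseteq> circle" using norm_W assms by (auto simp: P_def)
  have "compact P"
    unfolding P_def
    by (rule compact_continuous_image[OF continuous_on_cnj[OF continuous_on_id]])
      (rule compact_continuous_image[OF continuous_on_W_Icc[OF assms] compact_Icc])
  then have P_meas: "P \<in> sets \<mu>"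
    by (intro circle_prob_sets[OF \<mu> _ P_sub] borel_closed compact_imp_closed)
  \<comment> \<open>With mesh \<open>h = (b - a) / (n + 1)\<close> and radius
    \<open>e = L / (n + 1)\<close>, the summand 1 makes \<open>C * h < e\<close> strict and keeps
    \<open>e\<close> positive when \<open>a = b\<close>. The \<open>n + 2\<close> balls then have
    total mass of order \<open>1 / n\<close>.\<close>
  define L where "L = C * (b - a) + 1"
  have L: "0 < L" using C assms(2) by (simp add: L_def add_nonneg_pos)
  have bound: "measure \<mu> P \<le> (L\<^sup>2 * C * 2) / (1 + of_nat n)" for n
  proof -
    define h where "h = (b - a) / (1 + of_nat n)"
    define e where "e = L / (1 + of_nat n)"
    have e: "0 < e" using L by (simp add: e_def)
    have h0: "0 \<le> h" using assms(2) by (simp add: h_def)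
    have grid: "a + of_nat i * h \<in> {a..b}" if "i \<le> Suc n" for i
    proof -
      have "of_nat i * h \<le> of_nat (Suc n) * h" using that h0 by (intro mult_right_mono) auto
      moreover have "of_nat (Suc n) * h = b - a" by (simp add: h_def)
      moreover have "0 \<le> of_nat i * h" using h0 by simp
      ultimately show ?thesis by simp
    qed
    have "P \<subseteq> (\<Union>i\<le>Suc n. B (a + of_nat i * h) e)"
    proof
      fix x assume xP: "x \<in> P"
      then obtain \<theta> where \<theta>: "\<theta> \<in> {a..b}" "x = cnj (W \<theta>)" unfolding P_def by blast
      have n1: "norm (W \<theta>) = 1" using \<theta> assms by (intro norm_W) auto
      obtain i where i: "i \<le> Suc n" "\<bar>\<theta> - (a + of_nat i * h)\<bar> \<le> h"
      proof (cases "h = 0")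
        case True
        then have "a = b" by (simp add: h_def add_nonneg_eq_0_iff)
        then show ?thesis using \<theta> True by (intro that[of 0]) auto
      next
        case False
        then have h: "0 < h" using h0 by simp
        define i where "i = nat \<lfloor>(\<theta> - a) / h\<rfloor>"
        have q: "0 \<le> (\<theta> - a) / h" using \<theta> h by simp
        then have fl: "of_nat i \<le> (\<theta> - a) / h" "(\<theta> - a) / h < of_nat i + 1"
          unfolding i_def by (auto simp: of_nat_nat)
        have "(\<theta> - a) / h \<le> (b - a) / h" using \<theta> h by (intro divide_right_mono) auto
        also have "\<dots> = 1 + of_nat n" using False by (simp add: h_def)
        finally have "(of_nat i :: real) \<le> of_nat (Suc n)" using fl(1) by simp
        then have "i \<le> Suc n" by (simp only: of_nat_le_iff)
        moreover have "\<bar>\<theta> - (a + of_nat i * h)\<bar> \<le> h" using fl h by (simp add: field_simps abs_le_iff)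
        ultimately show ?thesis by (rule that)
      qed
      have "norm (1 - W (a + of_nat i * h) * x) = norm ((W \<theta> - W (a + of_nat i * h)) * x)"
      proof -
        have "W \<theta> * x = 1" using n1 \<theta>(2) by (metis complex_norm_square of_real_1 power_one)
        then show ?thesis by (simp add: algebra_simps)
      qed
      also have "\<dots> = norm (W \<theta> - W (a + of_nat i * h))" using n1 \<theta>(2) by (simp add: norm_mult)
      also have "\<dots> \<le> C * \<bar>\<theta> - (a + of_nat i * h)\<bar>"
        unfolding C_def by (rule W_lipschitz[OF assms dd \<theta>(1) grid[OF i(1)]])
      also have "\<dots> \<le> C * h" using C i(2) by (intro mult_left_mono) auto
      also have "\<dots> < e" by (simp add: h_def e_def L_def divide_strict_right_mono add_pos_nonneg)
      finally show "x \<in> (\<Union>i\<le>Suc n. B (a + of_nat i * h) e)"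
        using i(1) xP P_sub by (auto simp: B_def circle_prob_space[OF \<mu>])
    qed
    then have "measure \<mu> P \<le> measure \<mu> (\<Union>i\<le>Suc n. B (a + of_nat i * h) e)"
      using meas by (intro M.finite_measure_mono) auto
    also have "\<dots> \<le> (\<Sum>i\<le>Suc n. measure \<mu> (B (a + of_nat i * h) e))"
      using meas by (intro M.finite_measure_subadditive_finite) auto
    also have "\<dots> \<le> (\<Sum>i\<le>Suc n. e\<^sup>2 * C)"
      using grid e by (intro sum_mono ball) auto
    also have "\<dots> = (2 + of_nat n) * (e\<^sup>2 * C)" by simp
    also have "\<dots> \<le> (2 * (1 + of_nat n)) * (e\<^sup>2 * C)" using C by (intro mult_right_mono) auto
    also have "\<dots> = (L\<^sup>2 * C * 2) / (1 + of_nat n)"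
    proof -
      have "(2 * m) * ((L / m)\<^sup>2 * C) = (L\<^sup>2 * C * 2) / m" if "m \<noteq> 0" for m :: real
        using that by (simp add: power2_eq_square)
      from this[of "1 + of_nat n"] show ?thesis by (simp add: e_def)
    qed
    finally show ?thesis .
  qed
  have "(\<lambda>n. (L\<^sup>2 * C * 2) / (1 + of_nat n)) \<longlonglongrightarrow> 0" by real_asymp
  then have "measure \<mu> P \<le> 0" using bound by (intro LIMSEQ_le_const) auto
  then have "emeasure \<mu> P = 0" by (simp add: M.emeasure_eq_measure measure_le_0_iff)
  then have "AE x in \<mu>. x \<notin> P" using P_meas by (intro AE_not_in) auto
  then show ?thesis
    using circle_prob_AE_norm[OF \<mu>]
  proof eventually_elim
    case (elim x)
    show ?case
    proof (intro ballI notI)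
      fix \<theta> assume \<theta>: "\<theta> \<in> {a..b}" and wx: "W \<theta> * x = 1"
      have "norm (W \<theta>) = 1" using \<theta> assms by (intro norm_W) auto
      then have "W \<theta> * cnj (W \<theta>) = 1" using complex_norm_square[of "W \<theta>"] by simp
      then have "x = (W \<theta> * cnj (W \<theta>)) * x" by simp
      also have "\<dots> = cnj (W \<theta>) * (W \<theta> * x)" by (simp only: mult_ac)
      also have "\<dots> = cnj (W \<theta>)" by (simp only: wx mult_1_right)
      finally have "x \<in> P" unfolding P_def using \<theta> by blast
      then show False using elim by blast
    qed
  qed
qed

lemma W_avoids: "AE x in \<mu>. \<forall>\<theta>. S < \<theta> \<and> \<theta> < T \<longrightarrow> W \<theta> * x \<noteq> 1"
proof -
  \<comment> \<open>A countable exhaustion by compact subintervals keeps the union of exceptional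
    sets null.\<close>
  have "AE x in \<mu>. \<forall>n. \<forall>\<theta>\<in>{S + 1 / (of_nat n + 1)..T - 1 / (of_nat n + 1)}. W \<theta> * x \<noteq> 1"
    unfolding AE_all_countable
  proof
    fix n :: nat
    show "AE x in \<mu>. \<forall>\<theta>\<in>{S + 1 / (of_nat n + 1)..T - 1 / (of_nat n + 1)}. W \<theta> * x \<noteq> 1"
    proof (cases "S + 1 / (of_nat n + 1) \<le> T - 1 / (of_nat n + 1)")
      case True
      then show ?thesis by (intro W_avoids_Icc) auto
    qed auto
  qed
  then show ?thesis
  proof eventually_elim
    case (elim x)
    show ?case
    proof (intro allI impI)
      fix \<theta> assume \<theta>: "S < \<theta> \<and> \<theta> < T"
      then have "0 < min (\<theta> - S) (T - \<theta>)" by simp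
      then obtain n :: nat where "inverse (of_nat (Suc n)) < min (\<theta> - S) (T - \<theta>)"
        using reals_Archimedean by blast
      then have "\<theta> \<in> {S + 1 / (of_nat n + 1)..T - 1 / (of_nat n + 1)}"
        by (simp add: inverse_eq_divide add.commute)
      with elim show "W \<theta> * x \<noteq> 1" by blast
    qed
  qed
qed

text \<open>The relation between the transforms is carried to the circle. For \<nu> the kernels are
  dominated by \<open>1 / d\<close>. For \<mu> the second moments are uniformly bounded along the
  radius and at the limit point, which makes the difference of the transforms a multiple of
  \<open>|f (z n) - W \<theta>|\<close>.\<close>

lemma resolvent_transform_W:
  assumes "S < \<theta>" and "\<theta> < T"
  shows "integrable \<mu> (\<lambda>x. 1 / (1 - W \<theta> * x))"
    and "resolvent_transform \<mu> (W \<theta>) = resolvent_transform \<nu> (cis \<theta>)"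
    and "(\<lambda>n. resolvent_transform \<nu> (of_real (radii n) * cis \<theta>)) \<longlonglongrightarrow> resolvent_transform \<nu> (cis \<theta>)"
proof -
  define z where "z n = of_real (radii n) * cis \<theta>" for n
  obtain d where "near_const \<theta> \<theta> d"
    by (rule near_const_ex[OF assms(1) order_refl assms(2)])
  note d = near_constD(1-3)[OF this]
  obtain k where k: "\<And>n. n \<ge> k \<Longrightarrow> z n \<in> near \<theta> \<theta> d"
    using eventually_near[OF d(1), of \<theta> \<theta> \<theta>] by (auto simp: eventually_sequentially z_def)
  have z1: "norm (z n) < 1" for n by (simp add: z_def radii_cis_norm)
  have z_lim: "z \<longlonglongrightarrow> cis \<theta>" unfolding z_def by (rule radii_cis_tendsto)
  have W_lim: "(\<lambda>n. f (z n)) \<longlonglongrightarrow> W \<theta>" unfolding z_def by (rule W_tendsto[OF assms])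
  have avoid: "AE x in \<mu>. W \<theta> * x \<noteq> 1"
    using W_avoids by eventually_elim (use assms in auto)
  have "(\<lambda>n. resolvent_transform \<nu> (z (n + k))) \<longlonglongrightarrow> resolvent_transform \<nu> (cis \<theta>)"
    unfolding resolvent_transform_def
  proof (rule integral_dominated_convergence[where w = "\<lambda>_. 1 / d"])
    show "AE x in \<nu>. (\<lambda>n. 1 / (1 - z (n + k) * x)) \<longlonglongrightarrow> 1 / (1 - cis \<theta> * x)"
      using d(2)
    proof eventually_elim
      case (elim x)
      have "norm (cis \<theta> - cis \<theta>) \<le> d" using d(1) by simp
      then have "d \<le> norm (1 - cis \<theta> * x)"
        using elim by (meson atLeastAtMost_iff order_refl)
      then have "1 - cis \<theta> * x \<noteq> 0" using d(1) by auto
      then show ?case by (intro tendsto_intros LIMSEQ_ignore_initial_segment z_lim)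
    qed
    show "AE x in \<nu>. norm (1 / (1 - z (n + k) * x)) \<le> 1 / d" for n
      using d(2)
    proof eventually_elim
      case (elim x)
      have "norm (z (n + k) - cis \<theta>) \<le> d" using k[of "n + k"] by (simp add: near_def)
      then have "d \<le> norm (1 - z (n + k) * x)"
        using elim by (meson atLeastAtMost_iff order_refl)
      then show ?case using d(1) by (simp add: norm_divide frac_le)
    qed
  qed (auto intro!: circle_prob_measurable[OF \<nu>])
  then have G_lim: "(\<lambda>n. resolvent_transform \<nu> (z n)) \<longlonglongrightarrow> resolvent_transform \<nu> (cis \<theta>)"
    by (rule LIMSEQ_offset)
  then show "(\<lambda>n. resolvent_transform \<nu> (of_real (radii n) * cis \<theta>)) \<longlonglongrightarrow> resolvent_transform \<nu> (cis \<theta>)"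
    by (simp add: z_def)
  define q where "q w x = 1 / (norm (1 - w * x))\<^sup>2" for w x :: complex
  have q_meas: "q w \<in> borel_measurable \<mu>" for w
    unfolding q_def by (intro circle_prob_measurable[OF \<mu>]) measurable
  have q_int: "integrable \<mu> (q (f (z n)))" for n
    unfolding q_def by (rule Re_resolvent_transform(2)[OF \<mu> f_lt[OF z1]])
  have "(\<integral>\<^sup>+x. ennreal (q (W \<theta>) x) \<partial>\<mu>) = (\<integral>\<^sup>+x. liminf (\<lambda>n. ennreal (q (f (z n)) x)) \<partial>\<mu>)"
  proof (rule nn_integral_cong_AE)
    show "AE x in \<mu>. ennreal (q (W \<theta>) x) = liminf (\<lambda>n. ennreal (q (f (z n)) x))"
      using avoid
    proof eventually_elim
      case (elim x)
      then have "(\<lambda>n. ennreal (q (f (z n)) x)) \<longlonglongrightarrow> ennreal (q (W \<theta>) x)"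
        unfolding q_def by (intro tendsto_ennrealI tendsto_intros W_lim) auto
      then show ?case by (intro lim_imp_Liminf[symmetric]) auto
    qed
  qed
  also have "\<dots> \<le> liminf (\<lambda>n. \<integral>\<^sup>+x. ennreal (q (f (z n)) x) \<partial>\<mu>)"
    using q_meas by (intro nn_integral_liminf) measurable
  also have "\<dots> \<le> ennreal (1 / d\<^sup>2)"
  proof (rule order_trans[OF Liminf_le_Limsup Limsup_bounded])
    show "\<forall>\<^sub>F n in sequentially. (\<integral>\<^sup>+x. ennreal (q (f (z n)) x) \<partial>\<mu>) \<le> ennreal (1 / d\<^sup>2)"
      unfolding eventually_sequentially
    proof (intro exI[of _ k] allI impI)
      fix n assume "k \<le> n"
      then have "(\<integral>x. q (f (z n)) x \<partial>\<mu>) \<le> 1 / d\<^sup>2" unfolding q_def by (intro d(3) k)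
      moreover have "(\<integral>\<^sup>+x. ennreal (q (f (z n)) x) \<partial>\<mu>) = ennreal (\<integral>x. q (f (z n)) x \<partial>\<mu>)"
        by (rule nn_integral_eq_integral[OF q_int]) (simp add: q_def)
      ultimately show "(\<integral>\<^sup>+x. ennreal (q (f (z n)) x) \<partial>\<mu>) \<le> ennreal (1 / d\<^sup>2)"
        by (simp only: ennreal_leI)
    qed
  qed simp
  finally have fatou: "(\<integral>\<^sup>+x. ennreal (q (W \<theta>) x) \<partial>\<mu>) \<le> ennreal (1 / d\<^sup>2)" .
  have qW_int: "integrable \<mu> (q (W \<theta>))"
  proof (rule integrableI_nonneg[OF q_meas])
    show "(\<integral>\<^sup>+x. ennreal (q (W \<theta>) x) \<partial>\<mu>) < \<infinity>"
      using fatou by (rule le_less_trans) simp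
  qed (auto simp: q_def)
  have qW_le: "(\<integral>x. q (W \<theta>) x \<partial>\<mu>) \<le> 1 / d\<^sup>2"
  proof -
    have "(\<integral>\<^sup>+x. ennreal (q (W \<theta>) x) \<partial>\<mu>) = ennreal (\<integral>x. q (W \<theta>) x \<partial>\<mu>)"
      by (rule nn_integral_eq_integral[OF qW_int]) (simp add: q_def)
    then have "ennreal (\<integral>x. q (W \<theta>) x \<partial>\<mu>) \<le> ennreal (1 / d\<^sup>2)"
      using fatou by simp
    then show ?thesis by (simp add: ennreal_le_iff)
  qed
  show i1: "integrable \<mu> (\<lambda>x. 1 / (1 - W \<theta> * x))"
  proof (rule Bochner_Integration.integrable_bound)
    show "integrable \<mu> (\<lambda>x. 1 + q (W \<theta>) x)" using qW_int by simp
    show "AE x in \<mu>. norm (1 / (1 - W \<theta> * x)) \<le> norm (1 + q (W \<theta>) x)"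
    proof (rule AE_I2)
      fix x
      have "r \<le> 1 + r\<^sup>2" for r :: real
        using zero_le_power2[of "r - 1 / 2"]
        by (simp add: power2_eq_square algebra_simps)
      from this[of "norm (1 / (1 - W \<theta> * x))"]
      show "norm (1 / (1 - W \<theta> * x)) \<le> norm (1 + q (W \<theta>) x)"
        by (simp add: q_def norm_divide power_divide)
    qed
  qed (auto intro!: circle_prob_measurable[OF \<mu>])
  have "(\<lambda>n. resolvent_transform \<mu> (f (z n)) - resolvent_transform \<mu> (W \<theta>)) \<longlonglongrightarrow> 0"
  proof (rule Lim_null_comparison)
    have "(\<lambda>n. norm (f (z n) - W \<theta>) * (1 / d\<^sup>2)) \<longlonglongrightarrow> norm (W \<theta> - W \<theta>) * (1 / d\<^sup>2)"
      by (intro tendsto_intros W_lim)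
    then show "(\<lambda>n. norm (f (z n) - W \<theta>) * (1 / d\<^sup>2)) \<longlonglongrightarrow> 0" by simp
    show "\<forall>\<^sub>F n in sequentially. norm (resolvent_transform \<mu> (f (z n)) - resolvent_transform \<mu> (W \<theta>))
        \<le> norm (f (z n) - W \<theta>) * (1 / d\<^sup>2)"
      unfolding eventually_sequentially
    proof (intro exI[of _ k] allI impI)
      fix n assume n: "k \<le> n"
      have "AE x in \<mu>. f (z n) * x \<noteq> 1"
        using circle_prob_AE_norm[OF \<mu>]
      proof eventually_elim
        case (elim x)
        then show ?case using one_minus_mult_norm_ge[of x "f (z n)"] f_lt[OF z1, of n] by auto
      qed
      then show "norm (resolvent_transform \<mu> (f (z n)) - resolvent_transform \<mu> (W \<theta>))
        \<le> norm (f (z n) - W \<theta>) * (1 / d\<^sup>2)"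
        using q_int[of n] qW_int qW_le d(3)[OF k[OF n]] i1 avoid
          integrable_power_resolvent(1)[OF \<mu> f_lt[OF z1], of 0 n]
        by (intro integral_norm_diff_resolvent_le[OF \<mu>]) (auto simp: q_def[abs_def])
    qed
  qed
  then have "(\<lambda>n. resolvent_transform \<mu> (f (z n))) \<longlonglongrightarrow> resolvent_transform \<mu> (W \<theta>)"
    by (simp add: LIM_zero_iff)
  then have "(\<lambda>n. resolvent_transform \<nu> (z n)) \<longlonglongrightarrow> resolvent_transform \<mu> (W \<theta>)"
    by (simp add: subord z1)
  then show "resolvent_transform \<mu> (W \<theta>) = resolvent_transform \<nu> (cis \<theta>)"
    using G_lim by (rule LIMSEQ_unique)
qed

end

section \<open>Transforms on massless arcs and at atoms\<close>

lemma Im_inverse_one_minus_cis: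
  assumes "sin (w / 2) \<noteq> 0"
  shows "Im (1 / (1 - cis w)) = cos (w / 2) / (2 * sin (w / 2))"
proof -
  have n: "(norm (1 - cis w))\<^sup>2 = 4 * (sin (w / 2))\<^sup>2"
    by (simp add: norm_one_minus_cis power_mult_distrib)
  have s: "sin w = 2 * sin (w / 2) * cos (w / 2)" using sin_double[of "w / 2"] by simp
  have "Im (1 / (1 - cis w)) = sin w / (norm (1 - cis w))\<^sup>2"
    by (simp add: Im_divide cmod_power2)
  then show ?thesis using assms unfolding n s by (simp add: power2_eq_square)
qed

text \<open>The carrier is left with parameters \<open>y\<close> satisfying
  \<open>B <= y <= A + 2 * pi\<close>, which is at most one point.\<close>

lemma null_arc_full_point_mass:
  assumes "circle_prob \<mu>" and "null_arc \<mu> A B" and "A + 2 * pi \<le> B"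
  shows "is_point_mass \<mu>"
proof -
  interpret prob_space \<mu> using assms(1) by (simp add: circle_prob_def)
  let ?e = "cis (- B)"
  have AE: "AE x in \<mu>. x = ?e"
    using null_arc_AE[OF assms(1,2)]
  proof eventually_elim
    case (elim x)
    then obtain y where y: "B \<le> y" "y \<le> A + 2 * pi" "x = cis (- y)" by blast
    then have "y = B" using assms(3) by linarith
    then show ?case using y by simp
  qed
  have "\<mu> = return (restrict_space borel circle) ?e"
  proof (rule measure_eqI)
    show "sets \<mu> = sets (return (restrict_space borel circle) ?e)"
      using assms(1) by (simp add: circle_prob_def)
    fix X assume X: "X \<in> sets \<mu>"
    have "emeasure \<mu> X = indicator X ?e"
    proof (cases "?e \<in> X")
      case True
      have "AE x in \<mu>. x \<in> X" using AE by eventually_elim (use True in auto)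
      then have "prob X = 1" using X by (simp add: prob_eq_1)
      then show ?thesis using True by (simp add: emeasure_eq_measure)
    next
      case False
      have "AE x in \<mu>. x \<notin> X" using AE by eventually_elim (use False in auto)
      then have "prob X = 0" using X by (simp add: prob_eq_0)
      then show ?thesis using False by (simp add: emeasure_eq_measure)
    qed
    then show "emeasure \<mu> X = emeasure (return (restrict_space borel circle) ?e) X"
      using X assms(1) by (simp add: circle_prob_def)
  qed
  moreover have "?e \<in> circle" by simp
  ultimately show ?thesis unfolding is_point_mass_def by blast
qed

text \<open>The imaginary part of the kernel is half a cotangent of the half-angle. Choosing
  \<open>y > - a\<close> and using that the carrier avoids the arc puts both half-angles in
  \<open>(0, pi)\<close>, where the cotangent strictly decreases.\<close>

lemma Im_resolvent_transform_strict:
  assumes "circle_prob \<mu>" and "a < b" and "AE x in \<mu>. \<forall>\<phi>\<in>{a..b}. cis \<phi> * x \<noteq> 1"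
    and "integrable \<mu> (\<lambda>x. 1 / (1 - cis a * x))" and "integrable \<mu> (\<lambda>x. 1 / (1 - cis b * x))"
  shows "Im (resolvent_transform \<mu> (cis b)) < Im (resolvent_transform \<mu> (cis a))"
proof -
  interpret prob_space \<mu> using assms(1) by (simp add: circle_prob_def)
  have "(\<integral>x. Im (1 / (1 - cis b * x)) \<partial>\<mu>) < (\<integral>x. Im (1 / (1 - cis a * x)) \<partial>\<mu>)"
  proof (rule integral_less_AE_space)
    show "AE x in \<mu>. Im (1 / (1 - cis b * x)) < Im (1 / (1 - cis a * x))"
      using assms(3) circle_prob_AE_norm[OF assms(1)]
    proof eventually_elim
      case (elim x)
      obtain y where y: "- a < y" "y \<le> - a + 2 * pi" "x = cis y"
        using elim(2) by (rule circle_eq_cis)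
      have "b + y < 2 * pi"
      proof (rule ccontr)
        assume "\<not> b + y < 2 * pi"
        then have "2 * pi - y \<in> {a..b}" using y by auto
        with elim(1) have "cis (2 * pi - y) * x \<noteq> 1" by blast
        then show False by (simp add: y(3) cis_mult)
      qed
      define s where "s = (a + y) / 2"
      define t where "t = (b + y) / 2"
      have st: "0 < s" "s < t" "t < pi" using y assms(2) \<open>b + y < 2 * pi\<close> by (auto simp: s_def t_def)
      have pos: "0 < sin s" "0 < sin t" "0 < sin (t - s)" using st by (auto intro!: sin_gt_zero)
      have "cos s / (2 * sin s) - cos t / (2 * sin t) = sin (t - s) / (2 * sin s * sin t)"
        using pos by (simp add: sin_diff field_simps)
      also have "\<dots> > 0" using pos by simp
      finally have "cos t / (2 * sin t) < cos s / (2 * sin s)" by simp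
      then show ?case
        using Im_inverse_one_minus_cis[of "a + y"] Im_inverse_one_minus_cis[of "b + y"] pos
        by (simp add: y(3) cis_mult s_def t_def)
    qed
    show "emeasure \<mu> (space \<mu>) \<noteq> 0" by (simp add: emeasure_space_1)
  qed (use assms(4,5) in \<open>auto intro: integrable_Im\<close>)
  then show ?thesis
    using integral_Im[OF assms(4)] integral_Im[OF assms(5)] by (simp add: resolvent_transform_def)
qed

text \<open>On the circle, away from its pole, the Poisson kernel vanishes.\<close>

lemma Re_resolvent_transform_circle:
  assumes "circle_prob \<mu>" and "norm w = 1" and "AE x in \<mu>. w * x \<noteq> 1"
    and "integrable \<mu> (\<lambda>x. 1 / (1 - w * x))"
  shows "Re (resolvent_transform \<mu> w) = 1 / 2"
proof -
  interpret prob_space \<mu> using assms(1) by (simp add: circle_prob_def)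
  have "Re (resolvent_transform \<mu> w) = (\<integral>x. Re (1 / (1 - w * x)) \<partial>\<mu>)"
    using integral_Re[OF assms(4)] by (simp add: resolvent_transform_def)
  also have "\<dots> = (\<integral>x. 1 / 2 \<partial>\<mu>)"
  proof (rule Bochner_Integration.integral_cong_AE)
    show "AE x in \<mu>. Re (1 / (1 - w * x)) = 1 / 2"
      using assms(3) circle_prob_AE_norm[OF assms(1)]
    proof eventually_elim
      case (elim x)
      then show ?case using Re_inverse_one_minus[of "w * x"] assms(2) by (simp add: norm_mult)
    qed
  qed (use assms(4) in auto)
  finally show ?thesis by (simp add: prob_space)
qed

text \<open>The normalised kernel \<open>(1 - w n * e) / (1 - w n * x)\<close> tends to the
  indicator of \<open>e\<close>, and the nearest-point hypothesis dominates it by 1. No radial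
  approach is presupposed.\<close>

lemma atom_limit:
  assumes "circle_prob \<mu>" and "norm e = 1" and "w \<longlonglongrightarrow> cnj e"
    and "\<And>n. AE x in \<mu>. norm (1 - w n * e) \<le> norm (1 - w n * x)" and "\<And>n. w n * e \<noteq> 1"
  shows "(\<lambda>n. (1 - w n * e) * resolvent_transform \<mu> (w n)) \<longlonglongrightarrow> of_real (measure \<mu> {e})"
proof -
  interpret prob_space \<mu> using assms(1) by (simp add: circle_prob_def)
  have e: "{e} \<in> sets \<mu>" using assms(2) by (intro circle_prob_sets[OF assms(1)]) auto
  have unit: "cnj e * e = 1" using complex_norm_square[of e] assms(2) by (simp add: mult.commute)
  have "(\<lambda>n. \<integral>x. (1 - w n * e) / (1 - w n * x) \<partial>\<mu>) \<longlonglongrightarrow> (\<integral>x. complex_of_real (indicator {e} x) \<partial>\<mu>)"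
  proof (rule integral_dominated_convergence[where w = "\<lambda>_. 1"])
    show "AE x in \<mu>. (\<lambda>n. (1 - w n * e) / (1 - w n * x)) \<longlonglongrightarrow> complex_of_real (indicator {e} x)"
      using circle_prob_AE_norm[OF assms(1)]
    proof eventually_elim
      case (elim x)
      show ?case
      proof (cases "x = e")
        case True
        then have "(\<lambda>n. (1 - w n * e) / (1 - w n * x)) = (\<lambda>n. 1)" using assms(5) by auto
        then show ?thesis using True by simp
      next
        case False
        have "1 - cnj e * x \<noteq> 0"
        proof
          assume "1 - cnj e * x = 0"
          then have "cnj e * x = cnj e * e" using unit by simp
          then show False using False assms(2) by auto
        qed
        then have "(\<lambda>n. (1 - w n * e) / (1 - w n * x)) \<longlonglongrightarrow> (1 - cnj e * e) / (1 - cnj e * x)"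
          by (intro tendsto_intros assms(3))
        then show ?thesis using False unit by simp
      qed
    qed
    show "AE x in \<mu>. norm ((1 - w n * e) / (1 - w n * x)) \<le> 1" for n
      using assms(4)[of n]
    proof eventually_elim
      case (elim x)
      then show ?case using assms(5)[of n] by (simp add: norm_divide divide_le_eq_1)
    qed
    show "(\<lambda>x. complex_of_real (indicator {e} x)) \<in> borel_measurable \<mu>" using e by measurable
  qed (auto intro!: circle_prob_measurable[OF assms(1)])
  moreover have "(\<integral>x. complex_of_real (indicator {e} x) \<partial>\<mu>) = of_real (measure \<mu> {e})"
    using e by (simp add: integral_complex_of_real)
  moreover have "(\<integral>x. (1 - w n * e) / (1 - w n * x) \<partial>\<mu>) = (1 - w n * e) * resolvent_transform \<mu> (w n)" for n
  proof -
    have "(\<integral>x. (1 - w n * e) / (1 - w n * x) \<partial>\<mu>) = (\<integral>x. (1 - w n * e) * (1 / (1 - w n * x)) \<partial>\<mu>)"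
      by simp
    then show ?thesis by (simp only: integral_mult_right_zero resolvent_transform_def)
  qed
  ultimately show ?thesis by simp
qed

lemma sin_le_sin_between:
  assumes "0 \<le> p" and "p \<le> q" and "q \<le> pi - p"
  shows "sin p \<le> sin q"
proof (cases "q \<le> pi / 2")
  case True
  then show ?thesis using assms by (intro sin_monotone_2pi_le) auto
next
  case False
  have "sin p \<le> sin (pi - q)" using assms False by (intro sin_monotone_2pi_le) auto
  then show ?thesis by simp
qed

lemma atom_limit_arc:
  assumes "circle_prob \<mu>" and "null_arc \<mu> A B" and "B \<le> A + 2 * pi" and "E = A \<or> E = B"
    and "\<And>n. A < \<phi> n" and "\<And>n. \<phi> n < B" and "\<phi> \<longlonglongrightarrow> E"
  shows "(\<lambda>n. (1 - cis (\<phi> n - E)) * resolvent_transform \<mu> (cis (\<phi> n))) \<longlonglongrightarrow> of_real (measure \<mu> {cis (- E)})"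
proof -
  have AB: "A < B" using assms(5,6) by (rule less_trans)
  have "\<forall>\<^sub>F n in sequentially. dist (\<phi> n) E < (B - A) / 2"
    using AB by (intro tendstoD[OF assms(7)]) simp
  then obtain k where k: "\<And>n. n \<ge> k \<Longrightarrow> \<bar>\<phi> n - E\<bar> < (B - A) / 2"
    by (auto simp: eventually_sequentially dist_real_def)
  have "(\<lambda>n. (1 - cis (\<phi> (n + k)) * cis (- E)) * resolvent_transform \<mu> (cis (\<phi> (n + k))))
      \<longlonglongrightarrow> of_real (measure \<mu> {cis (- E)})"
  proof (rule atom_limit[OF assms(1)])
    show "(\<lambda>n. cis (\<phi> (n + k))) \<longlonglongrightarrow> cnj (cis (- E))"
      using LIMSEQ_ignore_initial_segment[OF assms(7), of k] by (auto intro: tendsto_cis simp: cis_cnj)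
    fix n
    \<comment> \<open>From index \<open>k\<close> on, the point lies in the half of the arc adjacent
      to \<open>E\<close>, so its distance \<delta> to \<open>E\<close> is at most that to either
      end. Every carrier parameter then satisfies
      \<open>\<delta> <= y - \<phi> <= 2 * pi - \<delta>\<close>, which makes \<open>E\<close> the
      nearest one.\<close>
    define \<delta> where "\<delta> = \<bar>\<phi> (n + k) - E\<bar>"
    have \<delta>: "0 < \<delta>" "\<delta> \<le> B - \<phi> (n + k)" "\<delta> \<le> \<phi> (n + k) - A"
      using k[of "n + k"] assms(4) assms(5)[of "n + k"] assms(6)[of "n + k"] by (auto simp: \<delta>_def abs_if)
    have sin_E: "norm (1 - cis (\<phi> (n + k)) * cis (- E)) = 2 * sin (\<delta> / 2)"
      using norm_one_minus_cis_abs[of "\<phi> (n + k) - E"] \<delta> assms(3) by (simp add: cis_mult \<delta>_def)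
    show "cis (\<phi> (n + k)) * cis (- E) \<noteq> 1"
    proof
      assume "cis (\<phi> (n + k)) * cis (- E) = 1"
      then have "sin (\<delta> / 2) = 0" using sin_E by simp
      moreover have "0 < sin (\<delta> / 2)" using \<delta> assms(3) by (intro sin_gt_zero) auto
      ultimately show False by simp
    qed
    show "AE x in \<mu>. norm (1 - cis (\<phi> (n + k)) * cis (- E)) \<le> norm (1 - cis (\<phi> (n + k)) * x)"
      using null_arc_AE[OF assms(1,2)]
    proof eventually_elim
      case (elim x)
      then obtain y where y: "B \<le> y" "y \<le> A + 2 * pi" "x = cis (- y)" by blast
      have "sin (\<delta> / 2) \<le> sin ((y - \<phi> (n + k)) / 2)"
        using \<delta> y by (intro sin_le_sin_between) auto
      also have "\<dots> \<le> \<bar>sin ((\<phi> (n + k) - y) / 2)\<bar>"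
      proof -
        have "(y - \<phi> (n + k)) / 2 = - ((\<phi> (n + k) - y) / 2)" by argo
        then show ?thesis by (simp only: sin_minus abs_ge_minus_self)
      qed
      finally show ?case unfolding sin_E by (simp add: y(3) cis_mult norm_one_minus_cis)
    qed
  qed simp
  then have "(\<lambda>n. (1 - cis (\<phi> n) * cis (- E)) * resolvent_transform \<mu> (cis (\<phi> n)))
      \<longlonglongrightarrow> of_real (measure \<mu> {cis (- E)})"
    by (rule LIMSEQ_offset)
  then show ?thesis by (simp add: cis_mult)
qed

lemma circle_lift:
  assumes "continuous_on {S<..<T} f" and "\<And>\<theta>. S < \<theta> \<Longrightarrow> \<theta> < T \<Longrightarrow> norm (f \<theta>) = 1"
  obtains \<phi> :: "real \<Rightarrow> real" where "continuous_on {S<..<T} \<phi>"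
    and "\<forall>\<theta>\<in>{S<..<T}. f \<theta> = cis (\<phi> \<theta>)"
proof -
  have c: "contractible {S<..<T}" by (intro convex_imp_contractible) simp
  have nz: "f \<theta> \<noteq> 0" if "\<theta> \<in> {S<..<T}" for \<theta> using assms(2)[of \<theta>] that by auto
  obtain g where g: "continuous_on {S<..<T} g" "\<forall>\<theta>\<in>{S<..<T}. f \<theta> = exp (g \<theta>)"
    using continuous_logarithm_on_contractible[OF assms(1) c nz] by metis
  show ?thesis
  proof (rule that)
    show "continuous_on {S<..<T} (\<lambda>\<theta>. Im (g \<theta>))" by (intro continuous_intros g(1))
    show "\<forall>\<theta>\<in>{S<..<T}. f \<theta> = cis (Im (g \<theta>))"
    proof
      fix \<theta> assume \<theta>: "\<theta> \<in> {S<..<T}"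
      then have "f \<theta> = exp (g \<theta>)" using g(2) by blast
      moreover from this have "Re (g \<theta>) = 0" using assms(2)[of \<theta>] \<theta> by simp
      ultimately show "f \<theta> = cis (Im (g \<theta>))" by (simp add: exp_eq_polar)
    qed
  qed
qed

context boundary_values
begin

lemma resolvent_transform_gap:
  assumes "S < \<theta>" and "\<theta> < T"
  shows "integrable \<nu> (\<lambda>x. 1 / (1 - cis \<theta> * x))" and "Re (resolvent_transform \<nu> (cis \<theta>)) = 1 / 2"
proof -
  obtain d where "near_const \<theta> \<theta> d"
    by (rule near_const_ex[OF assms(1) order_refl assms(2)])
  note d = near_constD(1,2)[OF this]
  show int: "integrable \<nu> (\<lambda>x. 1 / (1 - cis \<theta> * x))"
  proof (rule N.integrable_const_bound[where B = "1 / d"])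
    show "AE x in \<nu>. norm (1 / (1 - cis \<theta> * x)) \<le> 1 / d"
      using d(2)
    proof eventually_elim
      case (elim x)
      have "norm (cis \<theta> - cis \<theta>) \<le> d" using d(1) by simp
      then have "d \<le> norm (1 - cis \<theta> * x)"
        using elim by (meson atLeastAtMost_iff order_refl)
      then show ?case using d(1) by (simp add: norm_divide frac_le)
    qed
  qed (auto intro!: circle_prob_measurable[OF \<nu>])
  have "AE x in \<nu>. cis \<theta> * x \<noteq> 1"
    using gap unfolding null_arc_def by eventually_elim (use assms in auto)
  then show "Re (resolvent_transform \<nu> (cis \<theta>)) = 1 / 2"
    by (intro Re_resolvent_transform_circle[OF \<nu> _ _ int]) auto
qed

text \<open>Both \<open>Im (resolvent_transform \<nu> (cis \<theta>))\<close> and the corresponding function for \<open>\<mu>\<close> decrease along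
  arcs without mass, so the boundary values move in the same direction as \<open>\<theta>\<close>.\<close>

lemma lift_strict_mono:
  assumes "continuous_on {S<..<T} \<phi>" and "\<forall>\<theta>\<in>{S<..<T}. W \<theta> = cis (\<phi> \<theta>)"
    and "S < \<theta>" and "\<theta> < \<theta>'" and "\<theta>' < T"
  shows "\<phi> \<theta> < \<phi> \<theta>'"
proof (rule ccontr)
  assume "\<not> \<phi> \<theta> < \<phi> \<theta>'"
  then have le: "\<phi> \<theta>' \<le> \<phi> \<theta>" by simp
  have \<theta>: "S < \<theta>" "\<theta> < T" "S < \<theta>'" "\<theta>' < T" using assms(3-5) by auto
  have "AE x in \<nu>. \<forall>\<phi>\<in>{\<theta>..\<theta>'}. cis \<phi> * x \<noteq> 1"
    using gap unfolding null_arc_def by eventually_elim (use assms(3-5) in auto)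
  then have less: "Im (resolvent_transform \<nu> (cis \<theta>')) < Im (resolvent_transform \<nu> (cis \<theta>))"
    by (intro Im_resolvent_transform_strict[OF \<nu> assms(4)] resolvent_transform_gap(1) \<theta>)
  have eq: "resolvent_transform \<mu> (cis (\<phi> t)) = resolvent_transform \<nu> (cis t)"
    "integrable \<mu> (\<lambda>x. 1 / (1 - cis (\<phi> t) * x))" if "S < t" "t < T" for t
    using resolvent_transform_W(1,2)[OF that] assms(2) that by simp_all
  have "\<phi> \<theta>' \<noteq> \<phi> \<theta>" using less eq(1)[OF \<theta>(1,2)] eq(1)[OF \<theta>(3,4)] by auto
  with le have lt: "\<phi> \<theta>' < \<phi> \<theta>" by simp
  \<comment> \<open>By the intermediate value theorem every angle between the two values is attained
    by \<phi>, hence is avoided along with \<open>W\<close>.\<close>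
  have "AE x in \<mu>. \<forall>p\<in>{\<phi> \<theta>'..\<phi> \<theta>}. cis p * x \<noteq> 1"
    using W_avoids
  proof eventually_elim
    case (elim x)
    show ?case
    proof
      fix p assume p: "p \<in> {\<phi> \<theta>'..\<phi> \<theta>}"
      have "continuous_on {\<theta>..\<theta>'} \<phi>" using \<theta> by (intro continuous_on_subset[OF assms(1)]) auto
      then obtain t where "\<theta> \<le> t" "t \<le> \<theta>'" "\<phi> t = p"
        using IVT2'[of \<phi> \<theta>' p \<theta>] p assms(4) by auto
      moreover from this have t: "S < t" "t < T" using \<theta> by auto
      ultimately show "cis p * x \<noteq> 1" using elim assms(2) by (metis greaterThanLessThan_iff)
    qed
  qed
  then have "Im (resolvent_transform \<mu> (cis (\<phi> \<theta>))) < Im (resolvent_transform \<mu> (cis (\<phi> \<theta>')))"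
    by (intro Im_resolvent_transform_strict[OF \<mu> lt] eq(2) \<theta>)
  with less show False using eq(1)[OF \<theta>(1,2)] eq(1)[OF \<theta>(3,4)] by simp
qed

text \<open>The ends are the infimum and supremum of the increasing lift, finite because of
  \<open>l\<close> and \<open>r\<close>; strict monotonicity keeps them from being attained and the
  intermediate value theorem fills the arc. The limits hold along every sequence, since two lifts
  are later followed along the same one.\<close>

lemma lift_arc:
  assumes "S < T" and "continuous_on {S<..<T} \<phi>" and "\<forall>\<theta>\<in>{S<..<T}. W \<theta> = cis (\<phi> \<theta>)"
    and "\<forall>\<theta>\<in>{S<..<T}. l \<le> \<phi> \<theta> \<and> \<phi> \<theta> \<le> (r::real)"
  obtains A B where "A < B" and "null_arc \<mu> A B"
    and "\<forall>\<theta>\<in>{S<..<T}. A < \<phi> \<theta> \<and> \<phi> \<theta> < B"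
    and "\<forall>t :: nat \<Rightarrow> real. range t \<subseteq> {S<..<T} \<longrightarrow> t \<longlonglongrightarrow> S \<longrightarrow> (\<lambda>n. \<phi> (t n)) \<longlonglongrightarrow> A"
    and "\<forall>t :: nat \<Rightarrow> real. range t \<subseteq> {S<..<T} \<longrightarrow> t \<longlonglongrightarrow> T \<longrightarrow> (\<lambda>n. \<phi> (t n)) \<longlonglongrightarrow> B"
proof -
  note mono = lift_strict_mono[OF assms(2,3)]
  define J where "J = \<phi> ` {S<..<T}"
  define A where "A = Inf J"
  define B where "B = Sup J"
  have ne: "J \<noteq> {}" using assms(1) by (simp add: J_def)
  have bdd: "bdd_below J" "bdd_above J"
    using assms(4) by (auto simp: J_def intro!: bdd_belowI[of _ l] bdd_aboveI[of _ r])
  have in_AB: "A < \<phi> \<theta> \<and> \<phi> \<theta> < B" if \<theta>: "S < \<theta>" "\<theta> < T" for \<theta>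
  proof
    have "\<phi> ((S + \<theta>) / 2) \<in> J" "\<phi> ((\<theta> + T) / 2) \<in> J" using \<theta> by (auto simp: J_def)
    then have "A \<le> \<phi> ((S + \<theta>) / 2)" "\<phi> ((\<theta> + T) / 2) \<le> B"
      unfolding A_def B_def using bdd by (auto intro: cInf_lower cSup_upper)
    moreover have "\<phi> ((S + \<theta>) / 2) < \<phi> \<theta>" "\<phi> \<theta> < \<phi> ((\<theta> + T) / 2)" using \<theta> by (auto intro!: mono)
    ultimately show "A < \<phi> \<theta>" "\<phi> \<theta> < B" by auto
  qed
  have below: "\<exists>\<theta>. S < \<theta> \<and> \<theta> < T \<and> \<phi> \<theta> < c" if "A < c" for c
    using that cInf_lessD[OF ne, of c] by (auto simp: A_def J_def)
  have above: "\<exists>\<theta>. S < \<theta> \<and> \<theta> < T \<and> c < \<phi> \<theta>" if "c < B" for c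
    using that less_cSupD[OF ne, of c] by (auto simp: B_def J_def)
  show ?thesis
  proof (rule that[of A B])
    have "S < (S + T) / 2" "(S + T) / 2 < T" using assms(1) by auto
    from in_AB[OF this] show "A < B" by linarith
    show "null_arc \<mu> A B"
      unfolding null_arc_def using W_avoids
    proof eventually_elim
      case (elim x)
      show ?case
      proof (intro allI impI)
        fix p assume "A < p \<and> p < B"
        then obtain \<theta> \<theta>' where \<theta>: "S < \<theta>" "\<theta> < T" "\<phi> \<theta> < p" "S < \<theta>'" "\<theta>' < T" "p < \<phi> \<theta>'"
          using below[of p] above[of p] by blast
        have "\<theta> < \<theta>'"
        proof (rule ccontr)
          assume "\<not> \<theta> < \<theta>'"
          then have "\<theta>' = \<theta> \<or> \<theta>' < \<theta>" by auto
          then show False using mono[of \<theta>' \<theta>] \<theta> by auto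
        qed
        have "continuous_on {\<theta>..\<theta>'} \<phi>" using \<theta> by (intro continuous_on_subset[OF assms(2)]) auto
        then obtain t where "\<theta> \<le> t" "t \<le> \<theta>'" "\<phi> t = p"
          using IVT'[of \<phi> \<theta> p \<theta>'] \<theta> \<open>\<theta> < \<theta>'\<close> by auto
        moreover from this have t: "S < t" "t < T" using \<theta> by auto
        ultimately show "cis p * x \<noteq> 1" using elim assms(3) by (metis greaterThanLessThan_iff)
      qed
    qed
    show "\<forall>\<theta>\<in>{S<..<T}. A < \<phi> \<theta> \<and> \<phi> \<theta> < B" using in_AB by simp
    show "\<forall>t :: nat \<Rightarrow> real. range t \<subseteq> {S<..<T} \<longrightarrow> t \<longlonglongrightarrow> S \<longrightarrow> (\<lambda>n. \<phi> (t n)) \<longlonglongrightarrow> A"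
    proof (intro allI impI order_tendstoI)
      fix t :: "nat \<Rightarrow> real" and c
      assume "range t \<subseteq> {S<..<T}" and that: "t \<longlonglongrightarrow> S"
      then have t: "S < t n" "t n < T" for n by (auto simp: image_subset_iff)
      assume "c < A"
      then have "c < \<phi> (t n)" for n using in_AB[OF t, of n] by linarith
      then show "\<forall>\<^sub>F n in sequentially. c < \<phi> (t n)" by simp
    next
      fix t :: "nat \<Rightarrow> real" and c
      assume "range t \<subseteq> {S<..<T}" and that: "t \<longlonglongrightarrow> S"
      then have t: "S < t n" "t n < T" for n by (auto simp: image_subset_iff)
      assume "A < c"
      then obtain \<theta> where \<theta>: "S < \<theta>" "\<theta> < T" "\<phi> \<theta> < c" using below by blast
      have "\<forall>\<^sub>F n in sequentially. t n < \<theta>" by (rule order_tendstoD(2)[OF that \<theta>(1)])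
      then show "\<forall>\<^sub>F n in sequentially. \<phi> (t n) < c"
      proof eventually_elim
        case (elim n)
        then show ?case using mono[OF t(1) elim \<theta>(2)] \<theta>(3) by linarith
      qed
    qed
    show "\<forall>t :: nat \<Rightarrow> real. range t \<subseteq> {S<..<T} \<longrightarrow> t \<longlonglongrightarrow> T \<longrightarrow> (\<lambda>n. \<phi> (t n)) \<longlonglongrightarrow> B"
    proof (intro allI impI order_tendstoI)
      fix t :: "nat \<Rightarrow> real" and c
      assume "range t \<subseteq> {S<..<T}" and that: "t \<longlonglongrightarrow> T"
      then have t: "S < t n" "t n < T" for n by (auto simp: image_subset_iff)
      assume "B < c"
      then have "\<phi> (t n) < c" for n using in_AB[OF t, of n] by linarith
      then show "\<forall>\<^sub>F n in sequentially. \<phi> (t n) < c" by simp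
    next
      fix t :: "nat \<Rightarrow> real" and c
      assume "range t \<subseteq> {S<..<T}" and that: "t \<longlonglongrightarrow> T"
      then have t: "S < t n" "t n < T" for n by (auto simp: image_subset_iff)
      assume "c < B"
      then obtain \<theta> where \<theta>: "S < \<theta>" "\<theta> < T" "c < \<phi> \<theta>" using above by blast
      have "\<forall>\<^sub>F n in sequentially. \<theta> < t n" by (rule order_tendstoD(1)[OF that \<theta>(2)])
      then show "\<forall>\<^sub>F n in sequentially. c < \<phi> (t n)"
      proof eventually_elim
        case (elim n)
        then show ?case using mono[OF \<theta>(1) elim t(2)] \<theta>(3) by linarith
      qed
    qed
  qed
qed

end

section \<open>The mass relation at the ends and the contradiction\<close>

text \<open>The telescoping \<open>(1 - a) G + a (1 - b) G = G - a b G\<close> meets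
  \<open>a b G = c G - c\<close>, so the sum equals \<open>(1 - c) G + c\<close>. The trailing
  \<open>c\<close>, which tends to 1, is the surplus in the relation.\<close>

lemma mass_relation:
  fixes a b c G :: "nat \<Rightarrow> complex" and p q m :: real
  assumes "(\<lambda>n. (1 - a n) * G n) \<longlonglongrightarrow> of_real p" and "(\<lambda>n. (1 - b n) * G n) \<longlonglongrightarrow> of_real q"
    and "(\<lambda>n. (1 - c n) * G n) \<longlonglongrightarrow> of_real m"
    and "a \<longlonglongrightarrow> 1" and "c \<longlonglongrightarrow> 1" and "\<And>n. G n \<noteq> 0"
    and "\<And>n. a n * b n = c n * (1 - 1 / G n)"
  shows "p + q = m + 1"
proof -
  have "(\<lambda>n. (1 - a n) * G n + a n * ((1 - b n) * G n)) \<longlonglongrightarrow> of_real p + 1 * of_real q"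
    by (intro tendsto_intros assms)
  moreover have "(\<lambda>n. (1 - c n) * G n + c n) \<longlonglongrightarrow> of_real m + 1"
    by (intro tendsto_intros assms)
  moreover have "(1 - a n) * G n + a n * ((1 - b n) * G n) = (1 - c n) * G n + c n" for n
  proof -
    have "(1 - a n) * G n + a n * ((1 - b n) * G n) = G n - (a n * b n) * G n" by (simp add: algebra_simps)
    also have "\<dots> = (1 - c n) * G n + c n"
      unfolding assms(7) using assms(6)[of n] by (simp add: field_simps)
    finally show ?thesis .
  qed
  ultimately have "complex_of_real p + 1 * of_real q = of_real m + 1"
    by (simp only: LIMSEQ_unique)
  then have "complex_of_real (p + q) = of_real (m + 1)" by simp
  then show ?thesis by (simp only: of_real_eq_iff)
qed

theorem free_subordination_boundary:
  assumes \<mu>1: "circle_prob \<mu>1" and \<mu>2: "circle_prob \<mu>2" and \<nu>: "circle_prob \<nu>"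
    and w1: "w1 holomorphic_on ball 0 1" "\<And>z. norm z < 1 \<Longrightarrow> norm (w1 z) \<le> norm z"
      "\<And>z. norm z < 1 \<Longrightarrow> resolvent_transform \<mu>1 (w1 z) = resolvent_transform \<nu> z"
    and w2: "w2 holomorphic_on ball 0 1" "\<And>z. norm z < 1 \<Longrightarrow> norm (w2 z) \<le> norm z"
      "\<And>z. norm z < 1 \<Longrightarrow> resolvent_transform \<mu>2 (w2 z) = resolvent_transform \<nu> z"
    and w12: "\<And>z. norm z < 1 \<Longrightarrow> w1 z * w2 z * resolvent_transform \<nu> z = z * (resolvent_transform \<nu> z - 1)"
    and "S < T" and T_le: "T \<le> S + 2 * pi" and gap: "null_arc \<nu> S T"
    and atoms: "0 < measure \<nu> {cis (- S)}" "0 < measure \<nu> {cis (- T)}"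
  shows "is_point_mass \<mu>1 \<or> is_point_mass \<mu>2"
proof -
  interpret B1: boundary_values \<mu>1 \<nu> w1 S T
    by unfold_locales (use \<mu>1 \<nu> T_le gap w1 in auto)
  interpret B2: boundary_values \<mu>2 \<nu> w2 S T
    by unfold_locales (use \<mu>2 \<nu> T_le gap w2 in auto)
  define G where "G \<theta> = resolvent_transform \<nu> (cis \<theta>)" for \<theta>
  have Re_G: "Re (G \<theta>) = 1 / 2" if "S < \<theta>" "\<theta> < T" for \<theta>
    using B1.resolvent_transform_gap(2)[OF that] by (simp add: G_def)
  have G0: "G \<theta> \<noteq> 0" if "S < \<theta>" "\<theta> < T" for \<theta> using Re_G[OF that] by auto
  have prod: "B1.W \<theta> * B2.W \<theta> = cis \<theta> * (1 - 1 / G \<theta>)" if \<theta>: "S < \<theta>" "\<theta> < T" for \<theta>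
  proof -
    define z where "z n = of_real (radii n) * cis \<theta>" for n
    have lim: "(\<lambda>n. w1 (z n)) \<longlonglongrightarrow> B1.W \<theta>" "(\<lambda>n. w2 (z n)) \<longlonglongrightarrow> B2.W \<theta>"
      "(\<lambda>n. resolvent_transform \<nu> (z n)) \<longlonglongrightarrow> G \<theta>" "z \<longlonglongrightarrow> cis \<theta>"
      using B1.W_tendsto[OF \<theta>] B2.W_tendsto[OF \<theta>] B1.resolvent_transform_W(3)[OF \<theta>]
        radii_cis_tendsto[of \<theta>] by (simp_all add: z_def[abs_def] G_def)
    have "(\<lambda>n. w1 (z n) * w2 (z n) * resolvent_transform \<nu> (z n)) \<longlonglongrightarrow> B1.W \<theta> * B2.W \<theta> * G \<theta>"
      by (intro tendsto_intros lim)
    moreover have "(\<lambda>n. z n * (resolvent_transform \<nu> (z n) - 1)) \<longlonglongrightarrow> cis \<theta> * (G \<theta> - 1)"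
      by (intro tendsto_intros lim)
    ultimately have "B1.W \<theta> * B2.W \<theta> * G \<theta> = cis \<theta> * (G \<theta> - 1)"
      using w12[of "z _"] radii_cis_norm by (simp add: z_def LIMSEQ_unique)
    then have "B1.W \<theta> * B2.W \<theta> = cis \<theta> * (G \<theta> - 1) / G \<theta>" using G0[OF \<theta>] by (simp add: field_simps)
    then show ?thesis using G0[OF \<theta>] by (simp add: diff_divide_distrib right_diff_distrib)
  qed
  have G_eq: "G \<theta> = 1 / (1 - B1.W \<theta> * B2.W \<theta> * cis (- \<theta>))"
    and G_ne: "1 - B1.W \<theta> * B2.W \<theta> * cis (- \<theta>) \<noteq> 0" if \<theta>: "S < \<theta>" "\<theta> < T" for \<theta>
  proof -
    have "B1.W \<theta> * B2.W \<theta> * cis (- \<theta>) = (cis \<theta> * cis (- \<theta>)) * (1 - 1 / G \<theta>)"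
      unfolding prod[OF \<theta>] by simp
    then have eq: "1 - B1.W \<theta> * B2.W \<theta> * cis (- \<theta>) = 1 / G \<theta>" by (simp add: cis_mult)
    show "G \<theta> = 1 / (1 - B1.W \<theta> * B2.W \<theta> * cis (- \<theta>))" unfolding eq by simp
    show "1 - B1.W \<theta> * B2.W \<theta> * cis (- \<theta>) \<noteq> 0" unfolding eq using G0[OF \<theta>] by simp
  qed
  have "continuous_on {S<..<T} (\<lambda>\<theta>. 1 / (1 - B1.W \<theta> * B2.W \<theta> * cis (- \<theta>)))"
    by (intro continuous_intros B1.continuous_on_W B2.continuous_on_W) (use G_ne in auto)
  then have G_cont: "continuous_on {S<..<T} G"
    by (rule continuous_on_eq) (use G_eq in auto)
  \<comment> \<open>An explicit continuous angle for \<open>1 - 1 / G\<close>: with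
    \<open>Re G = 1/2\<close> and \<open>t = arctan (2 * Im G)\<close> one has
    \<open>2 * G = cis t / cos t\<close>, hence \<open>1 - 1 / G = - cis (- 2 * t)\<close>.\<close>
  define \<gamma> where "\<gamma> \<theta> = pi - 2 * arctan (2 * Im (G \<theta>))" for \<theta>
  have \<gamma>_bounds: "0 < \<gamma> \<theta>" "\<gamma> \<theta> < 2 * pi" for \<theta>
    using arctan_bounded[of "2 * Im (G \<theta>)"] by (auto simp: \<gamma>_def)
  have cis_\<gamma>: "cis (\<gamma> \<theta>) = 1 - 1 / G \<theta>" if \<theta>: "S < \<theta>" "\<theta> < T" for \<theta>
  proof -
    define t where "t = arctan (2 * Im (G \<theta>))"
    have c: "cos t > 0" unfolding t_def using arctan_bounded by (intro cos_gt_zero_pi) auto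
    have "2 * Im (G \<theta>) = sin t / cos t" using tan_arctan[of "2 * Im (G \<theta>)"] by (simp add: t_def tan_def)
    then have G: "2 * G \<theta> = cis t / of_real (cos t)"
      using Re_G[OF \<theta>] c by (simp add: complex_eq_iff Re_divide_of_real Im_divide_of_real)
    have "G \<theta> = 2 * G \<theta> / 2" by simp
    also have "\<dots> = cis t / (2 * of_real (cos t))" unfolding G by simp
    finally have "G \<theta> = cis t / (2 * of_real (cos t))" .
    then have "1 / G \<theta> = 2 * of_real (cos t) * cis (- t)"
      by (simp add: cis_inverse[symmetric] field_simps)
    also have "2 * complex_of_real (cos t) = cis t + cis (- t)" by (simp add: complex_eq_iff)
    also have "(cis t + cis (- t)) * cis (- t) = 1 + cis (- (2 * t))"
      by (simp add: distrib_right cis_mult)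
    finally have "1 - 1 / G \<theta> = - cis (- (2 * t))" by simp
    also have "\<dots> = cis pi * cis (- (2 * t))" by simp
    also have "\<dots> = cis (\<gamma> \<theta>)" unfolding cis_mult by (simp add: \<gamma>_def t_def)
    finally show ?thesis by simp
  qed
  obtain \<phi>1 where \<phi>1: "continuous_on {S<..<T} \<phi>1" "\<forall>\<theta>\<in>{S<..<T}. B1.W \<theta> = cis (\<phi>1 \<theta>)"
    using circle_lift[OF B1.continuous_on_W B1.norm_W] by metis
  have W1: "B1.W \<theta> = cis (\<phi>1 \<theta>)" if "S < \<theta>" "\<theta> < T" for \<theta> using \<phi>1(2) that by simp
  \<comment> \<open>Defined by difference, so that
    \<open>\<phi>1 + \<phi>2 = \<theta> + \<gamma>\<close> holds exactly; an independent lift would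
    give it only modulo \<open>2 * pi\<close>.\<close>
  define \<phi>2 where "\<phi>2 \<theta> = \<theta> + \<gamma> \<theta> - \<phi>1 \<theta>" for \<theta>
  have \<phi>2_cont: "continuous_on {S<..<T} \<phi>2"
    unfolding \<phi>2_def \<gamma>_def by (intro continuous_intros \<phi>1(1) G_cont)
  have W2: "B2.W \<theta> = cis (\<phi>2 \<theta>)" if \<theta>: "S < \<theta>" "\<theta> < T" for \<theta>
  proof -
    have "cis (\<phi>1 \<theta>) * B2.W \<theta> = cis \<theta> * cis (\<gamma> \<theta>)"
      using prod[OF \<theta>] by (simp only: W1[OF \<theta>] cis_\<gamma>[OF \<theta>])
    also have "\<dots> = cis (\<phi>1 \<theta>) * cis (\<phi>2 \<theta>)" by (simp add: cis_mult \<phi>2_def)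
    finally show ?thesis by simp
  qed
  have \<phi>2: "\<forall>\<theta>\<in>{S<..<T}. B2.W \<theta> = cis (\<phi>2 \<theta>)" using W2 by simp
  note mono1 = B1.lift_strict_mono[OF \<phi>1]
  note mono2 = B2.lift_strict_mono[OF \<phi>2_cont \<phi>2]
  define M where "M = (S + T) / 2"
  have M: "S < M" "M < T" using \<open>S < T\<close> by (auto simp: M_def)
  have sum: "S < \<phi>1 \<theta> + \<phi>2 \<theta>" "\<phi>1 \<theta> + \<phi>2 \<theta> < T + 2 * pi" if "S < \<theta>" "\<theta> < T" for \<theta>
    using that \<gamma>_bounds[of \<theta>] by (auto simp: \<phi>2_def)
  \<comment> \<open>Both lifts increase and their sum is bounded, so past \<open>M\<close> each is
    bounded above by the sum bound minus the other's value at \<open>M\<close>, and before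
    \<open>M\<close> likewise from below.\<close>
  have bds: "(S - \<phi>2 M \<le> \<phi>1 \<theta> \<and> \<phi>1 \<theta> \<le> T + 2 * pi - \<phi>2 M)
      \<and> (S - \<phi>1 M \<le> \<phi>2 \<theta> \<and> \<phi>2 \<theta> \<le> T + 2 * pi - \<phi>1 M)" if \<theta>: "S < \<theta>" "\<theta> < T" for \<theta>
    using sum[OF \<theta>] sum[OF M] mono1[of \<theta> M] mono1[of M \<theta>] mono2[of \<theta> M] mono2[of M \<theta>] \<theta> M
    by (cases \<theta> M rule: linorder_cases) auto
  have bd1: "\<forall>\<theta>\<in>{S<..<T}. S - \<phi>2 M \<le> \<phi>1 \<theta> \<and> \<phi>1 \<theta> \<le> T + 2 * pi - \<phi>2 M"
    and bd2: "\<forall>\<theta>\<in>{S<..<T}. S - \<phi>1 M \<le> \<phi>2 \<theta> \<and> \<phi>2 \<theta> \<le> T + 2 * pi - \<phi>1 M"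
    using bds by simp_all
  obtain A1 B1 where arc1: "A1 < B1" "null_arc \<mu>1 A1 B1"
    "\<forall>\<theta>\<in>{S<..<T}. A1 < \<phi>1 \<theta> \<and> \<phi>1 \<theta> < B1"
    "\<forall>t :: nat \<Rightarrow> real. range t \<subseteq> {S<..<T} \<longrightarrow> t \<longlonglongrightarrow> S \<longrightarrow> (\<lambda>n. \<phi>1 (t n)) \<longlonglongrightarrow> A1"
    "\<forall>t :: nat \<Rightarrow> real. range t \<subseteq> {S<..<T} \<longrightarrow> t \<longlonglongrightarrow> T \<longrightarrow> (\<lambda>n. \<phi>1 (t n)) \<longlonglongrightarrow> B1"
    by (rule B1.lift_arc[OF \<open>S < T\<close> \<phi>1 bd1])
  obtain A2 B2 where arc2: "A2 < B2" "null_arc \<mu>2 A2 B2"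
    "\<forall>\<theta>\<in>{S<..<T}. A2 < \<phi>2 \<theta> \<and> \<phi>2 \<theta> < B2"
    "\<forall>t :: nat \<Rightarrow> real. range t \<subseteq> {S<..<T} \<longrightarrow> t \<longlonglongrightarrow> S \<longrightarrow> (\<lambda>n. \<phi>2 (t n)) \<longlonglongrightarrow> A2"
    "\<forall>t :: nat \<Rightarrow> real. range t \<subseteq> {S<..<T} \<longrightarrow> t \<longlonglongrightarrow> T \<longrightarrow> (\<lambda>n. \<phi>2 (t n)) \<longlonglongrightarrow> B2"
    by (rule B2.lift_arc[OF \<open>S < T\<close> \<phi>2_cont \<phi>2 bd2])
  show ?thesis
  proof (rule ccontr)
    assume no: "\<not> (is_point_mass \<mu>1 \<or> is_point_mass \<mu>2)"
    have len1: "B1 < A1 + 2 * pi"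
      using null_arc_full_point_mass[OF \<mu>1 arc1(2)] no by fastforce
    have len2: "B2 < A2 + 2 * pi"
      using null_arc_full_point_mass[OF \<mu>2 arc2(2)] no by fastforce
    have G1: "resolvent_transform \<mu>1 (cis (\<phi>1 \<theta>)) = G \<theta>" and G2: "resolvent_transform \<mu>2 (cis (\<phi>2 \<theta>)) = G \<theta>"
      if \<theta>: "S < \<theta>" "\<theta> < T" for \<theta>
      using B1.resolvent_transform_W(2)[OF \<theta>] B2.resolvent_transform_W(2)[OF \<theta>]
      by (simp_all add: G_def W1[OF \<theta>] W2[OF \<theta>])
    have masses: "measure \<mu>1 {cis (- E1)} + measure \<mu>2 {cis (- E2)} = measure \<nu> {cis (- E)} + 1"
      if E: "E = S \<or> E = T" "E1 = A1 \<or> E1 = B1" "E2 = A2 \<or> E2 = B2" "0 < measure \<nu> {cis (- E)}"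
        and t: "\<And>n. S < t n" "\<And>n. t n < T" "t \<longlonglongrightarrow> E"
        and lim: "(\<lambda>n. \<phi>1 (t n)) \<longlonglongrightarrow> E1" "(\<lambda>n. \<phi>2 (t n)) \<longlonglongrightarrow> E2" for E E1 E2 and t :: "nat \<Rightarrow> real"
    proof -
      define a where "a n = cis (\<phi>1 (t n) - E1)" for n
      define b where "b n = cis (\<phi>2 (t n) - E2)" for n
      define c where "c n = cis (t n - E)" for n
      define m where "m = measure \<nu> {cis (- E)}"
      have a: "(\<lambda>n. (1 - a n) * G (t n)) \<longlonglongrightarrow> of_real (measure \<mu>1 {cis (- E1)})"
        using atom_limit_arc[OF \<mu>1 arc1(2) less_imp_le[OF len1] E(2), of "\<lambda>n. \<phi>1 (t n)"] arc1(3) t(1,2) lim(1)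
        by (simp add: a_def G1[OF t(1,2)])
      have b: "(\<lambda>n. (1 - b n) * G (t n)) \<longlonglongrightarrow> of_real (measure \<mu>2 {cis (- E2)})"
        using atom_limit_arc[OF \<mu>2 arc2(2) less_imp_le[OF len2] E(3), of "\<lambda>n. \<phi>2 (t n)"] arc2(3) t(1,2) lim(2)
        by (simp add: b_def G2[OF t(1,2)])
      have c: "(\<lambda>n. (1 - c n) * G (t n)) \<longlonglongrightarrow> of_real m"
        using atom_limit_arc[OF \<nu> gap T_le E(1) t] by (simp add: c_def G_def m_def)
      have a1: "a \<longlonglongrightarrow> 1"
      proof -
        have "a \<longlonglongrightarrow> cis (E1 - E1)" unfolding a_def[abs_def] by (intro tendsto_cis tendsto_diff lim tendsto_const)
        then show ?thesis by simp
      qed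
      have c1: "c \<longlonglongrightarrow> 1"
      proof -
        have "c \<longlonglongrightarrow> cis (E - E)" unfolding c_def[abs_def] by (intro tendsto_cis tendsto_diff t(3) tendsto_const)
        then show ?thesis by simp
      qed
      \<comment> \<open>Here the atom of \<nu> enters: \<open>(1 - c n) * G (t n)\<close> has the
        nonzero limit \<open>m\<close> while \<open>1 - c n\<close> tends to 0, so \<open>G\<close>
        blows up at the end of the gap.\<close>
      have inv_G: "(\<lambda>n. 1 / G (t n)) \<longlonglongrightarrow> 0"
      proof -
        have "(\<lambda>n. (1 - c n) / ((1 - c n) * G (t n))) \<longlonglongrightarrow> (1 - 1) / of_real m"
          by (intro tendsto_intros c c1) (use E(4) in \<open>simp add: m_def\<close>)
        moreover have "(1 - c n) / ((1 - c n) * G (t n)) = 1 / G (t n)" for n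
        proof -
          have "0 < \<bar>t n - E\<bar>" "\<bar>t n - E\<bar> < 2 * pi"
            using t(1,2)[of n] E(1) T_le by auto
          then have "0 < norm (1 - c n)"
            unfolding c_def by (subst norm_one_minus_cis_abs) (auto intro!: sin_gt_zero)
          then have "1 - c n \<noteq> 0" by (rule zero_less_norm_iff[THEN iffD1])
          then show ?thesis by (rule nonzero_divide_mult_cancel_left)
        qed
        ultimately show ?thesis by simp
      qed
      have rel: "cis (\<phi>1 (t n)) * cis (\<phi>2 (t n)) = cis (t n) * (1 - 1 / G (t n))" for n
        using prod[OF t(1,2)] by (simp only: W1[OF t(1,2)] W2[OF t(1,2)])
      \<comment> \<open>In the limit the product formula relates the three ends, which allows it to
        be rewritten for the normalised quantities \<open>a\<close>, \<open>b\<close>,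
        \<open>c\<close>.\<close>
      have E12: "cis E1 * cis E2 = cis E"
      proof -
        have "(\<lambda>n. cis (\<phi>1 (t n)) * cis (\<phi>2 (t n))) \<longlonglongrightarrow> cis E1 * cis E2"
          by (intro tendsto_mult tendsto_cis lim)
        moreover have "(\<lambda>n. cis (t n) * (1 - 1 / G (t n))) \<longlonglongrightarrow> cis E * (1 - 0)"
          by (intro tendsto_mult tendsto_cis t(3) tendsto_diff tendsto_const inv_G)
        ultimately show ?thesis unfolding rel by (simp add: LIMSEQ_unique)
      qed
      have "a n * b n = c n * (1 - 1 / G (t n))" for n
      proof -
        have "a n * b n = (cis (\<phi>1 (t n)) * cis (\<phi>2 (t n))) / (cis E1 * cis E2)"
          by (simp add: a_def b_def cis_divide[symmetric])
        also have "\<dots> = c n * (1 - 1 / G (t n))"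
          unfolding rel E12 by (simp add: c_def cis_divide[symmetric])
        finally show ?thesis .
      qed
      from mass_relation[OF a b c a1 c1 G0[OF t(1,2)] this] show ?thesis by (simp add: m_def)
    qed
    \<comment> \<open>Adding 2 keeps the term for \<open>n = 0\<close> strictly inside the gap; with
      1 it would be the opposite end.\<close>
    define t where "t n = S + (T - S) / (of_nat n + 2)" for n :: nat
    define t' where "t' n = T - (T - S) / (of_nat n + 2)" for n :: nat
    have frac: "0 < (T - S) / (of_nat n + 2)" "(T - S) / (of_nat n + 2) < T - S" for n :: nat
    proof -
      show "0 < (T - S) / (of_nat n + 2)" using \<open>S < T\<close> by simp
      have "(T - S) / (of_nat n + 2) < (T - S) / 1"
        using \<open>S < T\<close> by (intro divide_strict_left_mono) auto
      then show "(T - S) / (of_nat n + 2) < T - S" by simp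
    qed
    have t: "S < t n" "t n < T" and t': "S < t' n" "t' n < T" for n
      using frac[of n] by (auto simp: t_def t'_def)
    have "(\<lambda>n. (T - S) / (of_nat n + 2)) \<longlonglongrightarrow> 0" by real_asymp
    from tendsto_add[OF tendsto_const this, of S] tendsto_diff[OF tendsto_const this, of T]
    have t_lim: "t \<longlonglongrightarrow> S" "t' \<longlonglongrightarrow> T" by (simp_all add: t_def[abs_def] t'_def[abs_def])
    have "range t \<subseteq> {S<..<T}" "range t' \<subseteq> {S<..<T}" using t t' by auto
    then have ends: "(\<lambda>n. \<phi>1 (t n)) \<longlonglongrightarrow> A1" "(\<lambda>n. \<phi>2 (t n)) \<longlonglongrightarrow> A2"
      "(\<lambda>n. \<phi>1 (t' n)) \<longlonglongrightarrow> B1" "(\<lambda>n. \<phi>2 (t' n)) \<longlonglongrightarrow> B2"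
      using arc1(4,5) arc2(4,5) t_lim by blast+
    have eq_S: "measure \<mu>1 {cis (- A1)} + measure \<mu>2 {cis (- A2)} = measure \<nu> {cis (- S)} + 1"
      by (rule masses[OF _ _ _ atoms(1) t t_lim(1) ends(1,2)]) auto
    have eq_T: "measure \<mu>1 {cis (- B1)} + measure \<mu>2 {cis (- B2)} = measure \<nu> {cis (- T)} + 1"
      by (rule masses[OF _ _ _ atoms(2) t' t_lim(2) ends(3,4)]) auto
    \<comment> \<open>Distinctness of the two atoms comes from the arc being shorter than the
      circle. It concerns \<mu>1 and \<mu>2 only; the ends of the gap of \<nu> may be one and the
      same atom.\<close>
    have "measure \<mu> {cis (- A)} + measure \<mu> {cis (- B)} \<le> 1"
      if \<mu>: "circle_prob \<mu>" and AB: "A < B" "B < A + 2 * pi" for \<mu> A B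
    proof -
      interpret prob_space \<mu> using \<mu> by (simp add: circle_prob_def)
      have "0 < norm (1 - cis (B - A))"
        using AB by (subst norm_one_minus_cis_abs) (auto intro!: sin_gt_zero)
      moreover have "cis (B - A) = cis (- A) / cis (- B)" by (simp add: cis_divide)
      ultimately have ne: "cis (- A) \<noteq> cis (- B)" by auto
      have "{cis (- A)} \<in> sets \<mu>" "{cis (- B)} \<in> sets \<mu>"
        by (auto intro!: circle_prob_sets[OF \<mu>])
      then have "measure \<mu> ({cis (- A)} \<union> {cis (- B)}) = measure \<mu> {cis (- A)} + measure \<mu> {cis (- B)}"
        using ne by (intro finite_measure_Union) auto
      then show ?thesis by (metis prob_le_1)
    qed
    from this[OF \<mu>1 arc1(1) len1] this[OF \<mu>2 arc2(1) len2] eq_S eq_T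
    show False using atoms by linarith
  qed
qed

theorem theorem4p1:
  fixes \<mu>1 \<mu>2 \<nu> :: "complex measure"
    and I :: "complex set"
    and \<alpha> \<beta> :: complex
  assumes "circle_prob \<mu>1" and "circle_prob \<mu>2"
    and "is_free_mult_convolution TYPE('h::complex_hilbert_space) \<mu>1 \<mu>2 \<nu>"
    and "open_arc I \<alpha> \<beta>"
    and "is_atom \<nu> \<alpha>" and "is_atom \<nu> \<beta>"
    and "measure \<nu> I = 0"
  shows "is_point_mass \<mu>1 \<or> is_point_mass \<mu>2"
proof -
  have \<nu>: "circle_prob \<nu>"
    using assms(3) by (auto simp: is_free_mult_convolution_def unitary_distribution_def)
  obtain s t where st: "s < t" "t \<le> s + 2 * pi" "I = cis ` {s<..<t}" "{\<alpha>, \<beta>} = {cis s, cis t}"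
    using assms(4) by (auto simp: open_arc_def)
  \<comment> \<open>Passing from points \<open>x\<close> of the carrier to arguments
    \<open>z = cnj x\<close> reverses the angles, so \<open>(s, t)\<close> becomes
    \<open>(- t, - s)\<close>.\<close>
  have gap: "null_arc \<nu> (- t) (- s)"
    using null_arc_open_arc[OF \<nu> st(1,2)] assms(7) st(3) by simp
  have "cis s \<in> {\<alpha>, \<beta>}" "cis t \<in> {\<alpha>, \<beta>}" using st(4) by auto
  then have atoms: "0 < measure \<nu> {cis s}" "0 < measure \<nu> {cis t}"
    using assms(5,6) by (auto simp: is_atom_def)
  obtain w1 w2 where w: "w1 holomorphic_on ball 0 1" "w2 holomorphic_on ball 0 1"
    "\<forall>z\<in>ball 0 1. norm (w1 z) \<le> norm z" "\<forall>z\<in>ball 0 1. norm (w2 z) \<le> norm z"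
    "\<forall>z\<in>ball 0 1. resolvent_transform \<mu>1 (w1 z) = resolvent_transform \<nu> z"
    "\<forall>z\<in>ball 0 1. resolvent_transform \<mu>2 (w2 z) = resolvent_transform \<nu> z"
    "\<forall>z\<in>ball 0 1. w1 z * w2 z * resolvent_transform \<nu> z = z * (resolvent_transform \<nu> z - 1)"
    by (rule free_subordination[OF assms(3)])
  show ?thesis
    by (rule free_subordination_boundary[of \<mu>1 \<mu>2 \<nu> w1 w2 "- t" "- s"])
      (use assms(1,2) \<nu> w st gap atoms in auto)
qed

end
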